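(* Let $S=\mathbb{C}[x_0,\dots,x_n]$ with $n\ge 1$, let $f\in S_d$ be a homogeneous polynomial of degree $d$ such that the hypersurface $D: f=0$ in $\mathbb{P}^n$ is singular and has only isolated singularities, and set $T=(n+1)(d-2)$. Assume that $st(D)<ct(D)$, where $st(D)$ and $ct(D)$ are the stability threshold and the coincidence threshold of $D$. Then the following hold. (1) The degree $d$ is odd, $ct(D)=(T+1)/2$ and $st(D)=(T-1)/2$. (2) If in addition $n=2$, then the curve $D: f=0$ is a free divisor.
   Context: $S=\mathbb{C}[x_0,\dots,x_n]$ is the polynomial ring with its standard grading, and $S_r$ is the space of homogeneous polynomials of degree $r$. For $f\in S_d$, the Jacobian ideal $J_f\subset S$ is the ideal generated by the partial derivatives $f_0,\dots,f_n$ of $f$ with respect to $x_0,\dots,x_n$, and the Milnor (Jacobian) algebra is the graded algebra $M(f)=S/J_f$, with degree $k$ component $M(f)_k$. For a hypersurface $D: f=0$ in $\mathbb{P}^n$ of degree $d$ with isolated singularities, $\tau(D)$ denotes the total Tjurina number of $D$, i.e. the sum of the Tjurina numbers of all singular points of $D$. The coincidence threshold is $$ct(D)=\max\{q : \dim M(f)_k=\dim M(f_s)_k \text{ for all } k\le q\},$$ where $f_s\in S_d$ is any homogeneous polynomial of the same degree $d$ such that $f_s=0$ is a smooth hypersurface in $\mathbb{P}^n$. This does not depend on $f_s$, since the Hilbert–Poincaré series of $M(f_s)$ is always $\sum_k \dim M(f_s)_k\,t^k=\left(\frac{1-t^{d-1}}{1-t}\right)^{n+1}$. The stability threshold is $$st(D)=\min\{q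 : \dim M(f)_k=\tau(D) \text{ for all } k\ge q\}.$$ Free divisor (case $n=2$, $D$ a singular reduced plane curve): $D: f=0$ is a free divisor if and only if the Jacobian ideal $J_f$ is a perfect ideal of $S$ (i.e. $S/J_f$ is Cohen–Macaulay). Equivalently, $J_f$ is saturated with respect to the maximal ideal $(x_0,x_1,x_2)$, i.e. $J_f=\widehat{J_f}$ where $\widehat{J_f}$ is the saturation of $J_f$. *)

theory Defs
  imports Complex_Main "HOL-Library.Poly_Mapping" "HOL-Library.Function_Algebras"
    "HOL-Library.Extended_Real"
begin

text \<open>
  Polynomials are finitely supported maps from exponent vectors to \<open>\<complex>\<close>, with the convolution product
  of \<^theory>\<open>HOL-Library.Poly_Mapping\<close>.  The type has countably many variables \<open>x\<^sub>0, x\<^sub>1, \<dots>\<close>; the ring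
  \<open>\<complex>[x\<^sub>0, \<dots>, x\<^sub>n]\<close> is the subset \<open>poly_ring n\<close>.
\<close>

type_synonym monom = "nat \<Rightarrow>\<^sub>0 nat"
type_synonym mpoly = "monom \<Rightarrow>\<^sub>0 complex"

definition mdeg :: "monom \<Rightarrow> nat" where
  "mdeg m = (\<Sum>j\<in>Poly_Mapping.keys m. Poly_Mapping.lookup m j)"

definition Const :: "complex \<Rightarrow> mpoly" where
  "Const c = Poly_Mapping.single 0 c"

definition Var :: "nat \<Rightarrow> mpoly" where
  "Var j = Poly_Mapping.single (Poly_Mapping.single j 1) 1"

definition poly_ring :: "nat \<Rightarrow> mpoly set" where
  "poly_ring n = {p. \<forall>m\<in>Poly_Mapping.keys p. Poly_Mapping.keys m \<subseteq> {..n}}"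

definition homog :: "nat \<Rightarrow> nat \<Rightarrow> mpoly set" where
  "homog n r = {p \<in> poly_ring n. \<forall>m\<in>Poly_Mapping.keys p. mdeg m = r}"

definition pderiv_wrt :: "nat \<Rightarrow> mpoly \<Rightarrow> mpoly" where
  "pderiv_wrt j p =
     (\<Sum>m\<in>Poly_Mapping.keys p.
        Poly_Mapping.single (m - Poly_Mapping.single j 1)
          (of_nat (Poly_Mapping.lookup m j) * Poly_Mapping.lookup p m))"

text \<open>The image of a polynomial under \<open>x\<^sub>j \<mapsto> \<sigma> j\<close>, with coefficients transported along \<open>\<kappa>\<close>.\<close>

definition mpoly_subst ::
    "(complex \<Rightarrow> 'b::comm_semiring_1) \<Rightarrow> (nat \<Rightarrow> 'b) \<Rightarrow> mpoly \<Rightarrow> 'b" where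
  "mpoly_subst \<kappa> \<sigma> p =
     (\<Sum>m\<in>Poly_Mapping.keys p.
        \<kappa> (Poly_Mapping.lookup p m) * (\<Prod>j\<in>Poly_Mapping.keys m. \<sigma> j ^ Poly_Mapping.lookup m j))"

definition mpoly_eval :: "mpoly \<Rightarrow> (nat \<Rightarrow> complex) \<Rightarrow> complex" where
  "mpoly_eval p v = mpoly_subst (\<lambda>c. c) v p"


text \<open>
  Let \<open>W \<subseteq> V\<close> be complex vector spaces with scalar multiplication \<open>sc\<close>.  \<open>quot_basis sc V W B\<close> says
  that the classes of the elements of \<open>B\<close> are distinct and form a finite basis of \<open>V / W\<close>.  The
  dimension of \<open>V / W\<close> is \<open>\<infinity>\<close> when there is no such \<open>B\<close> (the infimum of the empty set).
\<close>

definition quot_basis ::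
    "(complex \<Rightarrow> 'a::ab_group_add \<Rightarrow> 'a) \<Rightarrow> 'a set \<Rightarrow> 'a set \<Rightarrow> 'a set \<Rightarrow> bool" where
  "quot_basis sc V W B \<longleftrightarrow>
     finite B \<and> B \<subseteq> V \<and>
     (\<forall>v\<in>V. \<exists>c. v - (\<Sum>b\<in>B. sc (c b) b) \<in> W) \<and>
     (\<forall>c. (\<Sum>b\<in>B. sc (c b) b) \<in> W \<longrightarrow> (\<forall>b\<in>B. c b = 0))"

definition quot_dim ::
    "(complex \<Rightarrow> 'a::ab_group_add \<Rightarrow> 'a) \<Rightarrow> 'a set \<Rightarrow> 'a set \<Rightarrow> enat" where
  "quot_dim sc V W = Inf {enat (card B) | B. quot_basis sc V W B}"


definition jacobian_ideal :: "nat \<Rightarrow> mpoly \<Rightarrow> mpoly set" where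
  "jacobian_ideal n f =
     {\<Sum>j\<le>n. h j * pderiv_wrt j f | h. \<forall>j\<le>n. h j \<in> poly_ring n}"

text \<open>\<open>dim M(f)\<^sub>k\<close>: the degree \<open>k\<close> component of \<open>S / J\<^sub>f\<close> is \<open>S\<^sub>k / (S\<^sub>k \<inter> J\<^sub>f)\<close>.\<close>

definition milnor_dim :: "nat \<Rightarrow> mpoly \<Rightarrow> nat \<Rightarrow> enat" where
  "milnor_dim n f k =
     quot_dim (\<lambda>c p. Const c * p) (homog n k) (homog n k \<inter> jacobian_ideal n f)"

text \<open>The \<open>k\<close>-th power of the irrelevant ideal \<open>(x\<^sub>0, \<dots>, x\<^sub>n)\<close> is generated by \<open>S\<^sub>k\<close>.\<close>

definition saturation :: "nat \<Rightarrow> mpoly set \<Rightarrow> mpoly set" where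
  "saturation n I = {h \<in> poly_ring n. \<exists>k. \<forall>g\<in>homog n k. g * h \<in> I}"

text \<open>
  For a singular reduced plane curve \<open>f = 0\<close>, being a free divisor means that \<open>S / J\<^sub>f\<close> is
  Cohen-Macaulay, that is, that \<open>J\<^sub>f\<close> is saturated (the quotient has Krull dimension 1).
\<close>

definition free_plane_curve :: "mpoly \<Rightarrow> bool" where
  "free_plane_curve f \<longleftrightarrow> jacobian_ideal 2 f = saturation 2 (jacobian_ideal 2 f)"


text \<open>
  A point of projective \<open>n\<close>-space is represented by its unique vector of homogeneous coordinates
  whose first non-zero coordinate is 1.
\<close>

definition hom_coords :: "nat \<Rightarrow> (nat \<Rightarrow> complex) set" where
  "hom_coords n = {v. (\<forall>j>n. v j = 0) \<and> (\<exists>j. v j \<noteq> 0)}"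

definition chart_index :: "(nat \<Rightarrow> complex) \<Rightarrow> nat" where
  "chart_index v = (LEAST i. v i \<noteq> 0)"

definition proj_space :: "nat \<Rightarrow> (nat \<Rightarrow> complex) set" where
  "proj_space n = {v \<in> hom_coords n. v (chart_index v) = 1}"

definition sing_at :: "nat \<Rightarrow> mpoly \<Rightarrow> (nat \<Rightarrow> complex) \<Rightarrow> bool" where
  "sing_at n f v \<longleftrightarrow> mpoly_eval f v = 0 \<and> (\<forall>j\<le>n. mpoly_eval (pderiv_wrt j f) v = 0)"

definition sing_points :: "nat \<Rightarrow> mpoly \<Rightarrow> (nat \<Rightarrow> complex) set" where
  "sing_points n f = {v \<in> proj_space n. sing_at n f v}"

text \<open>
  The point \<open>[v]\<close> is isolated in the singular locus, in the quotient topology of projective space: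
  all singular \<open>[w]\<close> with \<open>w\<close> close to \<open>v\<close> are equal to \<open>[v]\<close>.  Here \<open>w\<close> ranges over all
  homogeneous coordinates, since the normalised ones do not depend continuously on the point.
\<close>

definition isolated_sing :: "nat \<Rightarrow> mpoly \<Rightarrow> (nat \<Rightarrow> complex) \<Rightarrow> bool" where
  "isolated_sing n f v \<longleftrightarrow>
     v \<in> sing_points n f \<and>
     (\<exists>e>0. \<forall>w\<in>hom_coords n. sing_at n f w \<and> (\<forall>j\<le>n. cmod (w j - v j) < e)
        \<longrightarrow> (\<exists>c. \<forall>j. w j = c * v j))"


text \<open>
  Convergent power series in the variables with index in \<open>I\<close>, as families of coefficients.
  Addition is pointwise, \<open>ps_mult\<close> is the Cauchy product; a polynomial \<open>p\<close> is the series
  \<open>Poly_Mapping.lookup p\<close>.  A power series converges near 0 iff its coefficients are geometrically bounded.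
\<close>

type_synonym mseries = "monom \<Rightarrow> complex"

definition conv_series :: "nat set \<Rightarrow> mseries set" where
  "conv_series I =
     {a. (\<forall>m. \<not> Poly_Mapping.keys m \<subseteq> I \<longrightarrow> a m = 0) \<and>
        (\<exists>C R. 0 < R \<and> (\<forall>m. cmod (a m) \<le> C * R ^ mdeg m))}"

definition ps_mult :: "mseries \<Rightarrow> mseries \<Rightarrow> mseries" where
  "ps_mult a b = (\<lambda>m. \<Sum>(k, l)\<in>{(k, l). k + l = m}. a k * b l)"

text \<open>
  The equation of \<open>f = 0\<close> at \<open>[v]\<close> in the chart \<open>x\<^sub>i = 1\<close>, where \<open>i\<close> is the chart index of \<open>v\<close>; the
  point is moved to the origin.  The local coordinates are the \<open>x\<^sub>j\<close> with \<open>j \<le> n\<close> and \<open>j \<noteq> i\<close>.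
\<close>

definition local_eqn :: "mpoly \<Rightarrow> (nat \<Rightarrow> complex) \<Rightarrow> mpoly" where
  "local_eqn f v =
     mpoly_subst Const
       (\<lambda>j. if j = chart_index v then 1 else Const (v j / v (chart_index v)) + Var j) f"

text \<open>The ideal \<open>(g, \<partial>\<^sub>j g : j \<in> I)\<close> of the ring of convergent power series in the variables in \<open>I\<close>.\<close>

definition tjurina_ideal :: "nat set \<Rightarrow> mpoly \<Rightarrow> mseries set" where
  "tjurina_ideal I g =
     {ps_mult a (Poly_Mapping.lookup g)
        + (\<Sum>j\<in>I. ps_mult (h j) (Poly_Mapping.lookup (pderiv_wrt j g))) | a h.
        a \<in> conv_series I \<and> (\<forall>j\<in>I. h j \<in> conv_series I)}"

definition tjurina_number :: "nat \<Rightarrow> mpoly \<Rightarrow> (nat \<Rightarrow> complex) \<Rightarrow> enat" where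
  "tjurina_number n f v =
     (let I = {..n} - {chart_index v}
      in quot_dim (\<lambda>c a m. c * a m) (conv_series I) (tjurina_ideal I (local_eqn f v)))"

text \<open>When all singular points are isolated there are only finitely many of them.\<close>

definition total_tjurina :: "nat \<Rightarrow> mpoly \<Rightarrow> enat" where
  "total_tjurina n f = (\<Sum>v\<in>sing_points n f. tjurina_number n f v)"


text \<open>
  The maximum and the minimum defining the thresholds are taken in \<^typ>\<open>enat\<close>: they are \<open>\<infinity>\<close>
  if the set in question is unbounded, respectively empty.  The argument \<open>fs\<close> stands for a form of
  the same degree as \<open>f\<close> defining a smooth hypersurface; the threshold does not depend on its choice.
\<close>

definition coincidence_threshold :: "nat \<Rightarrow> mpoly \<Rightarrow> mpoly \<Rightarrow> enat" where
  "coincidence_threshold n f fs =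
     Sup (enat ` {q. \<forall>k\<le>q. milnor_dim n f k = milnor_dim n fs k})"

definition stability_threshold :: "nat \<Rightarrow> mpoly \<Rightarrow> enat" where
  "stability_threshold n f =
     Inf (enat ` {q. \<forall>k\<ge>q. milnor_dim n f k = total_tjurina n f})"

end

theory Submission
  imports Defs
    "HOL-Computational_Algebra.Polynomial_FPS"
    "HOL-Computational_Algebra.Polynomial_Factorial"
    "HOL-Computational_Algebra.Field_as_Ring"
    "HOL-Computational_Algebra.Fundamental_Theorem_Algebra"
    "HOL-Analysis.Continuum_Not_Denumerable"
begin

text \<open>
  Put \<open>e = d - 1\<close>, the degree of the partial derivatives.  The proof compares two Hilbert functions.

  \<^bold>\<open>The smooth form.\<close>  The partial derivatives of \<open>fs\<close> have no common zero, so by the Nullstellensatz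
  (\<open>projective_nullstellensatz\<close>) their ideal contains all forms of some degree.  In a polynomial ring in
  \<open>r\<close> variables, \<open>r\<close> forms of degree \<open>e\<close> with this property generate the same ideal as a regular sequence
  (\<open>regular_basis\<close>).  Hence \<open>dim M(fs)\<^sub>k\<close> is the coefficient \<open>a\<^sub>k\<close> of \<open>t\<^sup>k\<close> in
  \<open>(1 + t + \<dots> + t\<^bsup>e-1\<^esup>)\<^bsup>n+1\<^esup>\<close>.  This polynomial is symmetric of degree \<open>T = (n+1)(d-2)\<close>, and since
  \<open>n \<ge> 1\<close> its coefficients increase strictly up to the middle; so \<open>a\<^sub>k = a\<^sub>k\<^sub>+\<^sub>1 \<noteq> 0\<close> happens only for
  \<open>2k + 1 = T\<close> (\<open>coeff_geom_poly_power_plateau\<close>).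

  \<^bold>\<open>The thresholds.\<close>  If \<open>q = st(D) < ct(D)\<close>, then \<open>dim M(f)\<^sub>k\<close> equals \<open>a\<^sub>k\<close> and equals \<open>\<tau>(D)\<close> for both
  \<open>k = q\<close> and \<open>k = q + 1\<close>.  The value \<open>\<tau>(D)\<close> is not 0: the Jacobian ideal vanishes at a singular point, so it
  contains all forms of degree \<open>k\<close> for no \<open>k\<close>.  Therefore \<open>2q + 1 = T\<close>, and a longer overlap would produce a
  second plateau.  As \<open>T\<close> is odd, so is \<open>d\<close>.

  \<^bold>\<open>Plane curves.\<close>  For \<open>n = 2\<close> and \<open>d = 2m + 1\<close> this gives \<open>dim M(f)\<^sub>k = a\<^bsub>3m-1\<^esub> = 3m\<^sup>2\<close> for all
  \<open>k \<ge> 3m - 2\<close>.  Rank and nullity turn these dimensions into dimensions of the spaces of syzygies of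
  \<open>f\<^sub>0, f\<^sub>1, f\<^sub>2\<close>: there are none in degree \<open>m - 1\<close>, and in degree \<open>m + i\<close> the dimension is \<open>2 dim S\<^sub>i\<close>.
  Two basis elements \<open>\<rho>, \<sigma>\<close> of the space in degree \<open>m\<close> are independent over \<open>S\<close>, because a relation
  \<open>a\<rho> + b\<sigma> = 0\<close> with coprime coefficients \<open>a, b\<close> makes \<open>\<rho>\<close> a multiple \<open>b\<rho>'\<close> of a syzygy \<open>\<rho>'\<close>, and no nonzero
  syzygy has degree less than \<open>m\<close> (\<open>syz_independent\<close>).  By the dimension count \<open>\<rho>\<close> and \<open>\<sigma>\<close> then generate
  all syzygies (\<open>syz_generated\<close>).  So \<open>S / J\<^sub>f\<close> has a free resolution of length 2 and depth at least 1,
  which is the saturation of \<open>J\<^sub>f\<close>.  The last step is made explicit in \<open>jacobian_socle\<close>.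
\<close>

section \<open>Dimensions of quotient spaces\<close>

text \<open>
  Gaussian elimination: an unknown that occurs in the equation of \<open>b\<close> is solved for and substituted.
\<close>

lemma homogeneous_system_nontrivial_solution:
  fixes c :: "'i \<Rightarrow> 'b \<Rightarrow> complex"
  assumes "finite B" "finite I" "card B < card I"
  shows "\<exists>l. (\<exists>i\<in>I. l i \<noteq> 0) \<and> (\<forall>b\<in>B. (\<Sum>i\<in>I. l i * c i b) = 0)"
  using assms
proof (induction B arbitrary: I c rule: finite_induct)
  case empty
  then obtain i where "i \<in> I" by fastforce
  then show ?case by (intro exI[of _ "\<lambda>_. 1"]) auto
next
  case (insert b B)
  show ?case
  proof (cases "\<forall>i\<in>I. c i b = 0")
    case True
    have "card B < card I" using insert by simp
    then obtain l where "\<exists>i\<in>I. l i \<noteq> 0" "\<forall>b\<in>B. (\<Sum>i\<in>I. l i * c i b) = 0"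
      using insert.IH[of I c] insert.prems by auto
    then show ?thesis using True by (intro exI[of _ l]) auto
  next
    case False
    then obtain k where k: "k \<in> I" "c k b \<noteq> 0" by auto
    define J where "J = I - {k}"
    define c' where "c' i x = c i x - c i b / c k b * c k x" for i x
    have J: "finite J" "card B < card J" "k \<notin> J" "I = insert k J"
      using insert k by (auto simp: J_def)
    obtain l where l: "\<exists>i\<in>J. l i \<noteq> 0" "\<forall>x\<in>B. (\<Sum>i\<in>J. l i * c' i x) = 0"
      using insert.IH[OF J(1,2), of c'] by auto
    define s where "s = (\<Sum>i\<in>J. l i * c i b)"
    define l' where "l' = l(k := - s / c k b)"
    have eq: "(\<Sum>i\<in>I. l' i * c i x) = (\<Sum>i\<in>J. l i * c i x) - s / c k b * c k x" for x
    proof -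
      have "(\<Sum>i\<in>J. l' i * c i x) = (\<Sum>i\<in>J. l i * c i x)"
        using J(3) by (intro sum.cong) (auto simp: l'_def)
      then show ?thesis using J by (simp add: l'_def)
    qed
    have "(\<Sum>i\<in>I. l' i * c i x) = 0" if "x \<in> B" for x
    proof -
      have "0 = (\<Sum>i\<in>J. l i * c i x - (l i * c i b) * (c k x / c k b))"
        using l(2) that by (simp add: c'_def algebra_simps)
      also have "\<dots> = (\<Sum>i\<in>J. l i * c i x) - s * (c k x / c k b)"
        by (simp only: sum_subtractf s_def sum_distrib_right)
      finally show ?thesis by (simp add: eq)
    qed
    moreover have "(\<Sum>i\<in>I. l' i * c i b) = 0"
      using k by (simp add: eq s_def)
    moreover have "\<exists>i\<in>I. l' i \<noteq> 0"
    proof -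
      obtain i where "i \<in> J" "l i \<noteq> 0" using l(1) by blast
      then show ?thesis using J(3,4) by (intro bexI[of _ i]) (auto simp: l'_def)
    qed
    ultimately show ?thesis by (intro exI[of _ l']) auto
  qed
qed

text \<open>
  A relation instead of a value, so that it also says that the quotient is finite-dimensional.
\<close>

definition has_qdim ::
    "(complex \<Rightarrow> 'a::ab_group_add \<Rightarrow> 'a) \<Rightarrow> 'a set \<Rightarrow> 'a set \<Rightarrow> nat \<Rightarrow> bool" where
  "has_qdim sc V W a \<longleftrightarrow> (\<exists>B. quot_basis sc V W B \<and> card B = a)"

lemma quot_basis_span:
  assumes "quot_basis sc V W B" "v \<in> V"
  obtains c where "v - (\<Sum>b\<in>B. sc (c b) b) \<in> W"
  using assms unfolding quot_basis_def by metis

lemma quot_basis_indep: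
  assumes "quot_basis sc V W B" "(\<Sum>b\<in>B. sc (c b) b) \<in> W" "b \<in> B"
  shows "c b = 0"
  using assms(1) unfolding quot_basis_def using assms(2,3) by simp

locale complex_space = vector_space sc for sc :: "complex \<Rightarrow> 'a::ab_group_add \<Rightarrow> 'a"
begin

text \<open>
  Expanding each \<open>v i\<close> in a basis of the quotient turns the wanted relation into a homogeneous linear
  system with more unknowns than equations.
\<close>

lemma relation_mod:
  assumes W: "subspace W" and d: "has_qdim sc V W a"
    and I: "finite I" "a < card I" and v: "\<And>i. i \<in> I \<Longrightarrow> v i \<in> V"
  shows "\<exists>l. (\<exists>i\<in>I. l i \<noteq> 0) \<and> (\<Sum>i\<in>I. sc (l i) (v i)) \<in> W"
proof -
  obtain B where B: "quot_basis sc V W B" "card B = a" using d by (auto simp: has_qdim_def)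
  have "\<forall>i. \<exists>c. i \<in> I \<longrightarrow> v i - (\<Sum>b\<in>B. sc (c b) b) \<in> W"
    using quot_basis_span[OF B(1) v] by metis
  then obtain c where c: "\<And>i. i \<in> I \<Longrightarrow> v i - (\<Sum>b\<in>B. sc (c i b) b) \<in> W" by metis
  have "finite B" using B(1) by (simp add: quot_basis_def)
  then obtain l where l: "\<exists>i\<in>I. l i \<noteq> 0" "\<forall>b\<in>B. (\<Sum>i\<in>I. l i * c i b) = 0"
    using homogeneous_system_nontrivial_solution[of B I c] I B(2) by auto
  have "(\<Sum>i\<in>I. sc (l i) (v i - (\<Sum>b\<in>B. sc (c i b) b))) \<in> W"
    using c by (intro subspace_sum[OF W] subspace_scale[OF W]) auto
  also have "(\<Sum>i\<in>I. sc (l i) (v i - (\<Sum>b\<in>B. sc (c i b) b))) =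
      (\<Sum>i\<in>I. sc (l i) (v i)) - (\<Sum>i\<in>I. \<Sum>b\<in>B. sc (l i * c i b) b)"
    by (simp add: scale_right_diff_distrib sum_subtractf scale_sum_right)
  also have "(\<Sum>i\<in>I. \<Sum>b\<in>B. sc (l i * c i b) b) = (\<Sum>b\<in>B. sc (\<Sum>i\<in>I. l i * c i b) b)"
    by (subst sum.swap) (simp add: scale_sum_left)
  also have "\<dots> = 0" using l(2) by simp
  finally show ?thesis using l(1) by (intro exI[of _ l]) simp
qed

definition indep_mod :: "'a set \<Rightarrow> 'a set \<Rightarrow> bool" where
  "indep_mod W A \<longleftrightarrow> (\<forall>c. (\<Sum>b\<in>A. sc (c b) b) \<in> W \<longrightarrow> (\<forall>b\<in>A. c b = 0))"

lemma indep_mod_card_le: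
  assumes "subspace W" "has_qdim sc V W a" "finite A" "A \<subseteq> V" "indep_mod W A"
  shows "card A \<le> a"
proof (rule ccontr)
  assume "\<not> card A \<le> a"
  then obtain l where "\<exists>i\<in>A. l i \<noteq> 0" "(\<Sum>i\<in>A. sc (l i) i) \<in> W"
    using relation_mod[OF assms(1,2,3), of "\<lambda>x. x"] assms(4) by auto
  then show False using assms(5) by (auto simp: indep_mod_def)
qed

lemma has_qdim_unique:
  assumes "subspace W" "has_qdim sc V W a" "has_qdim sc V W b"
  shows "a = b"
proof -
  obtain A B where "quot_basis sc V W A" "card A = a" "quot_basis sc V W B" "card B = b"
    using assms by (auto simp: has_qdim_def)
  moreover have "card B \<le> a"
    using indep_mod_card_le[OF assms(1,2), of B] calculation
    unfolding quot_basis_def indep_mod_def by blast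
  moreover have "card A \<le> b"
    using indep_mod_card_le[OF assms(1,3), of A] calculation
    unfolding quot_basis_def indep_mod_def by blast
  ultimately show ?thesis by simp
qed

lemma quot_dim_eq:
  assumes "subspace W" "has_qdim sc V W a"
  shows "quot_dim sc V W = enat a"
proof -
  have "{enat (card B) | B. quot_basis sc V W B} = {enat a}"
  proof (intro equalityI subsetI)
    fix x assume "x \<in> {enat (card B) | B. quot_basis sc V W B}"
    then obtain B where B: "quot_basis sc V W B" "x = enat (card B)" by blast
    then have "has_qdim sc V W (card B)" unfolding has_qdim_def by blast
    from has_qdim_unique[OF assms this] show "x \<in> {enat a}" using B by simp
  next
    fix x assume "x \<in> {enat a}"
    then show "x \<in> {enat (card B) | B. quot_basis sc V W B}"
      using assms(2) unfolding has_qdim_def by blast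
  qed
  then show ?thesis by (simp add: quot_dim_def)
qed

text \<open>
  Bounded cardinality gives an independent set of maximal size, and maximality makes it spanning.
\<close>

lemma has_qdim_exists:
  assumes V: "subspace V" and W: "subspace W"
    and bound: "\<And>A. finite A \<Longrightarrow> A \<subseteq> V \<Longrightarrow> indep_mod W A \<Longrightarrow> card A \<le> N"
  shows "\<exists>a. has_qdim sc V W a"
proof -
  define P where "P A \<longleftrightarrow> finite A \<and> A \<subseteq> V \<and> indep_mod W A" for A
  have "P {}" by (simp add: P_def indep_mod_def)
  moreover have "\<forall>A. P A \<longrightarrow> card A < Suc N" using bound by (simp add: P_def less_Suc_eq_le)
  ultimately have "\<exists>A. P A \<and> (\<forall>A'. P A' \<longrightarrow> card A' \<le> card A)"
    using ex_has_greatest_nat[of P "{}" card "Suc N"] by simp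
  then obtain A where A: "P A" and mx: "\<And>A'. P A' \<Longrightarrow> card A' \<le> card A" by metis
  have fin: "finite A" and sub: "A \<subseteq> V" and ind: "indep_mod W A" using A by (auto simp: P_def)
  have "\<exists>c. v - (\<Sum>b\<in>A. sc (c b) b) \<in> W" if v: "v \<in> V" for v
  proof (cases "v \<in> A")
    case True
    have "(\<Sum>b\<in>A. sc (if b = v then 1 else 0) b) = (\<Sum>b\<in>A. if b = v then b else 0)"
      by (intro sum.cong) auto
    also have "\<dots> = v" using True fin by simp
    finally show ?thesis
      using subspace_0[OF W] by (intro exI[of _ "\<lambda>b. if b = v then 1 else 0"]) simp
  next
    case False
    then have "\<not> P (insert v A)" using mx[of "insert v A"] fin by auto
    then obtain c where c: "(\<Sum>b\<in>insert v A. sc (c b) b) \<in> W" "\<exists>b\<in>insert v A. c b \<noteq> 0"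
      using fin sub v by (auto simp: P_def indep_mod_def)
    have eq: "(\<Sum>b\<in>insert v A. sc (c b) b) = sc (c v) v + (\<Sum>b\<in>A. sc (c b) b)"
      using False fin by simp
    have cv: "c v \<noteq> 0"
    proof
      assume "c v = 0"
      then have "(\<Sum>b\<in>A. sc (c b) b) \<in> W" using c(1) eq by simp
      then show False using ind c(2) \<open>c v = 0\<close> by (auto simp: indep_mod_def)
    qed
    have "sc (1 / c v) (sc (c v) v + (\<Sum>b\<in>A. sc (c b) b)) \<in> W"
      using subspace_scale[OF W] c(1) eq by simp
    also have "sc (1 / c v) (sc (c v) v + (\<Sum>b\<in>A. sc (c b) b)) =
        v - (\<Sum>b\<in>A. sc (- c b / c v) b)"
      using cv by (simp add: scale_right_distrib scale_sum_right sum_negf)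
    finally show ?thesis by (intro exI[of _ "\<lambda>b. - c b / c v"])
  qed
  then have "quot_basis sc V W A"
    using fin sub ind by (simp add: quot_basis_def indep_mod_def)
  then show ?thesis by (auto simp: has_qdim_def)
qed

lemma has_qdim_add:
  assumes V: "subspace V" and U: "subspace U" and W: "subspace W" and sub: "W \<subseteq> U" "U \<subseteq> V"
    and d: "has_qdim sc U W a" "has_qdim sc V U b"
  shows "has_qdim sc V W (a + b)"
proof -
  obtain A B where A: "quot_basis sc U W A" "card A = a" and B: "quot_basis sc V U B" "card B = b"
    using d by (auto simp: has_qdim_def)
  have fin: "finite A" "finite B" and AU: "A \<subseteq> U" and BV: "B \<subseteq> V"
    using A B by (auto simp: quot_basis_def)
  have disj: "A \<inter> B = {}"
  proof (rule ccontr)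
    assume "A \<inter> B \<noteq> {}"
    then obtain x where x: "x \<in> A" "x \<in> B" by auto
    have "(\<Sum>b\<in>B. sc (if b = x then 1 else 0) b) = (\<Sum>b\<in>B. if b = x then b else 0)"
      by (intro sum.cong) auto
    also have "\<dots> \<in> U" using x fin AU by auto
    finally show False using quot_basis_indep[OF B(1), of _ x] x(2) by fastforce
  qed
  have split: "(\<Sum>x\<in>A\<union>B. sc (c x) x) = (\<Sum>x\<in>A. sc (c x) x) + (\<Sum>x\<in>B. sc (c x) x)" for c
    using fin disj by (rule sum.union_disjoint)
  have span: "\<exists>c. v - (\<Sum>x\<in>A\<union>B. sc (c x) x) \<in> W" if v: "v \<in> V" for v
  proof -
    obtain c1 where c1: "v - (\<Sum>x\<in>B. sc (c1 x) x) \<in> U"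
      using quot_basis_span[OF B(1) v] .
    obtain c2 where c2: "v - (\<Sum>x\<in>B. sc (c1 x) x) - (\<Sum>x\<in>A. sc (c2 x) x) \<in> W"
      using quot_basis_span[OF A(1) c1] .
    define c where "c x = (if x \<in> A then c2 x else c1 x)" for x
    have "(\<Sum>x\<in>A. sc (c x) x) = (\<Sum>x\<in>A. sc (c2 x) x)"
      by (intro sum.cong) (auto simp: c_def)
    moreover have "(\<Sum>x\<in>B. sc (c x) x) = (\<Sum>x\<in>B. sc (c1 x) x)"
      using disj by (intro sum.cong) (auto simp: c_def)
    ultimately have "v - (\<Sum>x\<in>A\<union>B. sc (c x) x) \<in> W"
      using c2 by (simp add: split diff_diff_eq add.commute)
    then show ?thesis by blast
  qed
  have ind: "\<forall>x\<in>A\<union>B. c x = 0" if h: "(\<Sum>x\<in>A\<union>B. sc (c x) x) \<in> W" for c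
  proof -
    have "(\<Sum>x\<in>A. sc (c x) x) \<in> U"
      using AU by (intro subspace_sum[OF U] subspace_scale[OF U]) auto
    then have "(\<Sum>x\<in>A. sc (c x) x) + (\<Sum>x\<in>B. sc (c x) x) - (\<Sum>x\<in>A. sc (c x) x) \<in> U"
      using h sub(1) by (intro subspace_diff[OF U]) (auto simp: split)
    then have "(\<Sum>x\<in>B. sc (c x) x) \<in> U" by simp
    then have cB: "\<forall>x\<in>B. c x = 0" using B(1) by (simp add: quot_basis_def)
    then have "(\<Sum>x\<in>A. sc (c x) x) \<in> W" using h by (simp add: split)
    then show ?thesis using A(1) cB by (auto simp: quot_basis_def)
  qed
  have "quot_basis sc V W (A \<union> B)"
    unfolding quot_basis_def
  proof (intro conjI ballI allI impI)
    show "finite (A \<union> B)" "A \<union> B \<subseteq> V" using fin AU BV sub by auto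
  qed (use span ind in auto)
  moreover have "card (A \<union> B) = a + b" using A B fin disj by (simp add: card_Un_disjoint)
  ultimately show ?thesis by (auto simp: has_qdim_def)
qed

lemma has_qdim_split:
  assumes V: "subspace V" and U: "subspace U" and W: "subspace W" and sub: "W \<subseteq> U" "U \<subseteq> V"
    and d: "has_qdim sc V W a"
  obtains u v where "has_qdim sc U W u" "has_qdim sc V U v" "a = u + v"
proof -
  obtain u where u: "has_qdim sc U W u"
    using has_qdim_exists[OF U W, of a] indep_mod_card_le[OF W d] sub(2) by blast
  have "indep_mod W A" if "indep_mod U A" for A
    using that sub(1) by (auto simp: indep_mod_def)
  then obtain v where v: "has_qdim sc V U v"
    using has_qdim_exists[OF V U, of a] indep_mod_card_le[OF W d] by blast
  have "a = u + v"
    using has_qdim_unique[OF W d has_qdim_add[OF V U W sub u v]] .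
  with u v that show ?thesis by blast
qed

lemma has_qdim_0_iff:
  shows "has_qdim sc V W 0 \<longleftrightarrow> V \<subseteq> W"
proof
  assume "has_qdim sc V W 0"
  then obtain B where "quot_basis sc V W B" "card B = 0" by (auto simp: has_qdim_def)
  then show "V \<subseteq> W" by (auto simp: quot_basis_def)
next
  assume "V \<subseteq> W"
  then have "quot_basis sc V W {}" by (auto simp: quot_basis_def)
  then show "has_qdim sc V W 0" by (auto simp: has_qdim_def)
qed

lemma subspace_eq_if_dim_eq:
  assumes "subspace V" "subspace U" "subspace W" "W \<subseteq> U" "U \<subseteq> V"
    and "has_qdim sc V W a" "has_qdim sc U W a"
  shows "U = V"
proof -
  obtain u v where uv: "has_qdim sc U W u" "has_qdim sc V U v" "a = u + v"
    by (rule has_qdim_split[OF assms(1-6)])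
  have "u = a" using has_qdim_unique[OF assms(3) uv(1) assms(7)] .
  then have "V \<subseteq> U" using uv has_qdim_0_iff by simp
  then show ?thesis using assms(5) by blast
qed

lemma has_qdim_span:
  assumes "finite S" "subspace W" "\<And>v. v \<in> V \<Longrightarrow> \<exists>c. v - (\<Sum>b\<in>S. sc (c b) b) \<in> W"
    and "\<And>c. (\<Sum>b\<in>S. sc (c b) b) \<in> W \<Longrightarrow> \<forall>b\<in>S. c b = 0" "S \<subseteq> V"
  shows "has_qdim sc V W (card S)"
  using assms by (auto simp: has_qdim_def quot_basis_def)

end

text \<open>
  The hypotheses say that \<open>\<phi>\<close> induces an isomorphism from \<open>V / W\<close> to \<open>V' / W'\<close>.
\<close>

lemma has_qdim_transfer:
  assumes "complex_space sc" "complex_space sc'"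
    and W': "module.subspace sc' W'"
    and add: "\<And>u v. \<phi> (u + v) = \<phi> u + \<phi> v" and scale: "\<And>c v. \<phi> (sc c v) = sc' c (\<phi> v)"
    and V: "module.subspace sc V"
    and into: "\<And>v. v \<in> V \<Longrightarrow> \<phi> v \<in> V'"
    and onto: "\<And>w. w \<in> V' \<Longrightarrow> \<exists>v\<in>V. w - \<phi> v \<in> W'"
    and ker: "\<And>v. v \<in> V \<Longrightarrow> \<phi> v \<in> W' \<longleftrightarrow> v \<in> W"
    and d: "has_qdim sc V W a"
  shows "has_qdim sc' V' W' a"
proof -
  interpret s: complex_space sc by fact
  interpret t: complex_space sc' by fact
  interpret hom: module_hom sc sc' \<phi>
    by unfold_locales (auto simp: add scale)
  obtain B where B: "quot_basis sc V W B" "card B = a" using d by (auto simp: has_qdim_def)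
  have fin: "finite B" and BV: "B \<subseteq> V" using B by (auto simp: quot_basis_def)
  have sumV: "(\<Sum>b\<in>B. sc (c b) b) \<in> V" for c
    using BV by (intro s.subspace_sum[OF V] s.subspace_scale[OF V]) auto
  have lin: "\<phi> (\<Sum>b\<in>B. sc (c b) b) = (\<Sum>b\<in>B. sc' (c b) (\<phi> b))" for c
    by (simp add: hom.sum scale)
  have inj: "inj_on \<phi> B"
  proof (rule inj_onI, rule ccontr)
    fix x y assume xy: "x \<in> B" "y \<in> B" "\<phi> x = \<phi> y" "x \<noteq> y"
    define c :: "'a \<Rightarrow> complex" where "c b = (if b = x then 1 else if b = y then -1 else 0)" for b
    have "(\<Sum>b\<in>B. sc (c b) b) = (\<Sum>b\<in>{x,y}. sc (c b) b)"
      using xy fin by (intro sum.mono_neutral_right) (auto simp: c_def)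
    also have "\<dots> = x - y" using xy by (simp add: c_def)
    finally have "(\<Sum>b\<in>B. sc (c b) b) = x - y" .
    moreover have "\<phi> (x - y) = 0" using xy by (simp add: hom.diff)
    ultimately have "(\<Sum>b\<in>B. sc (c b) b) \<in> W"
      using ker[OF sumV[of c]] t.subspace_0[OF W'] by simp
    then have "c x = 0" using B(1) xy by (simp add: quot_basis_def)
    then show False by (simp add: c_def)
  qed
  have re: "(\<Sum>b\<in>\<phi>`B. sc' (c b) b) = \<phi> (\<Sum>b\<in>B. sc (c (\<phi> b)) b)" for c
    by (simp add: lin sum.reindex[OF inj])
  have "\<exists>c. w - (\<Sum>b\<in>\<phi>`B. sc' (c b) b) \<in> W'" if w: "w \<in> V'" for w
  proof -
    obtain v where v: "v \<in> V" "w - \<phi> v \<in> W'" using onto w by blast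
    obtain c where c: "v - (\<Sum>b\<in>B. sc (c b) b) \<in> W"
      using quot_basis_span[OF B(1) v(1)] .
    define c' where "c' y = c (the_inv_into B \<phi> y)" for y
    have "(\<Sum>b\<in>B. sc (c' (\<phi> b)) b) = (\<Sum>b\<in>B. sc (c b) b)"
      by (intro sum.cong) (auto simp: c'_def the_inv_into_f_f[OF inj])
    moreover have "\<phi> (v - (\<Sum>b\<in>B. sc (c b) b)) \<in> W'"
      using ker[OF s.subspace_diff[OF V v(1) sumV]] c by blast
    then have "(w - \<phi> v) + \<phi> (v - (\<Sum>b\<in>B. sc (c b) b)) \<in> W'"
      using v by (intro t.subspace_add[OF W'])
    ultimately have "w - (\<Sum>b\<in>\<phi>`B. sc' (c' b) b) \<in> W'"
      by (simp add: re hom.diff)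
    then show ?thesis by blast
  qed
  moreover have "\<forall>b\<in>\<phi>`B. c b = 0" if "(\<Sum>b\<in>\<phi>`B. sc' (c b) b) \<in> W'" for c
    using that ker[OF sumV[of "\<lambda>b. c (\<phi> b)"]] B(1) by (auto simp: re quot_basis_def)
  ultimately have "quot_basis sc' V' W' (\<phi> ` B)"
    using fin BV into by (auto simp: quot_basis_def)
  moreover have "card (\<phi> ` B) = a" using B inj by (simp add: card_image)
  ultimately show ?thesis by (auto simp: has_qdim_def)
qed

section \<open>Homogeneous components and ideals\<close>

abbreviation (input) lookup where "lookup \<equiv> Poly_Mapping.lookup"
abbreviation (input) keys where "keys \<equiv> Poly_Mapping.keys"
abbreviation (input) single where "single \<equiv> Poly_Mapping.single"

lemma sum_monomials: "(\<Sum>m\<in>keys p. single m (lookup p m)) = p"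
proof (rule poly_mapping_eqI)
  fix k
  have "lookup (\<Sum>m\<in>keys p. single m (lookup p m)) k = (\<Sum>m\<in>keys p. if m = k then lookup p m else 0)"
    by (auto simp: lookup_sum lookup_single when_def intro!: sum.cong)
  also have "\<dots> = lookup p k" by (simp add: in_keys_iff)
  finally show "lookup (\<Sum>m\<in>keys p. single m (lookup p m)) k = lookup p k" .
qed

lemma keys_add_monom: "keys (a + b :: monom) = keys a \<union> keys b"
  by (auto simp: in_keys_iff lookup_add)

lemma mdeg_superset:
  assumes "finite A" "keys m \<subseteq> A"
  shows "mdeg m = (\<Sum>j\<in>A. lookup m j)"
  unfolding mdeg_def using assms by (intro sum.mono_neutral_left) (auto simp: in_keys_iff)

lemma mdeg_add: "mdeg (a + b) = mdeg a + mdeg b"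
  using mdeg_superset[of "keys a \<union> keys b" a] mdeg_superset[of "keys a \<union> keys b" b]
  by (subst mdeg_superset[of "keys a \<union> keys b"]) (auto simp: keys_add_monom lookup_add sum.distrib)

lemma mdeg_0 [simp]: "mdeg 0 = 0"
  by (simp add: mdeg_def)

lemma mdeg_single [simp]: "mdeg (single j k) = k"
  by (simp add: mdeg_def)

lemma mdeg_eq_0_iff: "mdeg m = 0 \<longleftrightarrow> m = 0"
  by (auto simp: mdeg_def in_keys_iff) (metis keys_eq_empty equals0I in_keys_iff)

lemma lookup_le_mdeg: "lookup m j \<le> mdeg m"
proof (cases "j \<in> keys m")
  case True
  then show ?thesis unfolding mdeg_def by (intro member_le_sum) auto
qed (simp add: in_keys_iff)

definition forms :: "nat \<Rightarrow> mpoly set" where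
  "forms k = {p. \<forall>m\<in>keys p. mdeg m = k}"

definition hcomp :: "nat \<Rightarrow> mpoly \<Rightarrow> mpoly" where
  "hcomp k p = Poly_Mapping.mapp (\<lambda>m c. c when mdeg m = k) p"

text \<open>
  It is convenient to allow all variables in a form, and to treat the restriction to the first variables
  separately.
\<close>

lemma homog_eq: "homog n k = poly_ring n \<inter> forms k"
  by (auto simp: homog_def forms_def)

lemma lookup_hcomp: "lookup (hcomp k p) m = (lookup p m when mdeg m = k)"
  by (simp add: hcomp_def lookup_mapp when_def in_keys_iff)

lemma hcomp_0 [simp]: "hcomp k 0 = 0"
  by (rule poly_mapping_eqI) (simp add: lookup_hcomp)

lemma hcomp_add: "hcomp k (p + q) = hcomp k p + hcomp k q"
  by (rule poly_mapping_eqI) (simp add: lookup_hcomp lookup_add when_add_distrib)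

lemma hcomp_diff: "hcomp k (p - q) = hcomp k p - hcomp k q"
  by (rule poly_mapping_eqI) (simp add: lookup_hcomp lookup_minus when_diff_distrib)

lemma hcomp_sum: "hcomp k (sum f A) = (\<Sum>a\<in>A. hcomp k (f a))"
  by (induction A rule: infinite_finite_induct) (auto simp: hcomp_add)

lemma hcomp_in_forms: "hcomp k p \<in> forms k"
  by (auto simp: forms_def in_keys_iff lookup_hcomp)

lemma hcomp_form: "p \<in> forms e \<Longrightarrow> hcomp k p = (if k = e then p else 0)"
  by (rule poly_mapping_eqI) (auto simp: forms_def in_keys_iff lookup_hcomp when_def)

lemma sum_hcomp: "(\<Sum>k\<in>mdeg ` keys p. hcomp k p) = p"
proof (rule poly_mapping_eqI)
  fix m
  have "lookup (\<Sum>k\<in>mdeg ` keys p. hcomp k p) m =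
      (\<Sum>k\<in>mdeg ` keys p. if mdeg m = k then lookup p m else 0)"
    by (simp add: lookup_sum lookup_hcomp when_def)
  also have "\<dots> = lookup p m" by (auto simp: in_keys_iff)
  finally show "lookup (\<Sum>k\<in>mdeg ` keys p. hcomp k p) m = lookup p m" .
qed

lemma sum_hcomp_superset:
  assumes "finite T" "mdeg ` keys p \<subseteq> T"
  shows "(\<Sum>t\<in>T. hcomp t p) = p"
proof -
  have "(\<Sum>t\<in>T. hcomp t p) = (\<Sum>t\<in>mdeg ` keys p. hcomp t p)"
  proof (rule sum.mono_neutral_right[OF assms], rule ballI, rule poly_mapping_eqI)
    fix t x assume "t \<in> T - mdeg ` keys p"
    then show "lookup (hcomp t p) x = lookup 0 x"
      by (cases "x \<in> keys p") (auto simp: lookup_hcomp when_def in_keys_iff)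
  qed
  then show ?thesis by (simp only: sum_hcomp)
qed

lemma forms_0 [simp]: "0 \<in> forms k"
  by (simp add: forms_def)

lemma forms_add: "p \<in> forms k \<Longrightarrow> q \<in> forms k \<Longrightarrow> p + q \<in> forms k"
  using keys_add[of p q] by (auto simp: forms_def)

lemma forms_minus: "p \<in> forms k \<Longrightarrow> - p \<in> forms k"
  by (auto simp: forms_def in_keys_iff)

lemma forms_diff: "p \<in> forms k \<Longrightarrow> q \<in> forms k \<Longrightarrow> p - q \<in> forms k"
  using forms_add[of p k "- q"] forms_minus[of q k] by simp

lemma forms_sum: "(\<And>a. a \<in> A \<Longrightarrow> f a \<in> forms k) \<Longrightarrow> sum f A \<in> forms k"
  by (induction A rule: infinite_finite_induct) (auto intro: forms_add)

lemma forms_mult: "p \<in> forms a \<Longrightarrow> q \<in> forms b \<Longrightarrow> p * q \<in> forms (a + b)"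
  using keys_mult[of p q] by (fastforce simp: forms_def mdeg_add)

lemma forms_single: "single m c \<in> forms (mdeg m)"
  by (simp add: forms_def)

lemma forms_Const: "Const c \<in> forms 0"
  by (simp add: forms_def Const_def)

lemma forms_one: "1 \<in> forms 0"
  using forms_Const[of 1] by (simp add: Const_def)

lemma forms_Var: "Var j \<in> forms 1"
  by (simp add: forms_def Var_def)

lemma Var_neq_0 [simp]: "Var j \<noteq> 0"
  by (metis Var_def lookup_single_eq lookup_zero zero_neq_one)

lemma forms_power: "p \<in> forms a \<Longrightarrow> p ^ k \<in> forms (a * k)"
  by (induction k) (auto simp: forms_one dest: forms_mult)

lemma forms_prod:
  "(\<And>a. a \<in> A \<Longrightarrow> f a \<in> forms (d a)) \<Longrightarrow> prod f A \<in> forms (sum d A)"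
  by (induction A rule: infinite_finite_induct) (auto simp: forms_one intro: forms_mult)

lemma forms_Const_mult: "p \<in> forms k \<Longrightarrow> Const c * p \<in> forms k"
  using forms_mult[OF forms_Const] by fastforce

lemma hcomp_mult:
  assumes "F \<in> forms e"
  shows "hcomp k (F * p) = (if e \<le> k then F * hcomp (k - e) p else 0)"
proof -
  have *: "hcomp k (F * p) = (\<Sum>j\<in>mdeg ` keys p. if k = e + j then F * hcomp j p else 0)"
  proof -
    have "hcomp k (F * p) = hcomp k (F * (\<Sum>j\<in>mdeg ` keys p. hcomp j p))"
      by (simp only: sum_hcomp)
    also have "\<dots> = (\<Sum>j\<in>mdeg ` keys p. hcomp k (F * hcomp j p))"
      by (simp only: sum_distrib_left hcomp_sum)
    finally show ?thesis
      by (simp only: hcomp_form[OF forms_mult[OF assms hcomp_in_forms]])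
  qed
  show ?thesis
  proof (cases "e \<le> k")
    case True
    have "hcomp (k - e) p = (\<Sum>j\<in>mdeg ` keys p. if k = e + j then hcomp j p else 0)"
    proof -
      have "hcomp (k - e) p = hcomp (k - e) (\<Sum>j\<in>mdeg ` keys p. hcomp j p)"
        by (simp only: sum_hcomp)
      also have "\<dots> = (\<Sum>j\<in>mdeg ` keys p. if k - e = j then hcomp j p else 0)"
        by (simp only: hcomp_sum hcomp_form[OF hcomp_in_forms])
      also have "\<dots> = (\<Sum>j\<in>mdeg ` keys p. if k = e + j then hcomp j p else 0)"
        using True by (intro sum.cong refl if_cong) auto
      finally show ?thesis .
    qed
    then have "F * hcomp (k - e) p = (\<Sum>j\<in>mdeg ` keys p. if k = e + j then F * hcomp j p else 0)"
      by (simp only: sum_distrib_left if_distrib[of "\<lambda>x. F * x"] mult_zero_right)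
    then show ?thesis using True by (simp only: * if_True)
  next
    case False
    then have "(\<Sum>j\<in>mdeg ` keys p. if k = e + j then F * hcomp j p else 0) = 0"
      by (intro sum.neutral) auto
    then show ?thesis using False by (simp only: * if_False)
  qed
qed

abbreviation (input) poly_scale :: "complex \<Rightarrow> mpoly \<Rightarrow> mpoly" where
  "poly_scale \<equiv> \<lambda>c p. Const c * p"

lemma Const_0 [simp]: "Const 0 = 0" and Const_1 [simp]: "Const 1 = 1"
  by (simp_all add: Const_def)

lemma Const_add: "Const (a + b) = Const a + Const b"
  by (simp add: Const_def single_add)

lemma Const_mult: "Const (a * b) = Const a * Const b"
  by (simp add: Const_def mult_single)

lemma Const_power: "Const x ^ k = Const (x ^ k)"
  by (induction k) (auto simp: Const_mult)

lemma Const_prod: "(\<Prod>i\<in>J. Const (g i)) = Const (prod g J)"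
  by (induction J rule: infinite_finite_induct) (auto simp: Const_mult)

lemma Const_sum: "(\<Sum>i\<in>J. Const (g i)) = Const (sum g J)"
  by (induction J rule: infinite_finite_induct) (auto simp: Const_add)

lemma Const_eq_0_iff [simp]: "Const c = 0 \<longleftrightarrow> c = 0"
  by (metis Const_def lookup_single_eq lookup_zero single_zero)

text \<open>
  Ideals are the submodules of the ring over itself; complex subspaces are those for multiplication
  by constants.  The rewrite rule for iterated scalar multiplication runs against associativity and
  is removed in both cases.
\<close>

interpretation ideal: module "(*) :: mpoly \<Rightarrow> mpoly \<Rightarrow> mpoly"
  by unfold_locales (simp_all add: distrib_left distrib_right mult.assoc)

declare ideal.scale_scale [simp del]

interpretation lin: complex_space poly_scale
  by unfold_locales (simp_all add: distrib_left distrib_right mult.assoc Const_add Const_mult)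

declare lin.scale_scale [simp del]

lemma ideal_lin_subspace: "ideal.subspace I \<Longrightarrow> lin.subspace I"
  by (auto simp: ideal.subspace_def lin.subspace_def)

lemma span_lin_subspace [simp]: "lin.subspace (ideal.span A)"
  by (rule ideal_lin_subspace) simp

lemma forms_lin_subspace [simp]: "lin.subspace (forms k)"
  by (auto simp: lin.subspace_def forms_add forms_Const_mult)

lemma ideal_mult_left: "p \<in> ideal.span A \<Longrightarrow> q * p \<in> ideal.span A"
  by (rule ideal.span_scale)

lemma ideal_mult_right: "p \<in> ideal.span A \<Longrightarrow> p * q \<in> ideal.span A"
  using ideal.span_scale[of p A q] by (simp add: mult.commute)

lemma ideal_span_subset: "A \<subseteq> ideal.span B \<Longrightarrow> ideal.span A \<subseteq> ideal.span B"
  by (rule ideal.span_minimal) auto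

definition all_forms :: "mpoly set \<Rightarrow> bool" where
  "all_forms A \<longleftrightarrow> (\<forall>a\<in>A. \<exists>e. a \<in> forms e)"

text \<open>
  For a form \<open>x\<close>, the components of \<open>c * x\<close> are the components of \<open>c\<close> times \<open>x\<close>.
\<close>

lemma hcomp_in_span:
  assumes "all_forms A" "p \<in> ideal.span A"
  shows "hcomp k p \<in> ideal.span A"
  using assms(2)
proof (induction rule: ideal.span_induct_alt)
  case base
  then show ?case by (simp add: ideal.span_zero)
next
  case (step c x y)
  then obtain e where e: "x \<in> forms e" using assms(1) by (auto simp: all_forms_def)
  have "hcomp k (c * x) = (if e \<le> k then hcomp (k - e) c * x else 0)"
    using hcomp_mult[OF e, of k c] by (simp add: mult.commute)
  then have "hcomp k (c * x) \<in> ideal.span A"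
    using step by (auto intro: ideal.span_zero ideal.span_scale ideal.span_base)
  then show ?case using step by (simp add: hcomp_add ideal.span_add)
qed

text \<open>
  The component of degree \<open>k\<close> of any expression \<open>p = g * F + \<dots>\<close> has a form as cofactor.  The difference
  \<open>k - e\<close> is truncated, so the case \<open>k < e\<close> needs its own clause.
\<close>

lemma form_in_span_insert:
  assumes A: "all_forms A" and F: "F \<in> forms e" and p: "p \<in> forms k" "p \<in> ideal.span (insert F A)"
  obtains h where "h \<in> forms (k - e)" "k < e \<Longrightarrow> h = 0" "p - F * h \<in> ideal.span A"
proof -
  obtain g where g: "p - g * F \<in> ideal.span A"
    using p(2) by (auto simp: ideal.span_insert)
  define h where "h = (if e \<le> k then hcomp (k - e) g else 0)"
  have "hcomp k (p - g * F) = p - F * h"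
    using hcomp_mult[OF F, of k g] hcomp_form[OF p(1), of k]
    by (simp add: hcomp_diff h_def mult.commute)
  then have "p - F * h \<in> ideal.span A" using hcomp_in_span[OF A g, of k] by simp
  then show ?thesis by (intro that[of h]) (auto simp: h_def hcomp_in_forms)
qed

lemma lookup_single_mult: "lookup (single k a * p) (k + m) = a * lookup p (m :: 'a::cancel_comm_monoid_add)"
  by (simp add: lookup_mult lookup_single when_mult mult_when)

lemma lookup_Var_mult: "lookup (Var j * p) (single j 1 + m) = lookup p m"
  by (simp add: Var_def lookup_single_mult)

lemma monom_split: "j \<in> keys m \<Longrightarrow> single j 1 + (m - single j 1) = (m :: monom)"
  by (rule poly_mapping_eqI) (auto simp: lookup_add lookup_minus lookup_single when_def in_keys_iff)

text \<open>
  An ideal generated by variables is a monomial ideal: membership is decided monomial by monomial.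
\<close>

lemma span_Var: "ideal.span (Var ` A) = {p. \<forall>m\<in>keys p. keys m \<inter> A \<noteq> {}}"
proof (intro equalityI subsetI)
  fix p :: mpoly assume "p \<in> ideal.span (Var ` A)"
  then show "p \<in> {p. \<forall>m\<in>keys p. keys m \<inter> A \<noteq> {}}"
  proof (induction rule: ideal.span_induct_alt)
    case (step c x y)
    then obtain j where j: "j \<in> A" "x = Var j" by auto
    have "keys m \<inter> A \<noteq> {}" if "m \<in> keys (c * x)" for m
      using that keys_mult[of c x] j by (fastforce simp: Var_def keys_add_monom)
    then show ?case using step keys_add[of "c * x" y] by blast
  qed simp
next
  fix p :: mpoly assume p: "p \<in> {p. \<forall>m\<in>keys p. keys m \<inter> A \<noteq> {}}"
  have "single m (lookup p m) \<in> ideal.span (Var ` A)" if "m \<in> keys p" for m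
  proof -
    obtain j where j: "j \<in> keys m" "j \<in> A" using p \<open>m \<in> keys p\<close> by auto
    have "single m (lookup p m) = single (m - single j 1) (lookup p m) * Var j"
      using monom_split[OF j(1)] by (simp add: Var_def mult_single add.commute)
    then show ?thesis
      using ideal.span_scale[OF ideal.span_base[of "Var j" "Var ` A"]] j by simp
  qed
  then have "(\<Sum>m\<in>keys p. single m (lookup p m)) \<in> ideal.span (Var ` A)"
    by (rule ideal.span_sum)
  then show "p \<in> ideal.span (Var ` A)" by (simp add: sum_monomials)
qed

definition nzd_mod :: "mpoly set \<Rightarrow> mpoly \<Rightarrow> bool" where
  "nzd_mod A F \<longleftrightarrow> (\<forall>g. F * g \<in> ideal.span A \<longrightarrow> g \<in> ideal.span A)"

lemma nzd_mod_Var: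
  assumes "j \<notin> A"
  shows "nzd_mod (Var ` A) (Var j)"
  unfolding nzd_mod_def span_Var
proof safe
  fix g m
  assume g: "\<forall>m\<in>keys (Var j * g). keys m \<inter> A \<noteq> {}" and m: "m \<in> keys g" "keys m \<inter> A = {}"
  have "single j 1 + m \<in> keys (Var j * g)"
    using m lookup_Var_mult[of j g m] by (simp add: in_keys_iff)
  then show False using g m assms by (fastforce simp: keys_add_monom)
qed

lemma poly_ring_0 [simp]: "0 \<in> poly_ring n"
  by (simp add: poly_ring_def)

lemma poly_ring_add: "p \<in> poly_ring n \<Longrightarrow> q \<in> poly_ring n \<Longrightarrow> p + q \<in> poly_ring n"
  using keys_add[of p q] by (auto simp: poly_ring_def)

lemma poly_ring_minus: "p \<in> poly_ring n \<Longrightarrow> - p \<in> poly_ring n"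
  by (auto simp: poly_ring_def in_keys_iff)

lemma poly_ring_diff: "p \<in> poly_ring n \<Longrightarrow> q \<in> poly_ring n \<Longrightarrow> p - q \<in> poly_ring n"
  using poly_ring_add[of p n "- q"] poly_ring_minus by simp

lemma poly_ring_mult: "p \<in> poly_ring n \<Longrightarrow> q \<in> poly_ring n \<Longrightarrow> p * q \<in> poly_ring n"
  using keys_mult[of p q] by (fastforce simp: poly_ring_def keys_add_monom)

lemma poly_ring_sum: "(\<And>a. a \<in> A \<Longrightarrow> f a \<in> poly_ring n) \<Longrightarrow> sum f A \<in> poly_ring n"
  by (induction A rule: infinite_finite_induct) (auto intro: poly_ring_add)

lemma poly_ring_Const [simp]: "Const c \<in> poly_ring n"
  by (simp add: poly_ring_def Const_def)

lemma poly_ring_1 [simp]: "1 \<in> poly_ring n"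
  using poly_ring_Const[of 1 n] by simp

lemma poly_ring_Var: "j \<le> n \<Longrightarrow> Var j \<in> poly_ring n"
  by (simp add: poly_ring_def Var_def)

lemma poly_ring_power: "p \<in> poly_ring n \<Longrightarrow> p ^ k \<in> poly_ring n"
  by (induction k) (auto intro: poly_ring_mult)

lemma poly_ring_hcomp: "p \<in> poly_ring n \<Longrightarrow> hcomp k p \<in> poly_ring n"
  by (auto simp: poly_ring_def in_keys_iff lookup_hcomp)

text \<open>
  The result of setting the variables \<open>x\<^sub>j\<close> with \<open>j > n\<close> to 0.
\<close>

definition trunc :: "nat \<Rightarrow> mpoly \<Rightarrow> mpoly" where
  "trunc n p = Poly_Mapping.mapp (\<lambda>m c. c when keys m \<subseteq> {..n}) p"

text \<open>
  All ideals are formed in the ring in all variables.  The ring in \<open>x\<^sub>0, \<dots>, x\<^bsub>r-1\<^esub>\<close> is its quotient by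
  these variables, so an ideal of the smaller ring is an ideal that contains \<open>vars_from r\<close>.
\<close>

definition vars_from :: "nat \<Rightarrow> mpoly set" where
  "vars_from r = Var ` {r..}"

lemma lookup_trunc: "lookup (trunc n p) m = (lookup p m when keys m \<subseteq> {..n})"
  by (simp add: trunc_def lookup_mapp when_def in_keys_iff)

lemma trunc_in_poly_ring: "trunc n p \<in> poly_ring n"
  by (auto simp: poly_ring_def in_keys_iff lookup_trunc)

lemma trunc_id: "p \<in> poly_ring n \<Longrightarrow> trunc n p = p"
  by (rule poly_mapping_eqI) (auto simp: poly_ring_def in_keys_iff lookup_trunc when_def)

lemma trunc_add: "trunc n (p + q) = trunc n p + trunc n q"
  by (rule poly_mapping_eqI) (simp add: lookup_trunc lookup_add when_add_distrib)

lemma trunc_forms: "p \<in> forms k \<Longrightarrow> trunc n p \<in> forms k"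
  by (auto simp: forms_def in_keys_iff lookup_trunc)

lemma diff_trunc: "p - trunc n p \<in> ideal.span (vars_from (Suc n))"
proof -
  have "keys m \<inter> {Suc n..} \<noteq> {}" if "m \<in> keys (p - trunc n p)" for m
  proof -
    have "\<not> keys m \<subseteq> {..n}" using that by (auto simp: in_keys_iff lookup_minus lookup_trunc)
    then show ?thesis by force
  qed
  then show ?thesis by (simp add: vars_from_def span_Var)
qed

lemma poly_ring_Int_vars: "p \<in> poly_ring n \<Longrightarrow> p \<in> ideal.span (vars_from (Suc n)) \<Longrightarrow> p = 0"
proof -
  assume p: "p \<in> poly_ring n" "p \<in> ideal.span (vars_from (Suc n))"
  have "keys p = {}"
  proof (rule equals0I)
    fix m assume "m \<in> keys p"
    then have "keys m \<subseteq> {..n}" "keys m \<inter> {Suc n..} \<noteq> {}"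
      using p by (auto simp: poly_ring_def vars_from_def span_Var)
    then show False by fastforce
  qed
  then show "p = 0" by simp
qed

lemma trunc_unique:
  assumes "q \<in> poly_ring n" "p - q \<in> ideal.span (vars_from (Suc n))"
  shows "trunc n p = q"
proof -
  have "trunc n p - q = (p - q) - (p - trunc n p)" by simp
  also have "\<dots> \<in> ideal.span (vars_from (Suc n))"
    using assms(2) diff_trunc by (rule ideal.span_diff)
  finally have "trunc n p - q = 0"
    using poly_ring_diff[OF trunc_in_poly_ring assms(1)] poly_ring_Int_vars by blast
  then show ?thesis by simp
qed

text \<open>
  The product of the truncations has the two properties that characterise the truncation of the product.
\<close>

lemma trunc_mult: "trunc n (p * q) = trunc n p * trunc n q"
proof (rule trunc_unique)
  have "p * q - trunc n p * trunc n q = (p - trunc n p) * q + trunc n p * (q - trunc n q)"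
    by (simp add: algebra_simps)
  also have "\<dots> \<in> ideal.span (vars_from (Suc n))"
    using diff_trunc by (intro ideal.span_add ideal_mult_left ideal_mult_right)
  finally show "p * q - trunc n p * trunc n q \<in> ideal.span (vars_from (Suc n))" .
qed (simp add: poly_ring_mult trunc_in_poly_ring)

lemma trunc_vars: "p \<in> ideal.span (vars_from (Suc n)) \<Longrightarrow> trunc n p = 0"
  by (rule trunc_unique) auto

lemma all_forms_vars [simp]: "all_forms (vars_from r)"
  using forms_Var by (auto simp: all_forms_def vars_from_def)

lemma all_forms_Un: "all_forms (A \<union> B) \<longleftrightarrow> all_forms A \<and> all_forms B"
  by (auto simp: all_forms_def)

lemma all_forms_insert: "a \<in> forms e \<Longrightarrow> all_forms A \<Longrightarrow> all_forms (insert a A)"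
  by (auto simp: all_forms_def)

lemma single_eq_prod_Var: "single m c = Const c * (\<Prod>j\<in>keys m. Var j ^ lookup m j)"
proof -
  have pow: "Var j ^ k = single (single j k) 1" for j k
  proof (induction k)
    case (Suc k)
    have "single j 1 + single j k = (single j (Suc k) :: monom)"
      by (simp flip: single_add)
    then show ?case using Suc by (simp add: Var_def mult_single)
  qed simp
  have "(\<Prod>j\<in>A. single (g j) 1) = (single (\<Sum>j\<in>A. g j) 1 :: mpoly)"
    if "finite A" for A and g :: "nat \<Rightarrow> monom"
    using that by (induction A rule: finite_induct) (simp_all add: mult_single)
  then have "(\<Prod>j\<in>keys m. Var j ^ lookup m j) = single (\<Sum>j\<in>keys m. single j (lookup m j)) 1"
    by (simp add: pow)
  then show ?thesis by (simp add: sum_monomials Const_def mult_single)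
qed

lemma mpoly_expand:
  "p = (\<Sum>m\<in>keys p. Const (lookup p m) * (\<Prod>j\<in>keys m. Var j ^ lookup m j))"
  using sum_monomials[of p] by (simp add: single_eq_prod_Var)

section \<open>Hilbert functions and regular sequences\<close>

definition hilbert_fun :: "mpoly set \<Rightarrow> (nat \<Rightarrow> nat) \<Rightarrow> bool" where
  "hilbert_fun A h \<longleftrightarrow>
     (\<forall>k. has_qdim poly_scale (forms k) (forms k \<inter> ideal.span A) (h k))"

definition hseries :: "(nat \<Rightarrow> nat) \<Rightarrow> int fps" where
  "hseries h = Abs_fps (\<lambda>k. int (h k))"

lemma hilbert_fun_unique: "hilbert_fun A h \<Longrightarrow> hilbert_fun A h' \<Longrightarrow> h = h'"
proof (rule ext)
  fix k assume "hilbert_fun A h" "hilbert_fun A h'"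
  then show "h k = h' k"
    unfolding hilbert_fun_def
    by (intro lin.has_qdim_unique[of "forms k \<inter> ideal.span A" "forms k"])
      (auto intro: lin.subspace_inter)
qed

text \<open>
  Multiplication by \<open>F\<close> identifies the quotient in degree \<open>k - e\<close> with the classes of multiples of \<open>F\<close> in
  degree \<open>k\<close>; it is injective because \<open>F\<close> is a nonzerodivisor.
\<close>

lemma hilbert_fun_insert:
  assumes A: "all_forms A" and F: "F \<in> forms e" and nzd: "nzd_mod A F" and h: "hilbert_fun A h"
  shows "\<exists>h'. hilbert_fun (insert F A) h' \<and> (\<forall>k. h k = h' k + (if e \<le> k then h (k - e) else 0))"
proof -
  let ?sc = poly_scale
  have "\<exists>v. has_qdim ?sc (forms k) (forms k \<inter> ideal.span (insert F A)) v \<and>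
      h k = v + (if e \<le> k then h (k - e) else 0)" for k
  proof -
    let ?W = "forms k \<inter> ideal.span A" and ?U = "forms k \<inter> ideal.span (insert F A)"
    have sub: "lin.subspace ?W" "lin.subspace ?U" "?W \<subseteq> ?U"
      using ideal.span_mono[of A "insert F A"] by (auto intro: lin.subspace_inter)
    have hk: "has_qdim ?sc (forms k) ?W (h k)" using h by (simp add: hilbert_fun_def)
    obtain u v where uv: "has_qdim ?sc ?U ?W u" "has_qdim ?sc (forms k) ?U v" "h k = u + v"
      by (rule lin.has_qdim_split[OF forms_lin_subspace sub(2,1,3) Int_lower1 hk])
    have "has_qdim ?sc ?U ?W (if e \<le> k then h (k - e) else 0)"
    proof (cases "e \<le> k")
      case True
      have "has_qdim ?sc ?U ?W (h (k - e))"
      proof (rule has_qdim_transfer[where \<phi> = "\<lambda>p. F * p" and sc = ?sc])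
        show "has_qdim ?sc (forms (k - e)) (forms (k - e) \<inter> ideal.span A) (h (k - e))"
          using h by (simp add: hilbert_fun_def)
        show "F * v \<in> ?U" if "v \<in> forms (k - e)" for v
          using forms_mult[OF F that] True ideal_mult_right[OF ideal.span_base[of F "insert F A"]]
          by simp
        show "\<exists>v\<in>forms (k - e). w - F * v \<in> ?W" if w: "w \<in> ?U" for w
        proof -
          obtain g where "g \<in> forms (k - e)" "w - F * g \<in> ideal.span A"
            using form_in_span_insert[OF A F, of w k] w by auto
          moreover from this have "w - F * g \<in> forms k"
            using forms_mult[OF F, of g "k - e"] True w by (intro forms_diff) auto
          ultimately show ?thesis by auto
        qed
        show "F * v \<in> ?W \<longleftrightarrow> v \<in> forms (k - e) \<inter> ideal.span A" if "v \<in> forms (k - e)" for v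
          using that forms_mult[OF F that] True nzd
          by (auto simp: nzd_mod_def intro: ideal.span_scale)
      qed (use sub in \<open>auto simp: distrib_left mult.left_commute lin.complex_space_axioms\<close>)
      then show ?thesis using True by simp
    next
      case False
      have "?U \<subseteq> ?W"
      proof
        fix p assume p: "p \<in> ?U"
        then obtain g where "g = 0" "p - F * g \<in> ideal.span A"
          using form_in_span_insert[OF A F, of p k] False by auto
        then show "p \<in> ?W" using p by simp
      qed
      then show ?thesis using False by (simp add: lin.has_qdim_0_iff)
    qed
    then have "u = (if e \<le> k then h (k - e) else 0)"
      using lin.has_qdim_unique[OF sub(1) uv(1)] by simp
    then show ?thesis using uv by (intro exI[of _ v]) simp
  qed
  then show ?thesis unfolding hilbert_fun_def by metis
qed

lemma hilbert_fun_insert_hseries: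
  assumes "all_forms A" "F \<in> forms e" "nzd_mod A F" "hilbert_fun A h"
  shows "\<exists>h'. hilbert_fun (insert F A) h' \<and> hseries h' = (1 - fps_X ^ e) * hseries h"
proof -
  obtain h' where h': "hilbert_fun (insert F A) h'"
      "\<And>k. h k = h' k + (if e \<le> k then h (k - e) else 0)"
    using hilbert_fun_insert[OF assms] by blast
  have "hseries h' = (1 - fps_X ^ e) * hseries h"
  proof (rule fps_ext)
    fix k
    show "fps_nth (hseries h') k = fps_nth ((1 - fps_X ^ e) * hseries h) k"
      using h'(2)[of k] by (auto simp: hseries_def left_diff_distrib fps_X_power_mult_nth)
  qed
  then show ?thesis using h' by blast
qed

definition monoms :: "nat \<Rightarrow> nat \<Rightarrow> monom set" where
  "monoms r k = {m. keys m \<subseteq> {..<r} \<and> mdeg m = k}"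

lemma finite_monoms: "finite (monoms r k)"
proof (rule finite_imageD)
  have "finite {f::nat\<Rightarrow>nat. \<forall>x. (x \<in> {..<r} \<longrightarrow> f x \<in> {..k}) \<and> (x \<notin> {..<r} \<longrightarrow> f x = 0)}"
    by (rule finite_set_of_finite_funs) auto
  moreover have "lookup ` monoms r k \<subseteq>
      {f. \<forall>x. (x \<in> {..<r} \<longrightarrow> f x \<in> {..k}) \<and> (x \<notin> {..<r} \<longrightarrow> f x = 0)}"
  proof (intro image_subsetI CollectI allI conjI impI)
    fix m x assume m: "m \<in> monoms r k"
    show "lookup m x \<in> {..k}" using m lookup_le_mdeg[of m x] by (simp add: monoms_def)
    show "lookup m x = 0" if "x \<notin> {..<r}"
      using m that unfolding monoms_def mem_Collect_eq by (meson in_keys_iff subsetD)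
  qed
  ultimately show "finite (lookup ` monoms r k)" by (rule finite_subset[rotated])
  show "inj_on lookup (monoms r k)" by (auto intro!: inj_onI poly_mapping_eqI)
qed

lemma single_one_inject: "(single m 1 :: mpoly) = single m' 1 \<longleftrightarrow> m = m'"
proof
  assume "(single m 1 :: mpoly) = single m' 1"
  then have "keys (single m 1 :: mpoly) = keys (single m' 1 :: mpoly)" by (rule arg_cong)
  then show "m = m'" by simp
qed simp

text \<open>The monomials in the first \<open>r\<close> variables form a basis of the quotient.\<close>

lemma hilbert_fun_vars_from: "hilbert_fun (vars_from r) (\<lambda>k. card (monoms r k))"
  unfolding hilbert_fun_def
proof
  fix k
  define B where "B = (\<lambda>m. single m 1 :: mpoly) ` monoms r k"
  have inj: "inj_on (\<lambda>m. single m 1 :: mpoly) (monoms r k)"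
    by (rule inj_onI) (simp only: single_one_inject)
  have in_span: "p \<in> ideal.span (vars_from r) \<longleftrightarrow> (\<forall>m. keys m \<subseteq> {..<r} \<longrightarrow> lookup p m = 0)" for p
  proof -
    have "keys m \<inter> {r..} \<noteq> {} \<longleftrightarrow> \<not> keys m \<subseteq> {..<r}" for m :: monom
      by (auto simp: not_less)
    then show ?thesis
      unfolding vars_from_def span_Var mem_Collect_eq Ball_def in_keys_iff by blast
  qed
  have re: "(\<Sum>b\<in>B. Const (c b) * b) = (\<Sum>m\<in>monoms r k. single m (c (single m 1)))" for c
    unfolding B_def by (subst sum.reindex[OF inj]) (simp add: Const_def mult_single)
  have lk: "lookup (\<Sum>b\<in>B. Const (c b) * b) m = (if m \<in> monoms r k then c (single m 1) else 0)" for c m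
    unfolding re using finite_monoms[of r k]
    by (simp add: lookup_sum lookup_single when_def)
  have "has_qdim poly_scale (forms k) (forms k \<inter> ideal.span (vars_from r)) (card B)"
  proof (rule lin.has_qdim_span)
    show "finite B" using finite_monoms by (simp add: B_def)
    show "B \<subseteq> forms k" by (auto simp: B_def monoms_def forms_def)
    show "lin.subspace (forms k \<inter> ideal.span (vars_from r))" by (auto intro: lin.subspace_inter)
    fix p assume p: "p \<in> forms k"
    define c where "c b = lookup p (THE m. b = single m (1::complex))" for b
    have c: "c (single m 1) = lookup p m" for m
      by (simp add: c_def single_one_inject)
    have "p - (\<Sum>b\<in>B. Const (c b) * b) \<in> forms k"
      using p \<open>B \<subseteq> forms k\<close> by (intro forms_diff forms_sum forms_Const_mult) auto
    moreover have "p - (\<Sum>b\<in>B. Const (c b) * b) \<in> ideal.span (vars_from r)"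
      unfolding in_span
    proof (intro allI impI)
      fix m :: monom assume "keys m \<subseteq> {..<r}"
      then show "lookup (p - (\<Sum>b\<in>B. Const (c b) * b)) m = 0"
        using p by (cases "mdeg m = k") (auto simp: lookup_minus lk c monoms_def forms_def in_keys_iff)
    qed
    ultimately show "\<exists>c. p - (\<Sum>b\<in>B. Const (c b) * b) \<in> forms k \<inter> ideal.span (vars_from r)"
      by blast
  next
    fix c assume "(\<Sum>b\<in>B. Const (c b) * b) \<in> forms k \<inter> ideal.span (vars_from r)"
    then have "\<forall>m. keys m \<subseteq> {..<r} \<longrightarrow> lookup (\<Sum>b\<in>B. Const (c b) * b) m = 0"
      using in_span by blast
    then have "c (single m 1) = 0" if "m \<in> monoms r k" for m
      using that lk[of c m] by (simp add: monoms_def)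
    then show "\<forall>b\<in>B. c b = 0" by (simp add: B_def)
  qed
  then show "has_qdim poly_scale (forms k) (forms k \<inter> ideal.span (vars_from r))
      (card (monoms r k))"
    by (simp add: B_def card_image[OF inj])
qed

lemma vars_from_insert: "vars_from r = insert (Var r) (vars_from (Suc r))"
  by (auto simp: vars_from_def atLeast_Suc_greaterThan dest: le_imp_less_or_eq intro: less_imp_le)

lemma nzd_vars_from: "nzd_mod (vars_from (Suc r)) (Var r)"
  unfolding vars_from_def by (rule nzd_mod_Var) simp

text \<open>
  Monomials in \<open>r + 1\<close> variables not divisible by the last one are monomials in \<open>r\<close> variables; on the level
  of Hilbert functions this is the case \<open>F = x\<^sub>r\<close> of \<open>hilbert_fun_insert\<close>.
\<close>

lemma card_monoms_Suc:
  "card (monoms (Suc r) k) = card (monoms r k) + (if 1 \<le> k then card (monoms (Suc r) (k - 1)) else 0)"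
proof -
  obtain h where h: "hilbert_fun (insert (Var r) (vars_from (Suc r))) h"
    "\<And>k. card (monoms (Suc r) k) = h k + (if 1 \<le> k then card (monoms (Suc r) (k - 1)) else 0)"
    using hilbert_fun_insert[OF all_forms_vars forms_Var nzd_vars_from hilbert_fun_vars_from] by blast
  have "h = (\<lambda>k. card (monoms r k))"
    using hilbert_fun_unique[OF h(1)] hilbert_fun_vars_from[of r] by (simp add: vars_from_insert[of r])
  then show ?thesis using h(2)[of k] by simp
qed

lemma monoms_0: "monoms 0 k = (if k = 0 then {0} else {})"
  by (auto simp: monoms_def)

lemma card_monoms: "card (monoms r k) = (r + k - 1) choose k"
proof (induction r arbitrary: k)
  case 0
  then show ?case by (cases k) (auto simp: monoms_0)
next
  case (Suc r)
  show ?case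
  proof (induction k)
    case (Suc k)
    then show ?case
      using card_monoms_Suc[of r "Suc k"] Suc.IH \<open>\<And>k. card (monoms r k) = (r + k - 1) choose k\<close>[of "Suc k"]
      by simp
  qed (use card_monoms_Suc[of r 0] Suc in simp)
qed

lemma hseries_vars_from: "(1 - fps_X) ^ r * hseries (\<lambda>k. card (monoms r k)) = 1"
proof (induction r)
  case 0
  show ?case by (rule fps_ext) (simp add: hseries_def monoms_0)
next
  case (Suc r)
  have "(1 - fps_X) * hseries (\<lambda>k. card (monoms (Suc r) k)) = hseries (\<lambda>k. card (monoms r k))"
  proof (rule fps_ext)
    fix k
    show "fps_nth ((1 - fps_X) * hseries (\<lambda>k. card (monoms (Suc r) k))) k =
        fps_nth (hseries (\<lambda>k. card (monoms r k))) k"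
      using card_monoms_Suc[of r k] by (simp add: hseries_def left_diff_distrib)
  qed
  then show ?case using Suc by (simp add: mult.assoc mult.left_commute[of "1 - fps_X"])
qed

fun regseq :: "mpoly set \<Rightarrow> mpoly list \<Rightarrow> bool" where
  "regseq A [] = True"
| "regseq A (G # Gs) = (nzd_mod A G \<and> regseq (insert G A) Gs)"

lemma regseq_append: "regseq A (Gs @ Hs) \<longleftrightarrow> regseq A Gs \<and> regseq (A \<union> set Gs) Hs"
  by (induction Gs arbitrary: A) auto

lemma hilbert_fun_regseq:
  assumes "all_forms A" "set Gs \<subseteq> forms e" "regseq A Gs" "hilbert_fun A h"
  shows "\<exists>h'. hilbert_fun (A \<union> set Gs) h' \<and> hseries h' = (1 - fps_X ^ e) ^ length Gs * hseries h"
  using assms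
proof (induction Gs arbitrary: A h)
  case (Cons G Gs)
  obtain h1 where h1: "hilbert_fun (insert G A) h1" "hseries h1 = (1 - fps_X ^ e) * hseries h"
    using hilbert_fun_insert_hseries[of A G e h] Cons.prems by auto
  obtain h' where "hilbert_fun (insert G A \<union> set Gs) h'"
      "hseries h' = (1 - fps_X ^ e) ^ length Gs * hseries h1"
    using Cons.IH[of "insert G A" h1] Cons.prems h1(1) all_forms_insert[of G e A] by auto
  then show ?case using h1(2) by (auto simp: mult_ac)
qed auto

text \<open>
  Multiplication by a form respects degrees, so only homogeneous \<open>g\<close> have to be tested.
\<close>

lemma nzd_modI:
  assumes A: "all_forms A" and F: "F \<in> forms e"
    and h: "\<And>k g. g \<in> forms k \<Longrightarrow> F * g \<in> ideal.span A \<Longrightarrow> g \<in> ideal.span A"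
  shows "nzd_mod A F"
  unfolding nzd_mod_def
proof (intro allI impI)
  fix g assume g: "F * g \<in> ideal.span A"
  have "hcomp k g \<in> ideal.span A" for k
  proof (rule h[OF hcomp_in_forms])
    show "F * hcomp k g \<in> ideal.span A"
      using hcomp_in_span[OF A g, of "e + k"] hcomp_mult[OF F, of "e + k" g] by simp
  qed
  then have "(\<Sum>k\<in>mdeg ` keys g. hcomp k g) \<in> ideal.span A"
    by (intro ideal.span_sum) auto
  then show "g \<in> ideal.span A" by (simp only: sum_hcomp)
qed

text \<open>
  If \<open>F * g\<close> lies in the ideal, then \<open>g = x * h\<close> modulo the ideal, and \<open>F * h\<close> lies in it because \<open>x\<close> is a
  nonzerodivisor; as \<open>h\<close> has smaller degree, induction applies.  This is how members of a regular
  sequence of forms are exchanged.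
\<close>

lemma nzd_swap:
  assumes A: "all_forms A" and x: "x \<in> forms 1" and F: "F \<in> forms e"
    and nx: "nzd_mod A x" and nF: "nzd_mod (insert x A) F"
  shows "nzd_mod A F" "nzd_mod (insert F A) x"
proof -
  show "nzd_mod A F"
  proof (rule nzd_modI[OF A F])
    fix k g
    assume "g \<in> forms k" "F * g \<in> ideal.span A"
    then show "g \<in> ideal.span A"
    proof (induction k arbitrary: g rule: less_induct)
      case (less k)
      have "F * g \<in> ideal.span (insert x A)"
        using less.prems ideal.span_mono[of A "insert x A"] by auto
      then have "g \<in> ideal.span (insert x A)" using nF by (simp add: nzd_mod_def)
      then obtain h where h: "h \<in> forms (k - 1)" "k < 1 \<Longrightarrow> h = 0" "g - x * h \<in> ideal.span A"
        using form_in_span_insert[OF A x less.prems(1)] by blast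
      have "F * g - F * (g - x * h) \<in> ideal.span A"
        by (rule ideal.span_diff[OF less.prems(2) ideal_mult_left[OF h(3)]])
      then have "x * (F * h) \<in> ideal.span A" by (simp add: algebra_simps)
      then have Fh: "F * h \<in> ideal.span A" using nx by (simp add: nzd_mod_def)
      have "h \<in> ideal.span A"
        using h(2) less.IH[OF _ h(1) Fh] ideal.span_zero by (cases "k < 1") auto
      then have "(g - x * h) + x * h \<in> ideal.span A"
        by (rule ideal.span_add[OF h(3) ideal_mult_left])
      then show ?case by simp
    qed
  qed
  show "nzd_mod (insert F A) x"
    unfolding nzd_mod_def
  proof (intro allI impI)
    fix g assume "x * g \<in> ideal.span (insert F A)"
    then obtain h where h: "x * g - h * F \<in> ideal.span A" by (auto simp: ideal.span_insert)
    then have "h * F - x * g \<in> ideal.span A" using ideal.span_neg by fastforce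
    then have "F * h \<in> ideal.span (insert x A)"
      unfolding ideal.span_insert by (auto simp: mult.commute intro!: exI[of _ g])
    then have "h \<in> ideal.span (insert x A)" using nF by (simp add: nzd_mod_def)
    then obtain h' where h': "h - h' * x \<in> ideal.span A" by (auto simp: ideal.span_insert)
    have "(x * g - h * F) + F * (h - h' * x) \<in> ideal.span A"
      by (rule ideal.span_add[OF h ideal_mult_left[OF h']])
    then have "x * (g - h' * F) \<in> ideal.span A" by (simp add: algebra_simps)
    then have "g - h' * F \<in> ideal.span A" using nx by (simp add: nzd_mod_def)
    then show "g \<in> ideal.span (insert F A)" by (auto simp: ideal.span_insert)
  qed
qed

lemma regseq_swap:
  assumes "all_forms A" "x \<in> forms 1" "set Gs \<subseteq> forms e" "nzd_mod A x" "regseq (insert x A) Gs"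
  shows "regseq A Gs \<and> nzd_mod (A \<union> set Gs) x"
  using assms
proof (induction Gs arbitrary: A)
  case (Cons G Gs)
  have "nzd_mod A G" "nzd_mod (insert G A) x"
    using nzd_swap[of A x G e] Cons.prems by auto
  moreover have "regseq (insert x (insert G A)) Gs"
    using Cons.prems by (simp add: insert_commute)
  ultimately show ?case
    using Cons.IH[of "insert G A"] Cons.prems all_forms_insert[of G e A] by auto
qed auto

lemma cong_mult:
  assumes "a - b \<in> ideal.span A" "c - d \<in> ideal.span A"
  shows "a * c - b * d \<in> ideal.span A"
proof -
  have "a * c - b * d = (a - b) * c + b * (c - d)" by (simp add: algebra_simps)
  then show ?thesis using assms by (simp add: ideal.span_add ideal_mult_left ideal_mult_right)
qed

lemma cong_power: "a - b \<in> ideal.span A \<Longrightarrow> a ^ k - b ^ k \<in> ideal.span A"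
  by (induction k) (auto simp: ideal.span_zero intro: cong_mult)

lemma cong_prod:
  "(\<And>i. i \<in> I \<Longrightarrow> f i - g i \<in> ideal.span A) \<Longrightarrow> prod f I - prod g I \<in> ideal.span A"
  by (induction I rule: infinite_finite_induct) (auto simp: ideal.span_zero intro: cong_mult)

lemma cong_sum:
  "(\<And>i. i \<in> I \<Longrightarrow> f i - g i \<in> ideal.span A) \<Longrightarrow> sum f I - sum g I \<in> ideal.span A"
  by (simp add: ideal.span_sum flip: sum_subtractf)

lemma forms_in_span_mono:
  assumes "forms K \<subseteq> ideal.span A" "K \<le> k"
  shows "forms k \<subseteq> ideal.span A"
proof
  fix p assume p: "p \<in> forms k"
  have "single m c \<in> ideal.span A" if "K \<le> mdeg m" for m c
    using that
  proof (induction "mdeg m" arbitrary: m rule: less_induct)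
    case less
    show ?case
    proof (cases "mdeg m = K")
      case True
      then show ?thesis using assms(1) forms_single[of m c] by auto
    next
      case False
      then have "mdeg m > K" using less by simp
      then obtain j where j: "j \<in> keys m" by (metis all_not_in_conv keys_eq_empty mdeg_0 not_less0)
      have deg: "mdeg m = Suc (mdeg (m - single j 1))"
        using arg_cong[OF monom_split[OF j], of mdeg] by (simp add: mdeg_add)
      then have "single (m - single j 1) c \<in> ideal.span A"
        using less.hyps \<open>mdeg m > K\<close> by simp
      then have "Var j * single (m - single j 1) c \<in> ideal.span A" by (rule ideal_mult_left)
      then show ?thesis using monom_split[OF j] by (simp add: Var_def mult_single)
    qed
  qed
  then have "(\<Sum>m\<in>keys p. single m (lookup p m)) \<in> ideal.span A"
    using p assms(2) by (intro ideal.span_sum) (auto simp: forms_def)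
  then show "p \<in> ideal.span A" by (simp add: sum_monomials)
qed

section \<open>Complete intersections\<close>

text \<open>
  Induction on the set of variables, comparing the coefficients of the powers of one of them.  The
  polynomial, of degree at most \<open>s\<close> in every variable, is given by its family of coefficients.
\<close>

lemma zero_if_vanishing_everywhere:
  fixes c :: "('i \<Rightarrow> nat) \<Rightarrow> complex"
  assumes "finite I" "\<And>a. (\<Sum>\<alpha>\<in>PiE I (\<lambda>_. {..s}). c \<alpha> * (\<Prod>i\<in>I. a i ^ \<alpha> i)) = 0"
    and "\<alpha> \<in> PiE I (\<lambda>_. {..s})"
  shows "c \<alpha> = 0"
  using assms
proof (induction I arbitrary: c \<alpha> rule: finite_induct)
  case empty
  then show ?case by simp
next
  case (insert x I)
  let ?P = "PiE I (\<lambda>_. {..s})"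
  define d where "d j a = (\<Sum>\<beta>\<in>?P. c (\<beta>(x := j)) * (\<Prod>i\<in>I. a i ^ \<beta> i))" for j a
  have inj: "inj_on (\<lambda>(j, \<beta>). \<beta>(x := j)) ({..s} \<times> ?P)"
    using inj_combinator[OF insert.hyps(2), of "\<lambda>_. {..s}"] by (simp add: case_prod_unfold)
  have img: "PiE (insert x I) (\<lambda>_. {..s}) = (\<lambda>(j, \<beta>). \<beta>(x := j)) ` ({..s} \<times> ?P)"
    using PiE_insert_eq[of x I "\<lambda>_. {..s}"] by (simp add: case_prod_unfold)
  have "(\<Sum>j\<le>s. d j a * t ^ j) = 0" for a t
  proof -
    have prod_upd: "(\<Prod>i\<in>insert x I. (a(x := t)) i ^ (\<beta>(x := j)) i) = t ^ j * (\<Prod>i\<in>I. a i ^ \<beta> i)" for \<beta> j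
    proof -
      have "(\<Prod>i\<in>I. (a(x := t)) i ^ (\<beta>(x := j)) i) = (\<Prod>i\<in>I. a i ^ \<beta> i)"
        using insert.hyps by (intro prod.cong) auto
      then show ?thesis using insert.hyps by simp
    qed
    have "0 = (\<Sum>\<alpha>\<in>PiE (insert x I) (\<lambda>_. {..s}). c \<alpha> * (\<Prod>i\<in>insert x I. (a(x := t)) i ^ \<alpha> i))"
      using insert.prems(1) by simp
    also have "\<dots> = (\<Sum>(j, \<beta>)\<in>{..s} \<times> ?P. c (\<beta>(x := j)) * (\<Prod>i\<in>insert x I. (a(x := t)) i ^ (\<beta>(x := j)) i))"
      unfolding img by (subst sum.reindex[OF inj]) (simp add: case_prod_unfold)
    also have "\<dots> = (\<Sum>(j, \<beta>)\<in>{..s} \<times> ?P. c (\<beta>(x := j)) * (t ^ j * (\<Prod>i\<in>I. a i ^ \<beta> i)))"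
      by (simp only: prod_upd)
    also have "\<dots> = (\<Sum>j\<le>s. d j a * t ^ j)"
      by (simp add: sum.cartesian_product[symmetric] d_def sum_distrib_left mult_ac)
    finally show ?thesis by simp
  qed
  then have "d j a = 0" if "j \<le> s" for j a
    using that polyfun_eq_0[of "\<lambda>j. d j a" s] by simp
  then have IH: "c (\<beta>(x := j)) = 0" if "j \<le> s" "\<beta> \<in> ?P" for j \<beta>
    using insert.IH[of "\<lambda>\<beta>. c (\<beta>(x := j))" \<beta>] that by (simp add: d_def)
  obtain j \<beta> where "j \<le> s" "\<beta> \<in> ?P" "\<alpha> = \<beta>(x := j)"
    using insert.prems(2) unfolding img by auto
  then show ?case by (simp only: IH)
qed

lemma card_bounded_monoms:
  "finite {m :: monom. keys m \<subseteq> {..<r} \<and> (\<forall>j. lookup m j \<le> D)} \<and>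
   card {m :: monom. keys m \<subseteq> {..<r} \<and> (\<forall>j. lookup m j \<le> D)} \<le> (D + 1) ^ r"
proof -
  let ?M = "{m :: monom. keys m \<subseteq> {..<r} \<and> (\<forall>j. lookup m j \<le> D)}"
  let ?f = "\<lambda>m :: monom. restrict (lookup m) {..<r}"
  have inj: "inj_on ?f ?M"
  proof (rule inj_onI, rule poly_mapping_eqI)
    fix m m' j assume m: "m \<in> ?M" "m' \<in> ?M" "?f m = ?f m'"
    show "lookup m j = lookup m' j"
    proof (cases "j < r")
      case True
      then show ?thesis using fun_cong[OF m(3), of j] by simp
    next
      case False
      then have "j \<notin> keys m" "j \<notin> keys m'" using m by auto
      then show ?thesis by (simp add: in_keys_iff)
    qed
  qed
  have sub: "?f ` ?M \<subseteq> PiE {..<r} (\<lambda>_. {..D})"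
    by (rule image_subsetI) (simp only: restrict_PiE_iff, simp)
  have fin: "finite (PiE {..<r} (\<lambda>_. {..D}))" by (intro finite_PiE) auto
  have "finite ?M" using finite_imageD[OF finite_subset[OF sub fin] inj] .
  moreover have "card ?M \<le> card (PiE {..<r} (\<lambda>_. {..D}))"
    using card_mono[OF fin sub] card_image[OF inj] by simp
  ultimately show ?thesis by (simp add: card_PiE)
qed

text \<open>
  Counting: the \<open>r + 1\<close> forms have \<open>(s + 1)\<^bsup>r+1\<^esup>\<close> power products with exponents at most \<open>s\<close>.  Modulo the
  variables from \<open>x\<^sub>r\<close> on they lie in a space of dimension at most \<open>(D + 1)\<^sup>r\<close>, which is smaller once \<open>s\<close> is
  large, so they are linearly dependent.  Since the forms have the same positive degree, the homogeneous
  components of a relation are relations as well.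
\<close>

lemma form_relation:
  fixes F :: "nat \<Rightarrow> mpoly"
  assumes e: "e \<ge> 1" and F: "\<And>i. i \<le> r \<Longrightarrow> F i \<in> forms e"
  obtains l s q where
    "(\<Sum>\<alpha>\<in>PiE {..r} (\<lambda>_. {..s}). Const (l \<alpha>) * (\<Prod>i\<le>r. F i ^ \<alpha> i)) \<in> ideal.span (vars_from r)"
    "\<forall>\<alpha>. l \<alpha> \<noteq> 0 \<longrightarrow> sum \<alpha> {..r} = q"
    "\<exists>\<alpha>\<in>PiE {..r} (\<lambda>_. {..s}). l \<alpha> \<noteq> 0"
proof -
  \<comment> \<open>Since \<open>D + 1 \<le> e * (r + 1) * (s + 1)\<close>, this choice gives
    \<open>(D + 1) ^ r \<le> s * (s + 1) ^ r < (s + 1) ^ (r + 1)\<close>.\<close>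
  define s where "s = (e * (r + 1)) ^ r"
  define D where "D = e * (s * (r + 1))"
  define I where "I = PiE {..r} (\<lambda>_. {..s})"
  define M where "M = {m :: monom. keys m \<subseteq> {..<r} \<and> (\<forall>j. lookup m j \<le> D)}"
  define mon where "mon \<alpha> = (\<Prod>i\<le>r. F i ^ \<alpha> i)" for \<alpha>
  have mon_form: "mon \<alpha> \<in> forms (e * sum \<alpha> {..r})" for \<alpha>
    unfolding mon_def sum_distrib_left using F by (intro forms_prod forms_power) auto
  have finI: "finite I" unfolding I_def by (intro finite_PiE) auto
  have "card M \<le> (D + 1) ^ r" "finite M" using card_bounded_monoms[of r D] by (auto simp: M_def)
  moreover have "D + 1 \<le> e * (r + 1) * (s + 1)"
    using e by (simp add: D_def algebra_simps)
  then have "(D + 1) ^ r \<le> (e * (r + 1) * (s + 1)) ^ r" by (rule power_mono) simp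
  moreover have "(e * (r + 1) * (s + 1)) ^ r = s * (s + 1) ^ r"
    by (simp only: power_mult_distrib s_def)
  moreover have "s * (s + 1) ^ r < (s + 1) ^ (r + 1)" by simp
  moreover have "card I = (s + 1) ^ (r + 1)" unfolding I_def by (simp add: card_PiE)
  ultimately have "card M < card I" by linarith
  then obtain l where l: "\<exists>\<alpha>\<in>I. l \<alpha> \<noteq> 0" "\<forall>m\<in>M. (\<Sum>\<alpha>\<in>I. l \<alpha> * lookup (mon \<alpha>) m) = 0"
    using homogeneous_system_nontrivial_solution[of M I "\<lambda>\<alpha>. lookup (mon \<alpha>)"] \<open>finite M\<close> finI
    by auto
  define P where "P = (\<Sum>\<alpha>\<in>I. Const (l \<alpha>) * mon \<alpha>)"
  have lookup_P: "lookup P m = (\<Sum>\<alpha>\<in>I. l \<alpha> * lookup (mon \<alpha>) m)" for m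
    using lookup_single_mult[of "0::monom" _ "_ :: mpoly" m, simplified]
    by (simp add: P_def lookup_sum Const_def)
  \<comment> \<open>The linear system says that the coefficients of \<open>P\<close> at monomials in the first \<open>r\<close> variables vanish.\<close>
  have "keys m \<inter> {r..} \<noteq> {}" if m: "m \<in> keys P" for m
  proof
    assume empty: "keys m \<inter> {r..} = {}"
    have "lookup P m \<noteq> 0" using m by (simp add: in_keys_iff)
    then obtain \<alpha> where \<alpha>: "\<alpha> \<in> I" "lookup (mon \<alpha>) m \<noteq> 0"
      unfolding lookup_P by (metis (no_types, lifting) mult_zero_right sum.neutral)
    have "sum \<alpha> {..r} \<le> (\<Sum>i\<le>r. s)"
      using \<alpha>(1) by (intro sum_mono) (auto simp: I_def)
    then have "e * sum \<alpha> {..r} \<le> D" by (simp add: D_def mult_ac)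
    moreover have "mdeg m = e * sum \<alpha> {..r}"
      using mon_form[of \<alpha>] \<alpha>(2) by (simp add: forms_def in_keys_iff)
    ultimately have "lookup m j \<le> D" for j using lookup_le_mdeg[of m j] by simp
    moreover have "keys m \<subseteq> {..<r}" using empty by (auto simp: not_le[symmetric])
    ultimately have "m \<in> M" by (simp add: M_def)
    then show False using l(2) \<open>lookup P m \<noteq> 0\<close> by (simp add: lookup_P)
  qed
  then have P: "P \<in> ideal.span (vars_from r)" by (simp add: vars_from_def span_Var)
  obtain \<alpha>0 where \<alpha>0: "\<alpha>0 \<in> I" "l \<alpha>0 \<noteq> 0" using l(1) by blast
  define q where "q = sum \<alpha>0 {..r}"
  define l' where "l' \<alpha> = (if sum \<alpha> {..r} = q then l \<alpha> else 0)" for \<alpha>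
  have "hcomp (e * q) P = (\<Sum>\<alpha>\<in>I. Const (l' \<alpha>) * mon \<alpha>)"
    unfolding P_def hcomp_sum
  proof (rule sum.cong)
    fix \<alpha>
    have "hcomp (e * q) (Const (l \<alpha>) * mon \<alpha>) =
        (if e * q = e * sum \<alpha> {..r} then Const (l \<alpha>) * mon \<alpha> else 0)"
      using hcomp_form[OF forms_Const_mult[OF mon_form]] .
    then show "hcomp (e * q) (Const (l \<alpha>) * mon \<alpha>) = Const (l' \<alpha>) * mon \<alpha>"
      using e by (auto simp: l'_def)
  qed simp
  then have "(\<Sum>\<alpha>\<in>I. Const (l' \<alpha>) * mon \<alpha>) \<in> ideal.span (vars_from r)"
    using hcomp_in_span[OF all_forms_vars P, of "e * q"] by simp
  then show ?thesis
    using \<alpha>0 by (intro that[of l' s q]) (auto simp: I_def mon_def l'_def q_def split: if_splits)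
qed

text \<open>
  The linear change of variables in Noether normalisation.  Let \<open>Q\<close> be a homogeneous relation between the
  forms and \<open>c\<close> a point with \<open>Q(c) \<noteq> 0\<close> and \<open>c p = 1\<close>.  Modulo the forms \<open>F i - c i * F p\<close> the relation
  becomes \<open>Q(c) * (F p) ^ q\<close>.
\<close>

lemma integral_after_linear_change:
  fixes F :: "nat \<Rightarrow> mpoly"
  assumes e: "e \<ge> 1" and F: "\<And>i. i \<le> r \<Longrightarrow> F i \<in> forms e"
  obtains p q c where "p \<le> r"
    "F p ^ q \<in> ideal.span (vars_from r \<union> (\<lambda>i. F i - Const (c i) * F p) ` ({..r} - {p}))"
proof -
  obtain l s q where rel:
    "(\<Sum>\<alpha>\<in>PiE {..r} (\<lambda>_. {..s}). Const (l \<alpha>) * (\<Prod>i\<le>r. F i ^ \<alpha> i)) \<in> ideal.span (vars_from r)"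
    and hom: "\<forall>\<alpha>. l \<alpha> \<noteq> 0 \<longrightarrow> sum \<alpha> {..r} = q"
    and nz: "\<exists>\<alpha>\<in>PiE {..r} (\<lambda>_. {..s}). l \<alpha> \<noteq> 0"
    by (rule form_relation[OF e F])
  define I where "I = PiE {..r} (\<lambda>_. {..s})"
  define Q where "Q a = (\<Sum>\<alpha>\<in>I. l \<alpha> * (\<Prod>i\<le>r. a i ^ \<alpha> i))" for a
  have "\<exists>a. Q a \<noteq> 0"
  proof (rule ccontr)
    assume "\<not> (\<exists>a. Q a \<noteq> 0)"
    then have "l \<alpha> = 0" if "\<alpha> \<in> PiE {..r} (\<lambda>_. {..s})" for \<alpha>
      using zero_if_vanishing_everywhere[where I="{..r}" and s=s and c=l and \<alpha>=\<alpha>] that by (simp add: Q_def I_def)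
    then show False using nz by blast
  qed
  then obtain a where a: "Q a \<noteq> 0" by blast
  have scale: "Q (\<lambda>i. t * a i) = t ^ q * Q a" for t a
  proof -
    have "l \<alpha> * (\<Prod>i\<le>r. (t * a i) ^ \<alpha> i) = t ^ q * (l \<alpha> * (\<Prod>i\<le>r. a i ^ \<alpha> i))" for \<alpha>
      using hom[rule_format, of \<alpha>] by (cases "l \<alpha> = 0") (auto simp: power_mult_distrib prod.distrib power_sum)
    then show ?thesis by (simp only: Q_def sum_distrib_left)
  qed
  obtain p b where p: "p \<le> r" "b p \<noteq> 0" "Q b \<noteq> 0"
  proof (cases "\<exists>p\<le>r. a p \<noteq> 0")
    case True
    then show ?thesis using that a by blast
  next
    case False
    \<comment> \<open>If \<open>a\<close> is the origin, then \<open>Q\<close> has degree 0, and any other point serves as well.\<close>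
    have "Q a = Q (\<lambda>i. 0 * 1)" unfolding Q_def using False by (intro sum.cong) auto
    also have "\<dots> = 0 ^ q * Q (\<lambda>_. 1)" by (rule scale)
    finally have "Q (\<lambda>_. 1) \<noteq> 0" using a by auto
    then show ?thesis using that[of 0 "\<lambda>_. 1"] by simp
  qed
  define c where "c = (\<lambda>i. inverse (b p) * b i)"
  have cp: "c p = 1" and Qc: "Q c \<noteq> 0"
    using p scale[of "inverse (b p)" b] by (auto simp: c_def)
  define B where "B = vars_from r \<union> (\<lambda>i. F i - Const (c i) * F p) ` ({..r} - {p})"
  have cong: "F i - Const (c i) * F p \<in> ideal.span B" if "i \<le> r" for i
    using that cp by (cases "i = p") (auto simp: B_def ideal.span_zero intro: ideal.span_base)
  have "(\<Sum>\<alpha>\<in>I. Const (l \<alpha>) * (\<Prod>i\<le>r. F i ^ \<alpha> i)) - Const (Q c) * F p ^ q \<in> ideal.span B"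
  proof -
    have termwise: "Const (l \<alpha>) * (\<Prod>i\<le>r. F i ^ \<alpha> i) -
        Const (l \<alpha> * (\<Prod>i\<le>r. c i ^ \<alpha> i)) * F p ^ q \<in> ideal.span B" for \<alpha>
    proof -
      have "(\<Prod>i\<le>r. F i ^ \<alpha> i) - (\<Prod>i\<le>r. (Const (c i) * F p) ^ \<alpha> i) \<in> ideal.span B"
        by (intro cong_prod cong_power cong) auto
      then have *: "Const (l \<alpha>) * ((\<Prod>i\<le>r. F i ^ \<alpha> i) - (\<Prod>i\<le>r. (Const (c i) * F p) ^ \<alpha> i)) \<in> ideal.span B"
        by (rule ideal_mult_left)
      have "(\<Prod>i\<le>r. (Const (c i) * F p) ^ \<alpha> i) = Const (\<Prod>i\<le>r. c i ^ \<alpha> i) * F p ^ sum \<alpha> {..r}"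
        by (simp add: power_mult_distrib prod.distrib power_sum Const_power Const_prod)
      then show ?thesis
        using * hom[rule_format, of \<alpha>] by (cases "l \<alpha> = 0") (auto simp: Const_mult right_diff_distrib mult.assoc ideal.span_zero)
    qed
    have "Const (Q c) = (\<Sum>\<alpha>\<in>I. Const (l \<alpha> * (\<Prod>i\<le>r. c i ^ \<alpha> i)))"
      by (simp add: Q_def Const_sum)
    then show ?thesis using cong_sum[OF termwise] by (simp add: sum_distrib_right)
  qed
  moreover have "(\<Sum>\<alpha>\<in>I. Const (l \<alpha>) * (\<Prod>i\<le>r. F i ^ \<alpha> i)) \<in> ideal.span B"
    using rel ideal.span_mono[of "vars_from r" B] by (auto simp: B_def I_def)
  ultimately have "Const (Q c) * F p ^ q \<in> ideal.span B"
    using ideal.span_diff by fastforce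
  then have "Const (inverse (Q c)) * (Const (Q c) * F p ^ q) \<in> ideal.span B"
    by (rule ideal_mult_left)
  then have "F p ^ q \<in> ideal.span B"
    using Qc by (simp flip: mult.assoc Const_mult)
  then show ?thesis using that[of p q c] p(1) by (simp add: B_def)
qed

text \<open>
  Modulo \<open>B\<close>, every form of large degree is \<open>F\<close> times a form, as often as wanted; after \<open>q\<close> times it is 0.
\<close>

lemma forms_in_span_if_power:
  assumes B: "all_forms B" and F: "F \<in> forms e" "F ^ q \<in> ideal.span B"
    and K: "forms K \<subseteq> ideal.span (insert F B)"
  shows "forms (K + e * q) \<subseteq> ideal.span B"
proof
  fix g assume g: "g \<in> forms (K + e * q)"
  have "\<exists>h\<in>forms (K + e * (q - j)). g - F ^ j * h \<in> ideal.span B" if "j \<le> q" for j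
    using that
  proof (induction j)
    case 0
    show ?case using g ideal.span_zero[of B] by (intro bexI[of _ g]) simp_all
  next
    case (Suc j)
    then obtain h where h: "h \<in> forms (K + e * (q - j))" "g - F ^ j * h \<in> ideal.span B" by auto
    have "h \<in> ideal.span (insert F B)"
      using h(1) forms_in_span_mono[OF K, of "K + e * (q - j)"] by auto
    then obtain h' where h': "h' \<in> forms (K + e * (q - j) - e)" "h - F * h' \<in> ideal.span B"
      using form_in_span_insert[OF B F(1) h(1)] by blast
    have "q - j = Suc (q - Suc j)" using Suc by simp
    then have "K + e * (q - j) - e = K + e * (q - Suc j)" by simp
    moreover have "(g - F ^ j * h) + F ^ j * (h - F * h') \<in> ideal.span B"
      by (rule ideal.span_add[OF h(2) ideal_mult_left[OF h'(2)]])
    then have "g - F ^ Suc j * h' \<in> ideal.span B" by (simp add: algebra_simps)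
    ultimately show ?case using h' by auto
  qed
  from this[of q] obtain h where "g - F ^ q * h \<in> ideal.span B" by auto
  then have "(g - F ^ q * h) + F ^ q * h \<in> ideal.span B"
    by (rule ideal.span_add[OF _ ideal_mult_right[OF F(2)]])
  then show "g \<in> ideal.span B" by simp
qed

lemma nzd_mod_power:
  assumes "nzd_mod A x" "x ^ k * g \<in> ideal.span A"
  shows "g \<in> ideal.span A"
  using assms by (induction k) (auto simp: nzd_mod_def mult.assoc)

lemma span_Un_cong: "ideal.span A = ideal.span A' \<Longrightarrow> ideal.span (B \<union> A) = ideal.span (B \<union> A')"
  by (simp add: ideal.span_Un)

text \<open>
  Macaulay's theorem on systems of parameters, for forms of one degree.  The induction is on the number
  of variables.  Modulo the last variable \<open>x\<^sub>r\<close> there is one form too many, and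
  \<open>integral_after_linear_change\<close> finds \<open>r\<close> combinations that still generate, modulo \<open>x\<^sub>r\<close>, an ideal
  containing all forms of some degree.  After a change of basis they are regular modulo \<open>x\<^sub>r\<close> by induction,
  and exchange moves \<open>x\<^sub>r\<close> behind them.  The remaining form is a nonzerodivisor modulo them, since a power of the
  nonzerodivisor \<open>x\<^sub>r\<close> is a multiple of it modulo them.
\<close>

theorem regular_basis:
  assumes "e \<ge> 1" "length Fs = r" "set Fs \<subseteq> forms e"
    and "forms K \<subseteq> ideal.span (vars_from r \<union> set Fs)"
  shows "\<exists>Gs. length Gs = r \<and> set Gs \<subseteq> forms e \<and> ideal.span (set Gs) = ideal.span (set Fs) \<and>
           regseq (vars_from r) Gs"
  using assms(2-)
proof (induction r arbitrary: Fs K)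
  case 0
  then show ?case by auto
next
  case (Suc r)
  define F where "F i = Fs ! i" for i
  have F: "F i \<in> forms e" if "i \<le> r" for i
    using Suc.prems that by (auto simp: F_def)
  have setFs: "set Fs = F ` {..r}"
    using Suc.prems by (auto simp: F_def set_conv_nth less_Suc_eq_le)
  obtain p q c where p: "p \<le> r" and
    q: "F p ^ q \<in> ideal.span (vars_from r \<union> (\<lambda>i. F i - Const (c i) * F p) ` ({..r} - {p}))"
    by (rule integral_after_linear_change[OF assms(1) F])
  define G where "G i = F i - Const (c i) * F p" for i
  define Fs' where "Fs' = map G (filter (\<lambda>i. i \<noteq> p) [0..<Suc r])"
  have setFs': "set Fs' = G ` ({..r} - {p})"
    by (auto simp: Fs'_def less_Suc_eq_le simp del: upt_Suc)
  have "length Fs' = card (set (filter (\<lambda>i. i \<noteq> p) [0..<Suc r]))"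
    unfolding Fs'_def by (subst distinct_card) (auto simp del: upt_Suc)
  also have "set (filter (\<lambda>i. i \<noteq> p) [0..<Suc r]) = {..r} - {p}"
    by (auto simp: less_Suc_eq_le simp del: upt_Suc)
  finally have len: "length Fs' = r" using p by simp
  have Gform: "set Fs' \<subseteq> forms e"
    using F p by (auto simp: setFs' G_def intro!: forms_diff forms_Const_mult)
  have same: "ideal.span (insert (F p) (set Fs')) = ideal.span (set Fs)"
  proof (intro equalityI ideal_span_subset subsetI)
    have FF: "F i \<in> ideal.span (set Fs)" if "i \<le> r" for i
      using that by (intro ideal.span_base) (auto simp: setFs)
    fix x assume "x \<in> insert (F p) (set Fs')"
    then show "x \<in> ideal.span (set Fs)"
      using p ideal.span_diff[OF FF ideal_mult_left[OF FF]] FF by (auto simp: setFs' G_def)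
  next
    fix x assume "x \<in> set Fs"
    then obtain i where i: "i \<le> r" "x = F i" by (auto simp: setFs)
    have "G i + Const (c i) * F p \<in> ideal.span (insert (F p) (set Fs'))" if "i \<noteq> p"
      using that i by (intro ideal.span_add ideal_mult_left ideal.span_base) (auto simp: setFs')
    then show "x \<in> ideal.span (insert (F p) (set Fs'))"
      using i by (cases "i = p") (auto simp: G_def intro: ideal.span_base)
  qed
  define B where "B = vars_from r \<union> set Fs'"
  have Bforms: "all_forms B"
    using Gform by (auto simp: B_def all_forms_Un all_forms_def[of "set Fs'"])
  have "forms K \<subseteq> ideal.span (vars_from (Suc r) \<union> set Fs)" using Suc.prems by simp
  also have "\<dots> = ideal.span (vars_from (Suc r) \<union> insert (F p) (set Fs'))"
    using span_Un_cong[OF same] by simp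
  also have "\<dots> \<subseteq> ideal.span (insert (F p) B)"
    by (rule ideal.span_mono) (auto simp: B_def vars_from_insert[of r])
  finally have "forms (K + e * q) \<subseteq> ideal.span B"
    using q F[OF p] by (intro forms_in_span_if_power[OF Bforms]) (auto simp: B_def setFs' G_def)
  then obtain Gs where Gs: "length Gs = r" "set Gs \<subseteq> forms e"
    "ideal.span (set Gs) = ideal.span (set Fs')" "regseq (vars_from r) Gs"
    using Suc.IH[OF len Gform, of "K + e * q"] by (auto simp: B_def)
  define C where "C = vars_from (Suc r) \<union> set Gs"
  have swap: "regseq (vars_from (Suc r)) Gs" "nzd_mod C (Var r)"
    using regseq_swap[OF all_forms_vars forms_Var Gs(2) nzd_vars_from] Gs(4)
    by (auto simp: C_def vars_from_insert[of r])
  have Gp: "ideal.span (insert (F p) (set Gs)) = ideal.span (set Fs)"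
    using span_Un_cong[OF Gs(3), of "{F p}"] same by simp
  have "nzd_mod C (F p)"
    unfolding nzd_mod_def
  proof (intro allI impI)
    fix g assume g: "F p * g \<in> ideal.span C"
    have "Var r ^ K \<in> forms K" using forms_power[OF forms_Var, of r K] by simp
    then have "Var r ^ K \<in> ideal.span (vars_from (Suc r) \<union> set Fs)" using Suc.prems by auto
    also have "\<dots> = ideal.span (insert (F p) C)"
      using span_Un_cong[OF Gp] by (simp add: C_def)
    finally obtain h where "Var r ^ K - h * F p \<in> ideal.span C" by (auto simp: ideal.span_insert)
    from ideal.span_add[OF ideal_mult_right[OF this, of g] ideal_mult_left[OF g, of h]]
    have "Var r ^ K * g \<in> ideal.span C" by (simp add: algebra_simps)
    then show "g \<in> ideal.span C" using nzd_mod_power[OF swap(2)] by blast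
  qed
  then have "regseq (vars_from (Suc r)) (Gs @ [F p])"
    using swap(1) by (simp add: regseq_append C_def)
  moreover have "ideal.span (set (Gs @ [F p])) = ideal.span (set Fs)" using Gp by simp
  ultimately show ?case
    using Gs F[OF p] by (intro exI[of _ "Gs @ [F p]"]) auto
qed

lemma one_minus_X_power: "(1 - fps_X) * (\<Sum>i<e. fps_X ^ i) = (1 - fps_X ^ e :: int fps)"
proof (induction e)
  case (Suc e)
  then show ?case by (simp only: sum.lessThan_Suc distrib_left) (simp add: left_diff_distrib)
qed simp

theorem hilbert_fun_complete_intersection:
  assumes "e \<ge> 1" "length Fs = r" "set Fs \<subseteq> forms e"
    and "forms K \<subseteq> ideal.span (vars_from r \<union> set Fs)"
  shows "\<exists>h. hilbert_fun (vars_from r \<union> set Fs) h \<and> hseries h = (\<Sum>i<e. fps_X ^ i) ^ r"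
proof -
  obtain Gs where Gs: "length Gs = r" "set Gs \<subseteq> forms e"
    "ideal.span (set Gs) = ideal.span (set Fs)" "regseq (vars_from r) Gs"
    using regular_basis[OF assms] by blast
  obtain h where h: "hilbert_fun (vars_from r \<union> set Gs) h"
    "hseries h = (1 - fps_X ^ e) ^ length Gs * hseries (\<lambda>k. card (monoms r k))"
    using hilbert_fun_regseq[OF all_forms_vars Gs(2,4) hilbert_fun_vars_from] by blast
  have "hseries h = (\<Sum>i<e. fps_X ^ i) ^ r * ((1 - fps_X) ^ r * hseries (\<lambda>k. card (monoms r k)))"
    using h(2) Gs(1) by (simp add: power_mult_distrib mult_ac flip: one_minus_X_power)
  then have "hseries h = (\<Sum>i<e. fps_X ^ i) ^ r" by (simp add: hseries_vars_from)
  moreover have "hilbert_fun (vars_from r \<union> set Fs) h"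
    using h(1) span_Un_cong[OF Gs(3)] by (simp add: hilbert_fun_def)
  ultimately show ?thesis by blast
qed

section \<open>Coefficients of powers of a geometric sum\<close>

definition geom_poly :: "nat \<Rightarrow> int poly" where
  "geom_poly e = (\<Sum>i<e. monom 1 i)"

lemma coeff_geom_poly: "coeff (geom_poly e) k = (if k < e then 1 else 0)"
  by (simp add: geom_poly_def coeff_sum)

lemma degree_geom_poly: "e \<ge> 1 \<Longrightarrow> degree (geom_poly e) = e - 1"
  by (rule antisym[OF degree_le le_degree]) (auto simp: coeff_geom_poly)

lemma geom_poly_neq_0: "e \<ge> 1 \<Longrightarrow> geom_poly e \<noteq> 0"
  using coeff_geom_poly[of e 0] by auto

text \<open>The polynomial is its own reflection.\<close>

lemma coeff_geom_poly_power_sym: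
  assumes "e \<ge> 1" "k \<le> N * (e - 1)"
  shows "coeff (geom_poly e ^ N) (N * (e - 1) - k) = coeff (geom_poly e ^ N) k"
proof -
  have "reflect_poly (geom_poly e) = geom_poly e"
    using assms(1) by (intro poly_eqI) (auto simp: coeff_reflect_poly degree_geom_poly coeff_geom_poly)
  then have "coeff (geom_poly e ^ N) k = coeff (reflect_poly (geom_poly e ^ N)) k"
    by (simp add: reflect_poly_power)
  then show ?thesis
    using assms by (simp add: coeff_reflect_poly degree_power_eq geom_poly_neq_0 degree_geom_poly)
qed

lemma coeff_geom_poly_power_eq_0:
  assumes "e \<ge> 1" "k > N * (e - 1)"
  shows "coeff (geom_poly e ^ N) k = 0"
  using assms by (intro coeff_eq_0) (simp add: degree_power_eq geom_poly_neq_0 degree_geom_poly)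

lemma geom_poly_telescope: "[:1, -1:] * geom_poly e = 1 - monom 1 e"
proof (rule poly_eqI)
  fix k show "coeff ([:1, -1:] * geom_poly e) k = coeff (1 - monom 1 e) k"
    by (cases k) (auto simp: coeff_geom_poly coeff_pCons)
qed

lemma coeff_geom_poly_power_diff:
  "coeff (geom_poly e ^ Suc N) (Suc k) - coeff (geom_poly e ^ Suc N) k =
     coeff (geom_poly e ^ N) (Suc k) - (if Suc k < e then 0 else coeff (geom_poly e ^ N) (Suc k - e))"
proof -
  have "[:1, -1:] * geom_poly e ^ Suc N = geom_poly e ^ N - monom 1 e * geom_poly e ^ N"
    by (simp only: power_Suc mult.assoc[symmetric] geom_poly_telescope left_diff_distrib mult_1)
  from arg_cong[OF this, of "\<lambda>p. coeff p (Suc k)"] show ?thesis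
    by (simp add: coeff_monom_mult)
qed

text \<open>
  An increment of the coefficients of one power is a difference of two coefficients of the previous power,
  at indices \<open>j\<close> and \<open>j - e\<close>.  To the left of the middle, \<open>j - e\<close> is the one further away from the middle
  of the previous power, so its coefficient is smaller by symmetry and induction.  The coefficients of the
  first power are all equal, hence \<open>N \<ge> 2\<close>.
\<close>

lemma coeff_geom_poly_power_strict:
  assumes "e \<ge> 1" "N \<ge> 2" "2 * k + 1 < N * (e - 1)"
  shows "coeff (geom_poly e ^ N) k < coeff (geom_poly e ^ N) (Suc k)"
  using assms(2,3)
proof (induction N arbitrary: k rule: nat_induct_at_least)
  case base
  then have "Suc k < e" by linarith
  then show ?case
    using coeff_geom_poly_power_diff[of e 1 k] by (simp add: coeff_geom_poly numeral_2_eq_2)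
next
  case (Suc N)
  define a where "a = coeff (geom_poly e ^ N)"
  define T where "T = N * (e - 1)"
  define j where "j = Suc k"
  have "2 * (e - 1) \<le> T" unfolding T_def using Suc by (intro mult_right_mono) auto
  moreover have "2 * k + 1 < T + (e - 1)" using Suc.prems by (simp add: T_def add.commute)
  ultimately have "j \<le> T \<and> 2 * j < T + e" using assms(1) unfolding j_def by arith
  then have jT: "j \<le> T" "2 * j < T + e" by auto
  have incr: "a i < a l" if "i < l" "2 * l \<le> T" for i l
    using that
  proof (induction l)
    case (Suc l)
    have "a l < a (Suc l)" using Suc.prems Suc.IH Suc(1) \<open>\<And>k. 2 * k + 1 < N * (e - 1) \<Longrightarrow> _\<close>
      by (simp add: a_def T_def)
    then show ?case using Suc by (cases "i = l") auto
  qed simp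
  have a0: "a 0 = 1" using assms(1) by (simp add: a_def coeff_0_power coeff_geom_poly)
  \<comment> \<open>The index in the left half with the same coefficient as \<open>j\<close>.\<close>
  define l where "l = (if 2 * j \<le> T then j else T - j)"
  have al: "a l = a j"
    using coeff_geom_poly_power_sym[OF assms(1), of j N] jT by (auto simp: l_def a_def T_def)
  have l2: "2 * l \<le> T" by (auto simp: l_def)
  have "(if j < e then 0 else a (j - e)) < a l"
  proof (cases "j < e")
    case True
    have "0 < a l" using incr[of 0 l] l2 a0 by (cases "l = 0") auto
    then show ?thesis using True by simp
  next
    case False
    then have "j - e < l" using jT assms(1) by (auto simp: l_def)
    then show ?thesis using False incr[of "j - e" l] l2 by simp
  qed
  then show ?case
    using coeff_geom_poly_power_diff[of e N k] al by (simp add: a_def j_def split: if_splits)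
qed

text \<open>By symmetry the coefficients decrease strictly to the right of the middle.\<close>

lemma coeff_geom_poly_power_plateau:
  assumes e: "e \<ge> 1" and N: "N \<ge> 2"
    and eq: "coeff (geom_poly e ^ N) k = coeff (geom_poly e ^ N) (Suc k)"
    and nz: "coeff (geom_poly e ^ N) k \<noteq> 0"
  shows "2 * k + 1 = N * (e - 1)"
proof (rule linorder_cases[of "2 * k + 1" "N * (e - 1)"])
  assume "2 * k + 1 < N * (e - 1)"
  then show ?thesis using coeff_geom_poly_power_strict[OF e N] eq by force
next
  assume gt: "2 * k + 1 > N * (e - 1)"
  have "Suc k \<le> N * (e - 1)"
    using coeff_geom_poly_power_eq_0[OF e, of N "Suc k"] eq nz by fastforce
  moreover define k' where "k' = N * (e - 1) - Suc k"
  ultimately have "coeff (geom_poly e ^ N) k' = coeff (geom_poly e ^ N) (Suc k')"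
    using coeff_geom_poly_power_sym[OF e, of k N] coeff_geom_poly_power_sym[OF e, of "Suc k" N] eq
    by (simp add: Suc_diff_Suc)
  moreover have "2 * k' + 1 < N * (e - 1)" using gt \<open>Suc k \<le> _\<close> by (simp add: k'_def)
  ultimately show ?thesis using coeff_geom_poly_power_strict[OF e N] by force
qed

lemma fps_of_geom_poly: "fps_of_poly (geom_poly e ^ N) = (\<Sum>i<e. fps_X ^ i) ^ N"
  by (simp add: geom_poly_def fps_of_poly_power fps_of_poly_sum fps_of_poly_monom)

lemma hilbert_fun_complete_intersection_coeff:
  assumes "e \<ge> 1" "length Fs = r" "set Fs \<subseteq> forms e"
    and "forms K \<subseteq> ideal.span (vars_from r \<union> set Fs)"
  shows "hilbert_fun (vars_from r \<union> set Fs) (\<lambda>k. nat (coeff (geom_poly e ^ r) k))"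
proof -
  obtain h where h: "hilbert_fun (vars_from r \<union> set Fs) h" "hseries h = fps_of_poly (geom_poly e ^ r)"
    using hilbert_fun_complete_intersection[OF assms] by (auto simp: fps_of_geom_poly)
  have "int (h k) = coeff (geom_poly e ^ r) k" for k
    using arg_cong[OF h(2), of "\<lambda>f. fps_nth f k"] by (simp add: hseries_def)
  then have "h = (\<lambda>k. nat (coeff (geom_poly e ^ r) k))" by (metis nat_int)
  then show ?thesis using h(1) by simp
qed

section \<open>The projective Nullstellensatz\<close>

definition monom_eval :: "monom \<Rightarrow> (nat \<Rightarrow> complex) \<Rightarrow> complex" where
  "monom_eval m v = (\<Prod>j\<in>keys m. v j ^ lookup m j)"

lemma monom_eval_superset:
  "finite A \<Longrightarrow> keys m \<subseteq> A \<Longrightarrow> monom_eval m v = (\<Prod>j\<in>A. v j ^ lookup m j)"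
  unfolding monom_eval_def by (intro prod.mono_neutral_left) (auto simp: in_keys_iff)

lemma monom_eval_add: "monom_eval (a + b) v = monom_eval a v * monom_eval b v"
  using monom_eval_superset[of "keys a \<union> keys b" a v] monom_eval_superset[of "keys a \<union> keys b" b v]
  by (subst monom_eval_superset[of "keys a \<union> keys b"])
    (auto simp: keys_add_monom lookup_add power_add prod.distrib)

lemma mpoly_eval_superset:
  assumes "finite A" "keys p \<subseteq> A"
  shows "mpoly_eval p v = (\<Sum>m\<in>A. lookup p m * monom_eval m v)"
  unfolding mpoly_eval_def mpoly_subst_def monom_eval_def
  using assms by (intro sum.mono_neutral_left) (auto simp: in_keys_iff)

lemma mpoly_eval_0 [simp]: "mpoly_eval 0 v = 0"
  by (simp add: mpoly_eval_def mpoly_subst_def)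

lemma mpoly_eval_add: "mpoly_eval (p + q) v = mpoly_eval p v + mpoly_eval q v"
  using mpoly_eval_superset[of "keys p \<union> keys q" p v] mpoly_eval_superset[of "keys p \<union> keys q" q v]
    mpoly_eval_superset[of "keys p \<union> keys q" "p + q" v] keys_add[of p q]
  by (simp add: lookup_add distrib_right sum.distrib)

lemma mpoly_eval_sum: "mpoly_eval (sum f A) v = (\<Sum>a\<in>A. mpoly_eval (f a) v)"
  by (induction A rule: infinite_finite_induct) (auto simp: mpoly_eval_add)

lemma mpoly_eval_single: "mpoly_eval (single m c) v = c * monom_eval m v"
  using mpoly_eval_superset[of "{m}" "single m c" v] by simp

lemma mpoly_eval_mult: "mpoly_eval (p * q) v = mpoly_eval p v * mpoly_eval q v"
proof -
  have "mpoly_eval (p * q) v = mpoly_eval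
      ((\<Sum>m\<in>keys p. single m (lookup p m)) * (\<Sum>m\<in>keys q. single m (lookup q m))) v"
    by (simp only: sum_monomials)
  also have "\<dots> = (\<Sum>m\<in>keys p. \<Sum>m'\<in>keys q. (lookup p m * monom_eval m v) * (lookup q m' * monom_eval m' v))"
    by (simp add: sum_product mpoly_eval_sum mult_single mpoly_eval_single monom_eval_add mult_ac)
  also have "\<dots> = mpoly_eval p v * mpoly_eval q v"
    by (simp add: sum_product mpoly_eval_superset[of "keys p" p] mpoly_eval_superset[of "keys q" q])
  finally show ?thesis .
qed

lemma mpoly_eval_Const [simp]: "mpoly_eval (Const c) v = c"
  by (simp add: Const_def mpoly_eval_single monom_eval_def)

lemma mpoly_eval_1 [simp]: "mpoly_eval 1 v = 1"
  using mpoly_eval_Const[of 1 v] by simp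

lemma mpoly_eval_Var [simp]: "mpoly_eval (Var j) v = v j"
  by (simp add: Var_def mpoly_eval_single monom_eval_def)

lemma mpoly_eval_diff: "mpoly_eval (p - q) v = mpoly_eval p v - mpoly_eval q v"
  using mpoly_eval_add[of "p - q" q v] by simp

lemma mpoly_eval_power: "mpoly_eval (p ^ k) v = mpoly_eval p v ^ k"
  by (induction k) (auto simp: mpoly_eval_mult)

lemma mpoly_eval_form_scale:
  assumes "p \<in> forms e"
  shows "mpoly_eval p (\<lambda>j. t * v j) = t ^ e * mpoly_eval p v"
proof -
  have "monom_eval m (\<lambda>j. t * v j) = t ^ mdeg m * monom_eval m v" for m
    by (simp add: monom_eval_def mdeg_def power_mult_distrib prod.distrib power_sum)
  then show ?thesis
    using assms by (simp add: mpoly_eval_superset[of "keys p" p] sum_distrib_left forms_def mult_ac)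
qed

text \<open>
  The extension of a homomorphism of coefficient rings to univariate polynomials, by evaluation at \<open>x\<close>.
\<close>

locale poly_lift =
  fixes h :: "'a::comm_ring_1 \<Rightarrow> mpoly" and x :: mpoly
  assumes h_0: "h 0 = 0" and h_1: "h 1 = 1"
    and h_add: "h (a + b) = h a + h b" and h_mult: "h (a * b) = h a * h b"
begin

definition lift :: "'a poly \<Rightarrow> mpoly" where
  "lift p = poly (map_poly h p) x"

lemma lift_0: "lift 0 = 0"
  by (simp add: lift_def)

lemma lift_pCons: "lift (pCons a p) = h a + x * lift p"
  by (simp add: lift_def map_poly_pCons h_0)

lemma lift_const: "lift [:a:] = h a"
  by (simp add: lift_pCons lift_0)

lemma lift_1: "lift 1 = 1"
  using lift_const[of 1] by (simp add: h_1 one_pCons)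

lemma lift_add: "lift (p + q) = lift p + lift q"
proof (induction p arbitrary: q)
  case (pCons a p)
  show ?case
    by (cases q) (simp add: lift_pCons pCons.IH h_add distrib_left add.assoc add.left_commute)
qed (simp add: lift_0)

lemma lift_smult: "lift (smult a p) = h a * lift p"
  by (induction p) (simp_all add: lift_0 lift_pCons h_mult algebra_simps)

lemma lift_mult: "lift (p * q) = lift p * lift q"
  by (induction p) (simp_all add: lift_0 lift_pCons lift_add lift_smult h_0 algebra_simps)

lemma lift_sum: "lift (sum f A) = (\<Sum>a\<in>A. lift (f a))"
  by (induction A rule: infinite_finite_induct) (auto simp: lift_0 lift_add)

lemma lift_prod: "lift (prod f A) = (\<Prod>a\<in>A. lift (f a))"
  by (induction A rule: infinite_finite_induct) (auto simp: lift_1 lift_mult)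

end

interpretation const_lift: poly_lift Const x for x
  by unfold_locales (simp_all add: Const_add Const_mult)

lemma maximal_ideal_exists:
  assumes "1 \<notin> ideal.span A"
  obtains M where "ideal.span M = M" "A \<subseteq> M" "1 \<notin> M" "\<And>x. x \<notin> M \<Longrightarrow> \<exists>u. 1 - u * x \<in> M"
proof -
  define \<A> where "\<A> = {I. ideal.subspace I \<and> A \<subseteq> I \<and> 1 \<notin> I}"
  have "\<exists>M\<in>\<A>. \<forall>X\<in>\<A>. M \<subseteq> X \<longrightarrow> X = M"
  proof (rule subset_Zorn_nonempty)
    show "\<A> \<noteq> {}" using assms ideal.span_superset[of A] by (auto simp: \<A>_def)
    fix \<C> assume C: "\<C> \<noteq> {}" "subset.chain \<A> \<C>"
    have sub: "ideal.subspace I" if "I \<in> \<C>" for I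
      using C(2) that by (auto simp: subset.chain_def \<A>_def)
    have "ideal.subspace (\<Union>\<C>)"
    proof (rule ideal.subspaceI)
      show "0 \<in> \<Union>\<C>" using C(1) sub ideal.subspace_0 by blast
      show "c * x \<in> \<Union>\<C>" if "x \<in> \<Union>\<C>" for c x
        using that sub ideal.subspace_scale by blast
      show "x + y \<in> \<Union>\<C>" if xy: "x \<in> \<Union>\<C>" "y \<in> \<Union>\<C>" for x y
      proof -
        obtain I J where IJ: "I \<in> \<C>" "x \<in> I" "J \<in> \<C>" "y \<in> J" using xy by blast
        have "I \<subseteq> J \<or> J \<subseteq> I" using C(2) IJ by (auto simp: subset.chain_def)
        then obtain L where "L \<in> \<C>" "x \<in> L" "y \<in> L" using IJ by blast
        then show ?thesis using sub ideal.subspace_add by blast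
      qed
    qed
    then show "\<Union>\<C> \<in> \<A>" using C by (auto simp: \<A>_def subset.chain_def)
  qed
  then obtain M where M: "M \<in> \<A>" and mx: "\<And>X. X \<in> \<A> \<Longrightarrow> M \<subseteq> X \<Longrightarrow> X = M" by blast
  have spanM: "ideal.span M = M" using M by (simp add: \<A>_def)
  have "\<exists>u. 1 - u * x \<in> M" if x: "x \<notin> M" for x
  proof -
    have "M \<subseteq> ideal.span (insert x M)" "x \<in> ideal.span (insert x M)"
      by (auto intro: ideal.span_base)
    then have "ideal.span (insert x M) \<notin> \<A>" using mx x by blast
    then have "1 \<in> ideal.span (insert x M)"
      using M \<open>M \<subseteq> ideal.span (insert x M)\<close> by (auto simp: \<A>_def)
    then show ?thesis by (simp add: ideal.span_insert spanM)
  qed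
  then show ?thesis using that[of M] M spanM by (auto simp: \<A>_def)
qed

text \<open>
  Over the complex numbers \<open>q\<close> is a product of linear factors, and a prime ideal contains one of them.
\<close>

lemma root_in_prime:
  assumes "ideal.span M = M" "1 \<notin> M" and prime: "\<And>x y. x * y \<in> M \<Longrightarrow> x \<in> M \<or> y \<in> M"
    and "q \<noteq> 0" "const_lift.lift x q \<in> M"
  shows "\<exists>r. x - Const r \<in> M"
  using assms(4,5)
proof (induction "degree q" arbitrary: q)
  case 0
  then obtain a where a: "q = [:a:]" "a \<noteq> 0" by (metis degree_eq_zeroE pCons_0_0)
  then have "Const a \<in> ideal.span M"
    using 0 unfolding assms(1) by (simp add: const_lift.lift_const)
  from ideal_mult_left[OF this, of "Const (inverse a)"] have "1 \<in> M"
    using a assms(1) by (simp flip: Const_mult)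
  then show ?case using assms(2) by simp
next
  case (Suc n)
  have "\<not> constant (poly q)" using Suc(2) by (simp add: constant_degree)
  then obtain r where "poly q r = 0" using fundamental_theorem_of_algebra by blast
  then obtain p where p: "q = [:-r, 1:] * p" by (auto simp: poly_eq_0_iff_dvd)
  have "p \<noteq> 0" using Suc p by auto
  then have "degree q = Suc (degree p)" unfolding p by (subst degree_mult_eq) auto
  moreover have "const_lift.lift x q = (x - Const r) * const_lift.lift x p"
    using Const_add[of r "-r"]
    by (simp only: p const_lift.lift_mult const_lift.lift_pCons const_lift.lift_0)
      (simp add: add_eq_0_iff)
  ultimately show ?case using Suc \<open>p \<noteq> 0\<close> prime by fastforce
qed

text \<open>
  Let \<open>M\<close> be a maximal ideal containing \<open>A\<close>.  If no \<open>x\<^sub>j - c\<close> lies in \<open>M\<close>, each of them has an inverse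
  \<open>w c\<close> modulo \<open>M\<close>.  There are uncountably many \<open>c\<close>, so infinitely many of the \<open>w c\<close> have bounded degree, and
  finitely many of these are linearly dependent.  Clearing denominators yields a nonzero polynomial in
  \<open>x\<^sub>j\<close> that lies in \<open>M\<close>; but then a linear factor lies in \<open>M\<close>.  So \<open>M\<close> is the ideal of a point.
\<close>

lemma weak_nullstellensatz:
  assumes "1 \<notin> ideal.span A" "vars_from (Suc n) \<subseteq> A"
  obtains v where "\<And>p. p \<in> A \<Longrightarrow> mpoly_eval p v = 0"
proof -
  obtain M where spanM: "ideal.span M = M" and AM: "A \<subseteq> M" and M1: "1 \<notin> M"
    and inv: "\<And>x. x \<notin> M \<Longrightarrow> \<exists>u. 1 - u * x \<in> M"
    using maximal_ideal_exists[OF assms(1)] by metis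
  note add = ideal.span_add[of _ M, unfolded spanM] and diff = ideal.span_diff[of _ M, unfolded spanM]
    and scale = ideal.span_scale[of _ M, unfolded spanM]
  have prime: "x \<in> M \<or> y \<in> M" if "x * y \<in> M" for x y
  proof (rule ccontr)
    assume no: "\<not> (x \<in> M \<or> y \<in> M)"
    then obtain u where "1 - u * x \<in> M" using inv by blast
    then have "y * (1 - u * x) + u * (x * y) \<in> M" by (rule add[OF scale scale[OF that]])
    moreover have "y * (1 - u * x) + u * (x * y) = y" by (simp add: algebra_simps)
    ultimately show False using no by simp
  qed
  have "\<exists>c. Var j - Const c \<in> M" for j
  proof (rule ccontr)
    assume no: "\<nexists>c. Var j - Const c \<in> M"
    let ?x = "Var j"
    have "\<forall>c. \<exists>u. 1 - u * (?x - Const c) \<in> M" using inv no by blast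
    from choice[OF this] obtain u where u: "\<And>c. 1 - u c * (?x - Const c) \<in> M" by blast
    \<comment> \<open>Only monomials in \<open>x\<^sub>0, \<dots>, x\<^sub>n\<close> may occur, so that bounded degree means finite dimension.\<close>
    define w where "w c = trunc n (u c)" for c
    have w: "1 - w c * (?x - Const c) \<in> M" for c
    proof -
      have uw: "u c - w c \<in> M"
        using diff_trunc[of "u c" n] ideal.span_mono[OF assms(2)] ideal.span_mono[OF AM]
        by (auto simp: w_def spanM)
      have "(1 - u c * (?x - Const c)) + (?x - Const c) * (u c - w c) \<in> M"
        by (rule add[OF u scale[OF uw]])
      then show ?thesis by (simp add: algebra_simps)
    qed
    define S where "S D = {c. \<forall>m\<in>keys (w c). mdeg m \<le> D}" for D
    have "c \<in> S (\<Sum>m\<in>keys (w c). mdeg m)" for c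
      by (auto simp: S_def intro: member_le_sum)
    then have UN: "UNIV = (\<Union>D. S D)" by blast
    have "\<exists>D. infinite (S D)"
    proof (rule ccontr)
      assume "\<not> (\<exists>D. infinite (S D))"
      then have "countable (\<Union>D. S D)" by (intro countable_UN) (auto intro: countable_finite)
      then show False using uncountable_UNIV_complex UN by simp
    qed
    then obtain D where D: "infinite (S D)" by blast
    define B where "B = (\<Union>k\<le>D. monoms (Suc n) k)"
    have "finite B" by (simp add: B_def finite_monoms)
    obtain C where C: "C \<subseteq> S D" "finite C" "card C = Suc (card B)"
      using infinite_arbitrarily_large[OF D] by blast
    obtain l where l: "\<exists>c\<in>C. l c \<noteq> 0" "\<forall>m\<in>B. (\<Sum>c\<in>C. l c * lookup (w c) m) = 0"
      using homogeneous_system_nontrivial_solution[OF \<open>finite B\<close> C(2), of "\<lambda>c. lookup (w c)"] C(3)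
      by auto
    have rel: "(\<Sum>c\<in>C. Const (l c) * w c) = 0"
    proof (rule poly_mapping_eqI)
      fix m
      have lk: "lookup (\<Sum>c\<in>C. Const (l c) * w c) m = (\<Sum>c\<in>C. l c * lookup (w c) m)"
        by (simp add: lookup_sum Const_def lookup_single_mult[of "0::monom" _ "_ :: mpoly" m, simplified])
      show "lookup (\<Sum>c\<in>C. Const (l c) * w c) m = lookup 0 m"
      proof (cases "m \<in> B")
        case False
        have "lookup (w c) m = 0" if "c \<in> C" for c
        proof (rule ccontr)
          assume "lookup (w c) m \<noteq> 0"
          then have "m \<in> keys (w c)" by (simp add: in_keys_iff)
          moreover from this have "keys m \<subseteq> {..n}"
            using trunc_in_poly_ring[of n "u c"] by (auto simp: w_def poly_ring_def)
          moreover have "mdeg m \<le> D" using \<open>m \<in> keys (w c)\<close> C(1) that by (auto simp: S_def)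
          ultimately show False using False by (auto simp: B_def monoms_def less_Suc_eq_le)
        qed
        then show ?thesis by (simp add: lk)
      qed (use l lk in simp)
    qed
    \<comment> \<open>The numerator of \<open>\<Sum>c\<in>C. l c / (x - c)\<close>; it is nonzero at every \<open>c0\<close> with \<open>l c0 \<noteq> 0\<close>.\<close>
    define q where "q = (\<Sum>c\<in>C. smult (l c) (\<Prod>d\<in>C - {c}. [:-d, 1:]))"
    obtain c0 where c0: "c0 \<in> C" "l c0 \<noteq> 0" using l(1) by blast
    have "poly q c0 = (\<Sum>c\<in>C. if c = c0 then l c0 * (\<Prod>d\<in>C - {c0}. c0 - d) else 0)"
      unfolding q_def poly_sum
    proof (rule sum.cong)
      fix c assume "c \<in> C"
      then show "poly (smult (l c) (\<Prod>d\<in>C - {c}. [:- d, 1:])) c0 =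
          (if c = c0 then l c0 * (\<Prod>d\<in>C - {c0}. c0 - d) else 0)"
        using c0 C(2) by (auto simp: poly_prod)
    qed simp
    also have "\<dots> \<noteq> 0" using c0 C(2) by auto
    finally have "q \<noteq> 0" by auto
    let ?P = "\<lambda>C. \<Prod>d\<in>C. ?x - Const d"
    have lin: "const_lift.lift ?x [:-d, 1:] = ?x - Const d" for d
      using Const_add[of d "-d"]
      by (simp add: const_lift.lift_pCons const_lift.lift_0 add_eq_0_iff)
    have lq: "const_lift.lift ?x q = (\<Sum>c\<in>C. Const (l c) * ?P (C - {c}))"
      by (simp only: q_def const_lift.lift_sum const_lift.lift_smult const_lift.lift_prod lin)
    have "(\<Sum>c\<in>C. Const (l c) * ?P (C - {c})) - (\<Sum>c\<in>C. Const (l c) * (?P C * w c)) \<in> ideal.span M"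
    proof (rule cong_sum)
      fix c assume c: "c \<in> C"
      have PC: "?P C = (?x - Const c) * ?P (C - {c})" using c C(2) by (rule prod.remove[rotated])
      have "(Const (l c) * ?P (C - {c})) * (1 - w c * (?x - Const c)) \<in> M" by (rule scale[OF w])
      then show "Const (l c) * ?P (C - {c}) - Const (l c) * (?P C * w c) \<in> ideal.span M"
        unfolding PC spanM by (simp add: algebra_simps)
    qed
    moreover have "(\<Sum>c\<in>C. Const (l c) * (?P C * w c)) = ?P C * (\<Sum>c\<in>C. Const (l c) * w c)"
      by (simp add: sum_distrib_left mult_ac)
    ultimately have "const_lift.lift ?x q \<in> M" by (simp add: lq rel spanM)
    then show False using root_in_prime[OF spanM M1 prime \<open>q \<noteq> 0\<close>] no by blast
  qed
  then obtain v where v: "\<And>j. Var j - Const (v j) \<in> ideal.span M" unfolding spanM by metis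
  have "mpoly_eval p v = 0" if "p \<in> A" for p
  proof -
    have "(\<Sum>m\<in>keys p. Const (lookup p m) * (\<Prod>j\<in>keys m. Var j ^ lookup m j)) -
        (\<Sum>m\<in>keys p. Const (lookup p m) * (\<Prod>j\<in>keys m. Const (v j) ^ lookup m j)) \<in> ideal.span M"
      by (intro cong_sum cong_mult cong_prod cong_power v) (simp add: ideal.span_zero)
    moreover have "(\<Sum>m\<in>keys p. Const (lookup p m) * (\<Prod>j\<in>keys m. Const (v j) ^ lookup m j)) =
        Const (mpoly_eval p v)"
      by (simp add: Const_power Const_prod Const_sum mpoly_eval_def mpoly_subst_def flip: Const_mult)
    ultimately have "p - Const (mpoly_eval p v) \<in> ideal.span M"
      using mpoly_expand[of p] by simp
    then have "p - Const (mpoly_eval p v) \<in> M" unfolding spanM .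
    moreover have "p \<in> M" using that AM by blast
    ultimately have "p - (p - Const (mpoly_eval p v)) \<in> M" by (rule diff[rotated])
    then have c: "Const (mpoly_eval p v) \<in> M" by simp
    show ?thesis
    proof (rule ccontr)
      assume "mpoly_eval p v \<noteq> 0"
      then have "Const (inverse (mpoly_eval p v)) * Const (mpoly_eval p v) = 1"
        by (simp flip: Const_mult)
      then show False using scale[OF c, of "Const (inverse (mpoly_eval p v))"] M1 by simp
    qed
  qed
  then show ?thesis using that by blast
qed

text \<open>
  Comparing the components of degree \<open>l\<close> in \<open>1 = u * (x - 1)\<close> modulo \<open>A\<close> shows that the component of \<open>u\<close> is
  \<open>- x ^ l\<close>; it vanishes for large \<open>l\<close>.
\<close>

lemma power_in_span_if_dehomogenised:
  assumes A: "all_forms A" and x: "x \<in> forms 1" and one: "1 \<in> ideal.span (insert (x - 1) A)"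
  shows "\<exists>k. x ^ k \<in> ideal.span A"
proof -
  obtain u where u: "1 - u * (x - 1) \<in> ideal.span A" using one by (auto simp: ideal.span_insert)
  have comp: "hcomp l (1 - u * (x - 1)) =
      (if l = 0 then 1 else 0) - ((if 1 \<le> l then x * hcomp (l - 1) u else 0) - hcomp l u)" for l
  proof -
    have "1 - u * (x - 1) = 1 - (x * u - u)" by (simp add: algebra_simps)
    then show ?thesis
      unfolding hcomp_diff[symmetric]
      by (simp only: hcomp_diff hcomp_mult[OF x] hcomp_form[OF forms_one])
  qed
  have "hcomp l u + x ^ l \<in> ideal.span A" for l
  proof (induction l)
    case 0
    then show ?case using hcomp_in_span[OF A u, of 0] comp[of 0] by (simp add: add.commute)
  next
    case (Suc l)
    have "hcomp (Suc l) (1 - u * (x - 1)) + x * (hcomp l u + x ^ l) \<in> ideal.span A"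
      by (rule ideal.span_add[OF hcomp_in_span[OF A u] ideal_mult_left[OF Suc]])
    then show ?case unfolding comp by (simp add: algebra_simps)
  qed
  from this[of "Suc (\<Sum>m\<in>keys u. mdeg m)"]
  have "hcomp (Suc (\<Sum>m\<in>keys u. mdeg m)) u + x ^ Suc (\<Sum>m\<in>keys u. mdeg m) \<in> ideal.span A" .
  moreover have "hcomp (Suc (\<Sum>m\<in>keys u. mdeg m)) u = 0"
  proof (rule poly_mapping_eqI)
    fix m
    have "m \<in> keys u \<Longrightarrow> mdeg m \<le> (\<Sum>m\<in>keys u. mdeg m)" by (intro member_le_sum) auto
    then show "lookup (hcomp (Suc (\<Sum>m\<in>keys u. mdeg m)) u) m = lookup 0 m"
      by (cases "m \<in> keys u") (auto simp: lookup_hcomp when_def in_keys_iff)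
  qed
  ultimately have "x ^ Suc (\<Sum>m\<in>keys u. mdeg m) \<in> ideal.span A" by simp
  then show ?thesis by blast
qed

text \<open>
  A power of every variable lies in the ideal, because adding \<open>x\<^sub>i - 1\<close> to the ideal removes the only zero.
  A monomial of large degree is divisible by one of these powers.
\<close>

theorem projective_nullstellensatz:
  assumes A: "all_forms A" and vars: "vars_from (Suc n) \<subseteq> A"
    and no_zero: "\<And>v. (\<And>a. a \<in> A \<Longrightarrow> mpoly_eval a v = 0) \<Longrightarrow> v = (\<lambda>_. 0)"
  shows "\<exists>K. forms K \<subseteq> ideal.span A"
proof -
  have "\<exists>k. Var i ^ k \<in> ideal.span A" for i
  proof (rule power_in_span_if_dehomogenised[OF A forms_Var], rule ccontr)
    assume "1 \<notin> ideal.span (insert (Var i - 1) A)"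
    then obtain v where v: "\<And>p. p \<in> insert (Var i - 1) A \<Longrightarrow> mpoly_eval p v = 0"
      using weak_nullstellensatz vars by (metis subset_insertI2)
    have "v i = 1" using v[of "Var i - 1"] by (simp add: mpoly_eval_diff)
    moreover have "v = (\<lambda>_. 0)" using v by (intro no_zero) auto
    ultimately show False by simp
  qed
  then obtain k where k: "\<And>i. Var i ^ k i \<in> ideal.span A" by metis
  define K where "K = Suc (\<Sum>i\<le>n. k i)"
  have "single m c \<in> ideal.span A" if m: "mdeg m = K" for m c
  proof -
    \<comment> \<open>Otherwise the degree of \<open>m\<close> would be at most \<open>\<Sum>i\<le>n. k i < K\<close>.\<close>
    have "\<exists>i\<in>keys m. i > n \<or> k i \<le> lookup m i"
    proof (rule ccontr)
      assume "\<not> (\<exists>i\<in>keys m. i > n \<or> k i \<le> lookup m i)"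
      then have sub: "keys m \<subseteq> {..n}" and le: "\<And>i. i \<in> keys m \<Longrightarrow> lookup m i \<le> k i"
        by (auto simp: not_less not_le intro: less_imp_le)
      have "mdeg m \<le> (\<Sum>i\<in>keys m. k i)" unfolding mdeg_def using le by (rule sum_mono)
      also have "\<dots> \<le> (\<Sum>i\<le>n. k i)" using sub by (intro sum_mono2) auto
      finally show False using m by (simp add: K_def)
    qed
    then obtain i where i: "i \<in> keys m" "i > n \<or> k i \<le> lookup m i" by blast
    have "Var i ^ lookup m i \<in> ideal.span A"
    proof (cases "i > n")
      case True
      have "lookup m i \<noteq> 0" using i(1) by (simp add: in_keys_iff)
      then obtain r where r: "lookup m i = Suc r" by (cases "lookup m i") auto
      have "Var i \<in> A" using True vars by (auto simp: vars_from_def)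
      then show ?thesis using ideal_mult_right[OF ideal.span_base] by (simp add: r)
    next
      case False
      then have "Var i ^ lookup m i = Var i ^ k i * Var i ^ (lookup m i - k i)"
        using i(2) by (simp flip: power_add)
      then show ?thesis using ideal_mult_right[OF k] by simp
    qed
    then have "Const c * (Var i ^ lookup m i * (\<Prod>j\<in>keys m - {i}. Var j ^ lookup m j)) \<in> ideal.span A"
      by (intro ideal_mult_left ideal_mult_right)
    also have "Var i ^ lookup m i * (\<Prod>j\<in>keys m - {i}. Var j ^ lookup m j) =
        (\<Prod>j\<in>keys m. Var j ^ lookup m j)"
      using i(1) by (intro prod.remove[symmetric]) auto
    finally show ?thesis by (simp only: single_eq_prod_Var)
  qed
  then have "(\<Sum>m\<in>keys p. single m (lookup p m)) \<in> ideal.span A" if "p \<in> forms K" for p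
    using that by (intro ideal.span_sum) (auto simp: forms_def)
  then have "forms K \<subseteq> ideal.span A" by (auto simp: sum_monomials)
  then show ?thesis by blast
qed

section \<open>The Milnor algebra\<close>

lemma monom_minus_single:
  "lookup m j \<noteq> 0 \<Longrightarrow> single j 1 + (m - single j 1) = (m :: monom)"
  by (rule monom_split) (simp add: in_keys_iff)

lemma pderiv_wrt_homog:
  assumes f: "f \<in> homog n d"
  shows "pderiv_wrt j f \<in> homog n (d - 1)"
proof -
  have "single (m - single j 1) (of_nat (lookup m j) * lookup f m) \<in> homog n (d - 1)"
    if m: "m \<in> keys f" for m
  proof (cases "lookup m j = 0")
    case True
    then show ?thesis by (simp add: homog_eq)
  next
    case False
    have "mdeg m = d" "keys m \<subseteq> {..n}" using f m by (auto simp: homog_def poly_ring_def)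
    moreover have "mdeg m = 1 + mdeg (m - single j 1)"
      using arg_cong[OF monom_minus_single[OF False], of mdeg] by (simp add: mdeg_add)
    moreover have "keys (m - single j 1) \<subseteq> keys m"
      by (auto simp: in_keys_iff lookup_minus)
    ultimately show ?thesis by (auto simp: homog_def poly_ring_def)
  qed
  then show ?thesis
    unfolding pderiv_wrt_def homog_eq by (auto intro!: poly_ring_sum forms_sum)
qed

lemma euler_identity:
  assumes f: "f \<in> homog n d"
  shows "(\<Sum>j\<le>n. Var j * pderiv_wrt j f) = Const (of_nat d) * f"
proof -
  have *: "Var j * single (m - single j 1) (of_nat (lookup m j) * c) =
      single m (of_nat (lookup m j) * c)" for j m c
  proof (cases "lookup m j = 0")
    case False
    show ?thesis using monom_minus_single[OF False] by (simp add: Var_def mult_single)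
  qed simp
  have sum_single: "(\<Sum>j\<in>J. single m (g j)) = (single m (sum g J) :: mpoly)"
    for g and J :: "nat set" and m
    by (induction J rule: infinite_finite_induct) (auto simp: single_add)
  have "(\<Sum>j\<le>n. Var j * pderiv_wrt j f) =
      (\<Sum>j\<le>n. \<Sum>m\<in>keys f. single m (of_nat (lookup m j) * lookup f m))"
    by (simp only: pderiv_wrt_def sum_distrib_left *)
  also have "\<dots> = (\<Sum>m\<in>keys f. \<Sum>j\<le>n. single m (of_nat (lookup m j) * lookup f m))"
    by (rule sum.swap)
  also have "\<dots> = (\<Sum>m\<in>keys f. single m (of_nat d * lookup f m))"
  proof (rule sum.cong)
    fix m assume m: "m \<in> keys f"
    have "mdeg m = (\<Sum>j\<le>n. lookup m j)"
      using f m by (intro mdeg_superset) (auto simp: homog_def poly_ring_def)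
    moreover have "mdeg m = d" using f m by (auto simp: homog_def)
    ultimately have "(\<Sum>j\<le>n. of_nat (lookup m j) * lookup f m) = of_nat d * lookup f m"
      by (simp flip: sum_distrib_right of_nat_sum)
    then show "(\<Sum>j\<le>n. single m (of_nat (lookup m j) * lookup f m)) = single m (of_nat d * lookup f m)"
      by (simp only: sum_single)
  qed simp
  also have "\<dots> = Const (of_nat d) * (\<Sum>m\<in>keys f. single m (lookup f m))"
    by (simp add: sum_distrib_left Const_def mult_single del: single_of_nat)
  finally show ?thesis by (simp only: sum_monomials)
qed

definition partials :: "nat \<Rightarrow> mpoly \<Rightarrow> mpoly set" where
  "partials n f = (\<lambda>j. pderiv_wrt j f) ` {..n}"

definition jac_gens :: "nat \<Rightarrow> mpoly \<Rightarrow> mpoly set" where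
  "jac_gens n f = vars_from (Suc n) \<union> partials n f"

lemma partials_forms: "f \<in> homog n d \<Longrightarrow> partials n f \<subseteq> forms (d - 1)"
  using pderiv_wrt_homog by (auto simp: partials_def homog_eq)

lemma all_forms_jac_gens: "f \<in> homog n d \<Longrightarrow> all_forms (jac_gens n f)"
  using partials_forms[of f n d] by (auto simp: jac_gens_def all_forms_Un all_forms_def[of "partials n f"])

text \<open>
  Truncation maps the ideal in all variables onto the Jacobian ideal and fixes \<open>poly_ring n\<close>.
\<close>

lemma jacobian_ideal_eq:
  assumes f: "f \<in> homog n d"
  shows "jacobian_ideal n f = poly_ring n \<inter> ideal.span (jac_gens n f)"
proof (intro equalityI subsetI)
  have pd: "pderiv_wrt j f \<in> poly_ring n" for j
    using pderiv_wrt_homog[OF f] by (auto simp: homog_eq)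
  fix p
  {
    assume "p \<in> jacobian_ideal n f"
    then obtain h where h: "p = (\<Sum>j\<le>n. h j * pderiv_wrt j f)" "\<forall>j\<le>n. h j \<in> poly_ring n"
      by (auto simp: jacobian_ideal_def)
    have "p \<in> poly_ring n" unfolding h(1) using h(2) pd by (intro poly_ring_sum poly_ring_mult) auto
    moreover have "p \<in> ideal.span (jac_gens n f)"
      unfolding h(1) by (intro ideal.span_sum ideal.span_scale ideal.span_base)
        (auto simp: jac_gens_def partials_def)
    ultimately show "p \<in> poly_ring n \<inter> ideal.span (jac_gens n f)" by simp
  next
    assume p: "p \<in> poly_ring n \<inter> ideal.span (jac_gens n f)"
    have tr: "trunc n q \<in> jacobian_ideal n f" if "q \<in> ideal.span (jac_gens n f)" for q
      using that
    proof (induction rule: ideal.span_induct_alt)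
      case base
      have "0 = (\<Sum>j\<le>n. 0 * pderiv_wrt j f)" by simp
      then have "0 \<in> jacobian_ideal n f"
        unfolding jacobian_ideal_def by (intro CollectI exI[of _ "\<lambda>_. 0"]) simp
      then show ?case using trunc_id[of 0 n] by simp
    next
      case (step c x y)
      then obtain h where h: "trunc n y = (\<Sum>j\<le>n. h j * pderiv_wrt j f)" "\<forall>j\<le>n. h j \<in> poly_ring n"
        by (auto simp: jacobian_ideal_def)
      show ?case
      proof (cases "x \<in> vars_from (Suc n)")
        case True
        then have "trunc n (c * x) = 0"
          by (intro trunc_vars ideal_mult_left ideal.span_base)
        then show ?thesis using step by (simp add: trunc_add)
      next
        case False
        then obtain i where i: "i \<le> n" "x = pderiv_wrt i f"
          using step by (auto simp: jac_gens_def partials_def)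
        define h' where "h' = h(i := trunc n c + h i)"
        have "trunc n (c * x + y) = trunc n c * pderiv_wrt i f + (\<Sum>j\<le>n. h j * pderiv_wrt j f)"
          using h i trunc_id[OF pd] by (simp add: trunc_add trunc_mult)
        also have "\<dots> = (\<Sum>j\<le>n. h' j * pderiv_wrt j f)"
        proof -
          have "(\<Sum>j\<in>{..n} - {i}. h' j * pderiv_wrt j f) = (\<Sum>j\<in>{..n} - {i}. h j * pderiv_wrt j f)"
            by (intro sum.cong) (auto simp: h'_def)
          then show ?thesis
            using i sum.remove[of "{..n}" i "\<lambda>j. h j * pderiv_wrt j f"]
              sum.remove[of "{..n}" i "\<lambda>j. h' j * pderiv_wrt j f"]
            by (simp add: h'_def distrib_right)
        qed
        finally show ?thesis
          using h(2) trunc_in_poly_ring[of n c] unfolding jacobian_ideal_def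
          by (auto simp: h'_def poly_ring_add intro!: exI[of _ h'])
      qed
    qed
    show "p \<in> jacobian_ideal n f" using p tr[of p] trunc_id[of p n] by simp
  }
qed

lemma hilbert_fun_exists:
  assumes "vars_from r \<subseteq> A"
  shows "\<exists>h. hilbert_fun A h"
proof -
  have "\<exists>v. has_qdim poly_scale (forms k) (forms k \<inter> ideal.span A) v" for k
  proof -
    have d: "has_qdim poly_scale (forms k) (forms k \<inter> ideal.span (vars_from r)) (card (monoms r k))"
      using hilbert_fun_vars_from by (simp add: hilbert_fun_def)
    have sub: "forms k \<inter> ideal.span (vars_from r) \<subseteq> forms k \<inter> ideal.span A"
      using ideal.span_mono[OF assms] by blast
    have ss: "lin.subspace (forms k \<inter> ideal.span B)" for B
      by (intro lin.subspace_inter) auto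
    show ?thesis
      using lin.has_qdim_split[OF forms_lin_subspace ss ss sub Int_lower1 d] by blast
  qed
  then have "\<forall>k. \<exists>v. has_qdim poly_scale (forms k) (forms k \<inter> ideal.span A) v" by blast
  from choice[OF this] show ?thesis by (simp add: hilbert_fun_def)
qed

lemma homog_lin_subspace: "lin.subspace (homog n k)"
  unfolding homog_eq
  by (intro lin.subspace_inter forms_lin_subspace)
    (auto simp: lin.subspace_def poly_ring_add poly_ring_mult)

lemma has_qdim_homog:
  assumes "vars_from (Suc n) \<subseteq> A"
    and "has_qdim poly_scale (forms k) (forms k \<inter> ideal.span A) a"
  shows "has_qdim poly_scale (homog n k) (homog n k \<inter> ideal.span A) a"
proof (rule has_qdim_transfer[OF lin.complex_space_axioms lin.complex_space_axioms,
      where \<phi> = "trunc n" and V = "forms k"])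
  show "lin.subspace (homog n k \<inter> ideal.span A)"
    by (intro lin.subspace_inter homog_lin_subspace span_lin_subspace)
  show "trunc n (Const c * v) = Const c * trunc n v" for c v
    by (simp add: trunc_mult trunc_id)
  show in_homog: "trunc n v \<in> homog n k" if "v \<in> forms k" for v
    using that by (simp add: homog_eq trunc_in_poly_ring trunc_forms)
  show "\<exists>v\<in>forms k. w - trunc n v \<in> homog n k \<inter> ideal.span A" if "w \<in> homog n k" for w
    using that lin.subspace_0[OF homog_lin_subspace]
    by (intro bexI[of _ w]) (auto simp: homog_eq trunc_id ideal.span_zero)
  show "trunc n v \<in> homog n k \<inter> ideal.span A \<longleftrightarrow> v \<in> forms k \<inter> ideal.span A" if v: "v \<in> forms k" for v
  proof -
    have d: "v - trunc n v \<in> ideal.span A"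
      using diff_trunc ideal.span_mono[OF assms(1)] by blast
    have "v \<in> ideal.span A \<longleftrightarrow> trunc n v \<in> ideal.span A"
      using ideal.span_add[OF d, of "trunc n v"] ideal.span_diff[OF _ d, of v] by auto
    then show ?thesis using v in_homog[OF v] by simp
  qed
qed (use assms in \<open>auto simp: trunc_add\<close>)

lemma milnor_dim_eq:
  assumes f: "f \<in> homog n d" and h: "hilbert_fun (jac_gens n f) h"
  shows "milnor_dim n f k = enat (h k)"
proof -
  have "homog n k \<inter> jacobian_ideal n f = homog n k \<inter> ideal.span (jac_gens n f)"
    by (auto simp: jacobian_ideal_eq[OF f] homog_eq)
  moreover have "has_qdim poly_scale (homog n k) (homog n k \<inter> ideal.span (jac_gens n f)) (h k)"
    using h by (intro has_qdim_homog) (auto simp: hilbert_fun_def jac_gens_def)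
  ultimately show ?thesis
    unfolding milnor_dim_def
    by (intro lin.quot_dim_eq) (auto intro: lin.subspace_inter homog_lin_subspace)
qed

text \<open>
  By Euler's identity a common zero of the partial derivatives is a zero of \<open>f\<close>; rescaled to the normalised
  coordinates it would be a singular point.
\<close>

lemma smooth_forms_in_span:
  assumes f: "f \<in> homog n d" and d: "d \<ge> 1" and smooth: "sing_points n f = {}"
  shows "\<exists>K. forms K \<subseteq> ideal.span (jac_gens n f)"
proof (rule projective_nullstellensatz[OF all_forms_jac_gens[OF f]])
  show "vars_from (Suc n) \<subseteq> jac_gens n f" by (simp add: jac_gens_def)
  fix v assume v: "\<And>a. a \<in> jac_gens n f \<Longrightarrow> mpoly_eval a v = 0"
  show "v = (\<lambda>_. 0)"
  proof (rule ccontr)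
    assume nz: "v \<noteq> (\<lambda>_. 0)"
    define t where "t = inverse (v (chart_index v))"
    \<comment> \<open>The normalised coordinates of the point with coordinates \<open>v\<close>.\<close>
    define w where "w = (\<lambda>j. t * v j)"
    have ex: "\<exists>j. v j \<noteq> 0" using nz by auto
    then have "v (chart_index v) \<noteq> 0" unfolding chart_index_def by (rule LeastI_ex)
    then have t: "t \<noteq> 0" "t * v (chart_index v) = 1" by (auto simp: t_def)
    have chart: "chart_index w = chart_index v" using t by (simp add: chart_index_def w_def)
    have "v j = 0" if "j > n" for j
    proof -
      have "Var j \<in> jac_gens n f" using that by (simp add: jac_gens_def vars_from_def)
      from v[OF this] show ?thesis by simp
    qed
    then have "w \<in> proj_space n"
      using t ex chart by (auto simp: proj_space_def hom_coords_def w_def)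
    moreover have dw: "mpoly_eval (pderiv_wrt j f) w = 0" if "j \<le> n" for j
    proof -
      have "mpoly_eval (pderiv_wrt j f) v = 0"
        using that by (intro v) (auto simp: jac_gens_def partials_def)
      moreover have "pderiv_wrt j f \<in> forms (d - 1)"
        using pderiv_wrt_homog[OF f] by (simp add: homog_eq)
      ultimately show ?thesis unfolding w_def by (simp add: mpoly_eval_form_scale)
    qed
    moreover have "mpoly_eval f w = 0"
    proof -
      have "of_nat d * mpoly_eval f w = mpoly_eval (\<Sum>j\<le>n. Var j * pderiv_wrt j f) w"
        by (simp add: euler_identity[OF f] mpoly_eval_mult)
      also have "\<dots> = 0" using dw by (simp add: mpoly_eval_sum mpoly_eval_mult)
      finally show ?thesis using d by simp
    qed
    ultimately have "w \<in> sing_points n f" by (simp add: sing_points_def sing_at_def)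
    then show False using smooth by simp
  qed
qed

lemma hilbert_fun_smooth:
  assumes f: "f \<in> homog n d" and d: "d \<ge> 2" and smooth: "sing_points n f = {}"
  shows "hilbert_fun (jac_gens n f) (\<lambda>k. nat (coeff (geom_poly (d - 1) ^ Suc n) k))"
proof -
  obtain K where K: "forms K \<subseteq> ideal.span (jac_gens n f)"
    using smooth_forms_in_span[OF f _ smooth] d by auto
  define Fs where "Fs = map (\<lambda>j. pderiv_wrt j f) [0..<Suc n]"
  have Fs: "set Fs = partials n f" "length Fs = Suc n"
    by (auto simp: Fs_def partials_def less_Suc_eq_le simp del: upt_Suc)
  show ?thesis
    using hilbert_fun_complete_intersection_coeff[of "d - 1" Fs "Suc n" K] K d Fs partials_forms[OF f]
    by (simp add: jac_gens_def)
qed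

lemma eval_jac_gens_singular:
  assumes v: "v \<in> sing_points n f" and p: "p \<in> ideal.span (jac_gens n f)"
  shows "mpoly_eval p v = 0"
  using p
proof (induction rule: ideal.span_induct_alt)
  case (step c x y)
  have "mpoly_eval x v = 0"
    using step(1) v
    by (auto simp: jac_gens_def partials_def vars_from_def sing_points_def sing_at_def
        proj_space_def hom_coords_def)
  then show ?case using step by (simp add: mpoly_eval_add mpoly_eval_mult)
qed simp

text \<open>
  The ideal vanishes at the singular point, but some power \<open>x\<^sub>i\<^sup>k\<close> does not.
\<close>

lemma hilbert_fun_singular_pos:
  assumes v: "v \<in> sing_points n f" and h: "hilbert_fun (jac_gens n f) h"
  shows "h k \<noteq> 0"
proof
  assume "h k = 0"
  then have sub: "forms k \<subseteq> ideal.span (jac_gens n f)"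
    using h lin.has_qdim_0_iff[of "forms k"] by (metis hilbert_fun_def le_inf_iff)
  have "v i = 0" for i
  proof -
    have "Var i ^ k \<in> forms k" using forms_power[OF forms_Var, of i k] by simp
    then have "mpoly_eval (Var i ^ k) v = 0" using sub by (intro eval_jac_gens_singular[OF v]) auto
    then show ?thesis by (simp add: mpoly_eval_power)
  qed
  then show False using v by (auto simp: sing_points_def proj_space_def hom_coords_def)
qed

lemma form_0_eq_Const: "p \<in> forms 0 \<Longrightarrow> p = Const (lookup p 0)"
  by (rule poly_mapping_eqI)
    (auto simp: forms_def Const_def lookup_single when_def mdeg_eq_0_iff in_keys_iff)

text \<open>
  For \<open>d \<le> 1\<close> the partial derivatives are constants.  They vanish at the singular point, so they are zero,
  and the Hilbert function is that of the polynomial ring, which increases strictly.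
\<close>

lemma degree_ge_2_if_eventually_constant:
  assumes n: "n \<ge> 1" and f: "f \<in> homog n d" and v: "v \<in> sing_points n f"
    and h: "hilbert_fun (jac_gens n f) h" and const: "h (Suc k) = h k"
  shows "d \<ge> 2"
proof (rule ccontr)
  assume "\<not> d \<ge> 2"
  then have d: "d - 1 = 0" by simp
  have "pderiv_wrt j f = 0" if "j \<le> n" for j
  proof -
    have "pderiv_wrt j f \<in> forms 0" using pderiv_wrt_homog[OF f, of j] d by (simp add: homog_eq)
    then have c: "pderiv_wrt j f = Const (lookup (pderiv_wrt j f) 0)" by (rule form_0_eq_Const)
    have "mpoly_eval (pderiv_wrt j f) v = 0" using v that by (simp add: sing_points_def sing_at_def)
    then have "lookup (pderiv_wrt j f) 0 = 0" using c mpoly_eval_Const by metis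
    then show ?thesis using c by simp
  qed
  then have "partials n f \<subseteq> {0}" by (auto simp: partials_def)
  then have "ideal.span (jac_gens n f) = ideal.span (vars_from (Suc n))"
    unfolding jac_gens_def
    by (intro equalityI ideal_span_subset) (auto intro: ideal.span_base ideal.span_zero)
  then have "hilbert_fun (vars_from (Suc n)) h" using h by (simp add: hilbert_fun_def)
  then have "h = (\<lambda>k. card (monoms (Suc n) k))" using hilbert_fun_unique hilbert_fun_vars_from by blast
  then have "card (monoms n (Suc k)) = 0" using const card_monoms_Suc[of n "Suc k"] by simp
  moreover have "single 0 (Suc k) \<in> monoms n (Suc k)" using n by (auto simp: monoms_def)
  ultimately show False using finite_monoms[of n "Suc k"] by auto
qed

section \<open>Overlap of the two thresholds\<close>

locale threshold_gap =
  fixes n d :: nat and f fs :: mpoly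
  assumes n: "n \<ge> 1" and f: "f \<in> homog n d" and sing: "sing_points n f \<noteq> {}"
    and fs: "fs \<in> homog n d" and smooth: "sing_points n fs = {}"
    and gap: "stability_threshold n f < coincidence_threshold n f fs"
begin

definition stable_from :: "nat set" where
  "stable_from = {q. \<forall>k\<ge>q. milnor_dim n f k = total_tjurina n f}"

definition coincide_to :: "nat set" where
  "coincide_to = {q. \<forall>k\<le>q. milnor_dim n f k = milnor_dim n fs k}"

definition hf :: "nat \<Rightarrow> nat" where
  "hf = (SOME h. hilbert_fun (jac_gens n f) h)"

lemma hilbert_fun_hf: "hilbert_fun (jac_gens n f) hf"
proof -
  have "\<exists>h. hilbert_fun (jac_gens n f) h" by (rule hilbert_fun_exists[of "Suc n"]) (simp add: jac_gens_def)
  then show ?thesis unfolding hf_def by (rule someI_ex)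
qed

lemma milnor_dim_f: "milnor_dim n f k = enat (hf k)"
  using milnor_dim_eq[OF f hilbert_fun_hf] .

lemma hf_pos: "hf k \<noteq> 0"
  using hilbert_fun_singular_pos[OF _ hilbert_fun_hf] sing by blast

lemma overlap: "\<exists>q\<in>stable_from. \<exists>q'\<in>coincide_to. q < q'"
proof -
  have "Inf (enat ` stable_from) < Sup (enat ` coincide_to)"
    using gap
    unfolding stability_threshold_def coincidence_threshold_def stable_from_def coincide_to_def .
  then obtain y where y: "y \<in> enat ` coincide_to" "Inf (enat ` stable_from) < y"
    unfolding less_Sup_iff by (rule bexE)
  obtain x where x: "x \<in> enat ` stable_from" "x < y" using y(2) unfolding Inf_less_iff by (rule bexE)
  obtain q where q: "x = enat q" "q \<in> stable_from" using x(1) by (rule imageE)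
  obtain q' where q': "y = enat q'" "q' \<in> coincide_to" using y(1) by (rule imageE)
  have "q < q'" using x(2) q(1) q'(1) by simp
  then show ?thesis using q(2) q'(2) by blast
qed

lemma hf_stable: "q \<in> stable_from \<Longrightarrow> q \<le> k \<Longrightarrow> hf k = hf q"
proof -
  assume q: "q \<in> stable_from" "q \<le> k"
  then have "milnor_dim n f k = total_tjurina n f" "milnor_dim n f q = total_tjurina n f"
    by (simp_all add: stable_from_def)
  then have "enat (hf k) = enat (hf q)" unfolding milnor_dim_f by (rule trans[OF _ sym])
  then show ?thesis by simp
qed

lemma d_ge_2: "d \<ge> 2"
proof -
  obtain q where "q \<in> stable_from" using overlap by blast
  then have "hf (Suc q) = hf q" by (rule hf_stable) simp
  then show ?thesis using degree_ge_2_if_eventually_constant[OF n f _ hilbert_fun_hf] sing by blast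
qed

lemma milnor_dim_fs: "milnor_dim n fs k = enat (nat (coeff (geom_poly (d - 1) ^ Suc n) k))"
  using milnor_dim_eq[OF fs hilbert_fun_smooth[OF fs d_ge_2 smooth]] .

lemma hf_coincide:
  assumes "q' \<in> coincide_to" "k \<le> q'"
  shows "int (hf k) = coeff (geom_poly (d - 1) ^ Suc n) k"
proof -
  have "hf k = nat (coeff (geom_poly (d - 1) ^ Suc n) k)"
    using assms by (auto simp: coincide_to_def milnor_dim_f milnor_dim_fs)
  then show ?thesis using hf_pos[of k] by simp
qed

text \<open>
  At \<open>q\<close> and \<open>q + 1\<close> the Hilbert function of \<open>f\<close> is stable and agrees with the smooth one, so the latter has
  a plateau there.
\<close>

lemma overlap_position:
  assumes "q \<in> stable_from" "q' \<in> coincide_to" "q < q'"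
  shows "2 * q + 1 = Suc n * (d - 2)"
proof -
  have "hf (Suc q) = hf q" by (rule hf_stable[OF assms(1)]) simp
  moreover have "int (hf q) = coeff (geom_poly (d - 1) ^ Suc n) q"
    using assms(3) by (intro hf_coincide[OF assms(2)]) simp
  moreover have "int (hf (Suc q)) = coeff (geom_poly (d - 1) ^ Suc n) (Suc q)"
    using assms(3) by (intro hf_coincide[OF assms(2)]) simp
  ultimately have "coeff (geom_poly (d - 1) ^ Suc n) q = coeff (geom_poly (d - 1) ^ Suc n) (Suc q)"
    and "coeff (geom_poly (d - 1) ^ Suc n) q \<noteq> 0"
    using hf_pos[of q] by linarith+
  moreover have "d - 1 \<ge> 1" "Suc n \<ge> 2" using d_ge_2 n by auto
  ultimately have "2 * q + 1 = Suc n * (d - 1 - 1)"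
    by (intro coeff_geom_poly_power_plateau)
  then show ?thesis by (simp add: numeral_2_eq_2)
qed

text \<open>
  By \<open>overlap_position\<close> all members of \<open>stable_from\<close> below a member of \<open>coincide_to\<close> are equal.
  This pins down the minimum of the one set and the maximum of the other.
\<close>

lemma thresholds:
  obtains q where "2 * q + 1 = Suc n * (d - 2)" "q \<in> stable_from" "Suc q \<in> coincide_to"
    "stability_threshold n f = enat q" "coincidence_threshold n f fs = enat (Suc q)"
proof -
  obtain q q' where q: "q \<in> stable_from" "q' \<in> coincide_to" "q < q'" using overlap by blast
  have pos: "2 * q + 1 = Suc n * (d - 2)" by (rule overlap_position[OF q])
  have co: "Suc q \<in> coincide_to" using q by (auto simp: coincide_to_def)
  have "q \<le> p" if "p \<in> stable_from" for p
    using overlap_position[OF that q(2)] pos q(3) by (cases "p < q") auto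
  then have "Inf (enat ` stable_from) = enat q"
    using q(1) by (intro antisym Inf_lower Inf_greatest) auto
  moreover have "p \<le> Suc q" if "p \<in> coincide_to" for p
  proof (rule ccontr)
    assume "\<not> p \<le> Suc q"
    moreover have "Suc q \<in> stable_from" using q(1) by (auto simp: stable_from_def)
    ultimately have "2 * Suc q + 1 = Suc n * (d - 2)"
      using overlap_position[OF _ that, of "Suc q"] by simp
    then show False using pos by simp
  qed
  then have "Sup (enat ` coincide_to) = enat (Suc q)"
    using co by (intro antisym Sup_upper Sup_least) auto
  ultimately show ?thesis
    using that[OF pos q(1) co]
    by (simp add: stability_threshold_def coincidence_threshold_def stable_from_def coincide_to_def)
qed

end

section \<open>Greatest common divisors in three variables\<close>

text \<open>
  The set \<open>poly_ring n\<close> is \<open>polys_below (Suc n)\<close>; the shifted index includes the ring of constants, where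
  the construction by adjoining variables starts.
\<close>

definition polys_below :: "nat \<Rightarrow> mpoly set" where
  "polys_below r = {p. \<forall>m\<in>keys p. keys m \<subseteq> {..<r}}"

lemma poly_ring_eq_polys_below: "poly_ring n = polys_below (Suc n)"
  by (simp add: poly_ring_def polys_below_def lessThan_Suc_atMost)

lemma polys_below_add: "p \<in> polys_below r \<Longrightarrow> q \<in> polys_below r \<Longrightarrow> p + q \<in> polys_below r"
  using keys_add[of p q] by (auto simp: polys_below_def)

lemma polys_below_mult: "p \<in> polys_below r \<Longrightarrow> q \<in> polys_below r \<Longrightarrow> p * q \<in> polys_below r"
  using keys_mult[of p q] by (fastforce simp: polys_below_def keys_add_monom)

text \<open>
  If \<open>h\<close> is an isomorphism onto the ring in \<open>x\<^sub>0, \<dots>, x\<^bsub>r-1\<^esub>\<close>, the lift is one onto the ring with \<open>x\<^sub>r\<close> adjoined.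
\<close>

locale variable_lift = poly_lift h "Var r" for h :: "'a::comm_ring_1 \<Rightarrow> mpoly" and r +
  assumes h_inj: "h a = 0 \<Longrightarrow> a = 0" and h_range: "range h = polys_below r"
begin

lemma lift_eq_0: "lift p = 0 \<Longrightarrow> p = 0"
proof (induction p)
  case (pCons a p)
  have sum0: "h a + Var r * lift p = 0" using pCons.prems by (simp add: lift_pCons)
  have "Var r * (- lift p) \<in> ideal.span (Var ` {r})"
    by (rule ideal_mult_right[OF ideal.span_base]) simp
  also have "Var r * (- lift p) = h a" using sum0 by (simp add: add_eq_0_iff)
  finally have "\<forall>m\<in>keys (h a). keys m \<inter> {r} \<noteq> {}" unfolding span_Var by simp
  moreover have "\<forall>m\<in>keys (h a). keys m \<subseteq> {..<r}" using h_range by (auto simp: polys_below_def)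
  ultimately have "keys (h a) = {}" by fastforce
  then have "h a = 0" by simp
  then show ?case using sum0 pCons.IH h_inj by auto
qed simp

lemma lift_diff: "lift (p - q) = lift p - lift q"
  using lift_add[of "p - q" q] by simp

lemma lift_power: "lift (p ^ k) = lift p ^ k"
  by (induction k) (auto simp: lift_1 lift_mult)

lemma lift_range: "range lift = polys_below (Suc r)"
proof (intro equalityI subsetI)
  fix y assume "y \<in> range lift"
  then obtain p where "y = lift p" by auto
  have "lift p \<in> polys_below (Suc r)"
  proof (induction p)
    case (pCons a p)
    have "h a \<in> polys_below (Suc r)"
      using h_range by (fastforce simp: polys_below_def set_eq_iff image_iff)
    moreover have "Var r \<in> polys_below (Suc r)" by (simp add: polys_below_def Var_def)
    ultimately show ?case using pCons by (simp add: lift_pCons polys_below_add polys_below_mult)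
  qed (simp add: lift_0 polys_below_def)
  then show "y \<in> polys_below (Suc r)" using \<open>y = lift p\<close> by simp
next
  fix y assume y: "y \<in> polys_below (Suc r)"
  have "\<exists>p. single m (lookup y m) = lift p" if m: "m \<in> keys y" for m
  proof -
    define k where "k = lookup m r"
    define m' where "m' = m - single r k"
    have "m = m' + single r k"
      by (rule poly_mapping_eqI) (auto simp: m'_def k_def lookup_add lookup_minus lookup_single when_def)
    moreover have "single (single r k) 1 = Var r ^ k"
      by (simp add: single_eq_prod_Var[of "single r k" 1])
    ultimately have eq: "single m (lookup y m) = single m' (lookup y m) * Var r ^ k"
      by (simp add: mult_single flip: \<open>single (single r k) 1 = Var r ^ k\<close>)
    have "keys m' \<subseteq> {..<r}"
    proof
      fix j assume j: "j \<in> keys m'"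
      then have "j \<noteq> r" "j \<in> keys m"
        by (auto simp: m'_def k_def in_keys_iff lookup_minus lookup_single)
      then show "j \<in> {..<r}" using y m by (fastforce simp: polys_below_def less_Suc_eq)
    qed
    then have "single m' (lookup y m) \<in> polys_below r" by (simp add: polys_below_def)
    then obtain a where "single m' (lookup y m) = h a" using h_range by blast
    then have "single m (lookup y m) = lift ([:a:] * [:0, 1:] ^ k)"
      using eq by (simp only: lift_mult lift_power lift_pCons lift_0 h_0 h_1) simp
    then show ?thesis by blast
  qed
  then have "\<forall>m. \<exists>p. m \<in> keys y \<longrightarrow> single m (lookup y m) = lift p" by blast
  from choice[OF this] obtain g where g: "\<And>m. m \<in> keys y \<Longrightarrow> single m (lookup y m) = lift (g m)" by blast
  have "y = lift (\<Sum>m\<in>keys y. g m)"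
    using sum_monomials[of y] g by (simp add: lift_sum)
  then show "y \<in> range lift" by blast
qed

lemma lift_hom: "lift 0 = 0" "lift 1 = 1" "lift (p + q) = lift p + lift q" "lift (p * q) = lift p * lift q"
  by (rule lift_0 lift_1 lift_add lift_mult)+

end

lemma range_Const: "range Const = polys_below 0"
proof (intro equalityI subsetI)
  fix p assume p: "p \<in> polys_below 0"
  have "p = Const (lookup p 0)"
    using p by (intro form_0_eq_Const) (auto simp: polys_below_def forms_def)
  then show "p \<in> range Const" by blast
qed (auto simp: polys_below_def Const_def split: if_splits)

interpretation lift1: variable_lift Const 0
  by unfold_locales (simp_all add: range_Const)

interpretation lift2: variable_lift "const_lift.lift (Var 0)" "Suc 0"
  using lift1.lift_hom lift1.lift_eq_0 lift1.lift_range by unfold_locales auto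

interpretation lift3: variable_lift lift2.lift 2
  using lift2.lift_hom lift2.lift_eq_0 lift2.lift_range by unfold_locales (auto simp: numeral_2_eq_2)

lemma range_lift3: "range lift3.lift = poly_ring 2"
  using lift3.lift_range by (simp add: poly_ring_eq_polys_below)

text \<open>
  The ring in three variables is isomorphic to an iterated univariate polynomial ring, where greatest common
  divisors exist.  The last two conclusions are coprimality of the cofactors, in the form in which it is used.
\<close>

lemma coprime_cofactors:
  assumes ab: "a \<in> poly_ring 2" "b \<in> poly_ring 2" "a \<noteq> 0 \<or> b \<noteq> 0"
  obtains g a' b' where "a = g * a'" "b = g * b'" "g \<in> poly_ring 2" "a' \<in> poly_ring 2" "b' \<in> poly_ring 2"
    "\<And>x y. x \<in> poly_ring 2 \<Longrightarrow> y \<in> poly_ring 2 \<Longrightarrow> a' * x = b' * y \<Longrightarrow> \<exists>k\<in>poly_ring 2. x = b' * k"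
    "\<And>x y. x \<in> poly_ring 2 \<Longrightarrow> y \<in> poly_ring 2 \<Longrightarrow> a' * x = b' * y \<Longrightarrow> \<exists>k\<in>poly_ring 2. y = a' * k"
proof -
  let ?L = "lift3.lift"
  have R: "?L p \<in> poly_ring 2" for p using range_lift3 by blast
  have inj: "p = q" if "?L p = ?L q" for p q
    using lift3.lift_eq_0[of "p - q"] that by (simp add: lift3.lift_diff)
  obtain A B where AB: "a = ?L A" "b = ?L B" using ab range_lift3 by blast
  then have "A \<noteq> 0 \<or> B \<noteq> 0" using ab(3) lift3.lift_0 by auto
  then have "gcd A B \<noteq> 0" by simp
  then obtain A' B' where A'B': "A = A' * gcd A B" "B = B' * gcd A B" "coprime A' B'"
    by (metis gcd_coprime_exists)
  have cop: "\<exists>K. X = B' * K" "\<exists>K. Y = A' * K" if "A' * X = B' * Y" for X Y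
  proof -
    have "B' dvd A' * X" using that by simp
    then have "B' dvd X" using A'B'(3) by (simp add: coprime_commute coprime_dvd_mult_right_iff)
    then show "\<exists>K. X = B' * K" by (auto simp: dvd_def)
    have "A' dvd B' * Y" using that[symmetric] by simp
    then have "A' dvd Y" using A'B'(3) by (simp add: coprime_dvd_mult_right_iff)
    then show "\<exists>K. Y = A' * K" by (auto simp: dvd_def)
  qed
  show ?thesis
  proof (rule that[of "?L (gcd A B)" "?L A'" "?L B'"])
    show "a = ?L (gcd A B) * ?L A'"
      unfolding AB(1) lift3.lift_mult[symmetric] by (subst A'B'(1)) (simp only: mult.commute)
    show "b = ?L (gcd A B) * ?L B'"
      unfolding AB(2) lift3.lift_mult[symmetric] by (subst A'B'(2)) (simp only: mult.commute)
    fix x y assume xy: "x \<in> poly_ring 2" "y \<in> poly_ring 2" "?L A' * x = ?L B' * y"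
    obtain X Y where XY: "x = ?L X" "y = ?L Y" using xy(1,2) range_lift3 by blast
    have "A' * X = B' * Y" using xy(3) by (intro inj) (simp add: XY lift3.lift_mult)
    from cop[OF this] show "\<exists>k\<in>poly_ring 2. x = ?L B' * k" "\<exists>k\<in>poly_ring 2. y = ?L A' * k"
      using R by (auto simp: XY lift3.lift_mult)
  qed (rule R)+
qed

section \<open>Syzygies of a plane curve\<close>

lemma two_card_monoms_3: "2 * card (monoms 3 k) = (k + 1) * (k + 2)"
proof -
  have "card (monoms 3 k) = (k + 2) choose k" using card_monoms[of 3 k] by simp
  also have "\<dots> = (k + 2) choose 2" using binomial_symmetric[of k "k + 2"] by simp
  finally show ?thesis by (simp add: choose_two)
qed

text \<open>
  The polynomial equals \<open>(1 - t\<^sup>e)\<^sup>3\<close> times the Hilbert series of the ring in three variables, and for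
  \<open>e \<le> k < 2e\<close> only the first two terms of the cube contribute.
\<close>

lemma geom_poly_cube_coeff:
  assumes "e \<le> k" "k < 2 * e"
  shows "coeff (geom_poly e ^ 3) k = int (card (monoms 3 k)) - 3 * int (card (monoms 3 (k - e)))"
proof -
  let ?X = "fps_X :: int fps" and ?h = "hseries (\<lambda>k. card (monoms 3 k))"
  have "fps_of_poly (geom_poly e ^ 3) = (\<Sum>i<e. ?X ^ i) ^ 3 * ((1 - ?X) ^ 3 * ?h)"
    by (simp add: hseries_vars_from fps_of_geom_poly)
  also have "\<dots> = (1 - ?X ^ e) ^ 3 * ?h"
    by (simp add: power_mult_distrib mult_ac flip: one_minus_X_power)
  also have "\<dots> = ?h - 3 * (?X ^ e * ?h) + ?X ^ (2 * e) * ((3 - ?X ^ e) * ?h)"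
  proof -
    have "(1 - y) ^ 3 * h = h - 3 * (y * h) + y ^ 2 * ((3 - y) * h)" for y h :: "int fps"
      by algebra
    then show ?thesis by (simp only: power_mult[symmetric] mult.commute[of 2 e])
  qed
  finally have "coeff (geom_poly e ^ 3) k =
      fps_nth (?h - 3 * (?X ^ e * ?h) + ?X ^ (2 * e) * ((3 - ?X ^ e) * ?h)) k"
    by (metis fps_of_poly_nth)
  then show ?thesis
    using assms by (simp add: fps_X_power_mult_nth hseries_def numeral_fps_const)
qed

text \<open>
  The product of the highest components of \<open>p\<close> and \<open>q\<close> is a nonzero component of \<open>p * q\<close>, so their degrees add
  up to \<open>m\<close>; but \<open>q\<close> already has degree at least \<open>m\<close>.
\<close>

lemma left_factor_const:
  assumes pq: "p * q \<in> forms m" "p \<noteq> 0" "q \<noteq> 0" and low: "\<And>t. t < m \<Longrightarrow> hcomp t q = 0"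
  shows "p \<in> forms 0"
proof -
  define a where "a = Max (mdeg ` keys p)"
  define b where "b = Max (mdeg ` keys q)"
  have fin: "finite (mdeg ` keys p)" "mdeg ` keys p \<noteq> {}" "finite (mdeg ` keys q)" "mdeg ` keys q \<noteq> {}"
    using pq by auto
  have top: "hcomp t r \<noteq> 0" if t: "t \<in> mdeg ` keys r" for t r
  proof -
    obtain x where "x \<in> keys r" "t = mdeg x" using t by auto
    then have "lookup (hcomp t r) x \<noteq> 0" by (simp add: lookup_hcomp in_keys_iff)
    then show ?thesis by auto
  qed
  have above: "hcomp t q = 0" if "t > b" for t
  proof (rule poly_mapping_eqI)
    fix m
    have "mdeg m \<noteq> t" if "m \<in> keys q"
      using \<open>t > b\<close> Max_ge[OF fin(3) imageI[OF that]] by (auto simp: b_def)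
    then show "lookup (hcomp t q) m = lookup 0 m"
      by (cases "m \<in> keys q") (auto simp: lookup_hcomp when_def in_keys_iff)
  qed
  have ab: "hcomp a p \<noteq> 0" "hcomp b q \<noteq> 0"
    using fin Max_in by (auto intro!: top simp: a_def b_def)
  then have bm: "m \<le> b" using low by (metis not_le)
  have "hcomp (a + b) (p * q) = hcomp (a + b) ((\<Sum>i\<in>mdeg ` keys p. hcomp i p) * q)"
    by (simp only: sum_hcomp)
  also have "\<dots> = (\<Sum>i\<in>mdeg ` keys p. hcomp (a + b) (hcomp i p * q))"
    by (simp only: sum_distrib_right hcomp_sum)
  also have "\<dots> = (\<Sum>i\<in>mdeg ` keys p. if i = a then hcomp a p * hcomp b q else 0)"
  proof (rule sum.cong)
    fix i assume "i \<in> mdeg ` keys p"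
    then have "i \<le> a" using fin by (simp add: a_def)
    then show "hcomp (a + b) (hcomp i p * q) = (if i = a then hcomp a p * hcomp b q else 0)"
      using above[of "a + b - i"] by (auto simp: hcomp_mult[OF hcomp_in_forms])
  qed simp
  also have "\<dots> = hcomp a p * hcomp b q" using fin Max_in[OF fin(1,2)] by (simp add: a_def)
  finally have "hcomp (a + b) (p * q) \<noteq> 0" using ab by simp
  then have "a + b = m" using hcomp_form[OF pq(1)] by metis
  then have "a = 0" using bm by simp
  then show "p \<in> forms 0" using Max_ge[OF fin(1)] by (fastforce simp: a_def forms_def)
qed

abbreviation (input) vec_scale :: "complex \<Rightarrow> (nat \<Rightarrow> mpoly) \<Rightarrow> nat \<Rightarrow> mpoly" where
  "vec_scale \<equiv> \<lambda>c v j. Const c * v j"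

interpretation vec: complex_space vec_scale
  by unfold_locales (simp_all add: fun_eq_iff distrib_left distrib_right mult.assoc Const_add Const_mult)

text \<open>
  Vectors of \<open>r\<close> forms, padded with zeros so that addition and zero are those of functions.
  Syzygies have \<open>r = 3\<close>, pairs of coefficients have \<open>r = 2\<close>.
\<close>

definition form_vecs :: "nat \<Rightarrow> nat \<Rightarrow> (nat \<Rightarrow> mpoly) set" where
  "form_vecs r k = {v. (\<forall>j<r. v j \<in> homog 2 k) \<and> (\<forall>j\<ge>r. v j = 0)}"

lemma homog_add: "p \<in> homog n k \<Longrightarrow> q \<in> homog n k \<Longrightarrow> p + q \<in> homog n k"
  using lin.subspace_add[OF homog_lin_subspace] .

lemma homog_scale: "p \<in> homog n k \<Longrightarrow> Const c * p \<in> homog n k"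
  using lin.subspace_scale[OF homog_lin_subspace] .

lemma homog_0 [simp]: "0 \<in> homog n k"
  using lin.subspace_0[OF homog_lin_subspace] .

lemma homog_mult: "p \<in> homog n a \<Longrightarrow> q \<in> homog n b \<Longrightarrow> p * q \<in> homog n (a + b)"
  by (simp add: homog_eq forms_mult poly_ring_mult)

lemma form_vecs_subspace: "vec.subspace (form_vecs r k)"
  by (auto simp: vec.subspace_def form_vecs_def homog_add homog_scale)

lemma vec_subspace_0: "vec.subspace {0}"
  by (rule vec.subspace_single_0)

lemma has_qdim_homog_2: "has_qdim poly_scale (homog 2 k) {0} (card (monoms 3 k))"
proof -
  have "has_qdim poly_scale (homog 2 k) (homog 2 k \<inter> ideal.span (vars_from 3)) (card (monoms 3 k))"
    using hilbert_fun_vars_from[of 3] by (intro has_qdim_homog) (auto simp: hilbert_fun_def numeral_3_eq_3)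
  moreover have "homog 2 k \<inter> ideal.span (vars_from 3) = {0}"
    using poly_ring_Int_vars[of _ 2] by (auto simp: homog_eq ideal.span_zero numeral_3_eq_3)
  ultimately show ?thesis by simp
qed

lemma has_qdim_form_vecs:
  "has_qdim vec_scale (form_vecs r k) {0} (r * card (monoms 3 k))"
proof (induction r)
  case 0
  have "form_vecs 0 k = {0}" by (auto simp: form_vecs_def fun_eq_iff)
  then show ?case using vec.has_qdim_0_iff[of "form_vecs 0 k" "{0}"]
    by (simp only: mult_zero_left subset_refl simp_thms)
next
  case (Suc r)
  have "has_qdim vec_scale (form_vecs (Suc r) k) (form_vecs r k)
      (card (monoms 3 k))"
  proof (rule has_qdim_transfer[OF lin.complex_space_axioms vec.complex_space_axioms
        form_vecs_subspace _ _ homog_lin_subspace _ _ _ has_qdim_homog_2,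
        where \<phi> = "\<lambda>p j. if j = r then p else 0"])
    show "(\<lambda>j. if j = r then v else 0) \<in> form_vecs (Suc r) k" if "v \<in> homog 2 k" for v
      using that by (auto simp: form_vecs_def)
    show "\<exists>v\<in>homog 2 k. w - (\<lambda>j. if j = r then v else 0) \<in> form_vecs r k"
      if "w \<in> form_vecs (Suc r) k" for w
      using that by (intro bexI[of _ "w r"]) (auto simp: form_vecs_def)
    show "(\<lambda>j. if j = r then v else 0) \<in> form_vecs r k \<longleftrightarrow> v \<in> {0}" if "v \<in> homog 2 k" for v
      by (auto simp: form_vecs_def)
  qed (auto simp: fun_eq_iff)
  moreover have "form_vecs r k \<subseteq> form_vecs (Suc r) k"
    by (auto simp: form_vecs_def less_Suc_eq)
  moreover have "{0} \<subseteq> form_vecs r k" by (auto simp: form_vecs_def)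
  ultimately have "has_qdim vec_scale (form_vecs (Suc r) k) {0}
      (r * card (monoms 3 k) + card (monoms 3 k))"
    by (intro vec.has_qdim_add[OF form_vecs_subspace form_vecs_subspace vec_subspace_0 _ _ Suc.IH])
  then show ?case by (simp only: mult_Suc add.commute)
qed

locale plane_threshold_gap = threshold_gap 2 d f fs for d f fs
begin

text \<open>
  The degree is odd, \<open>d = 2 * m + 1\<close>, and \<open>m\<close> turns out to be the least degree of a syzygy.
\<close>

definition m :: nat where "m = (d - 1) div 2"

text \<open>
  The plateau of the smooth Hilbert function is at \<open>3m - 2, 3m - 1\<close>, and its value is
  \<open>dim S\<^bsub>3m-1\<^esub> - 3 dim S\<^bsub>m-1\<^esub> = 3m\<^sup>2\<close>.
\<close>

lemma plateau_facts: "m \<ge> 1" "d = 2 * m + 1" "hf (3 * m - 1) = 3 * m ^ 2" "\<And>k. k \<ge> 3 * m - 2 \<Longrightarrow> hf k = 3 * m ^ 2"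
proof -
  obtain q where q: "2 * q + 1 = Suc 2 * (d - 2)" "q \<in> stable_from" "Suc q \<in> coincide_to"
    using thresholds by metis
  have q3: "2 * q + 1 = 3 * (d - 2)" using q(1) by simp
  have "odd (2 * q + 1)" by simp
  then have od: "odd (d - 2)" unfolding q3 by simp
  then have "d - 2 \<noteq> 0" by (metis even_zero)
  then have "d \<ge> 3" by linarith
  then have "odd d" using od by simp
  then have d: "d = 2 * m + 1" by (simp add: m_def)
  then have m1: "m \<ge> 1" using \<open>d \<ge> 3\<close> by simp
  then have qm: "Suc q = 3 * m - 1" "q = 3 * m - 2" using q3 d by simp_all
  have "int (hf (3 * m - 1)) = coeff (geom_poly (2 * m) ^ 3) (3 * m - 1)"
  proof -
    have "d - 1 = 2 * m" using d by simp
    moreover have "Suc 2 = 3" by simp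
    ultimately show ?thesis using hf_coincide[OF q(3) order_refl] by (simp only: qm(1))
  qed
  also have "\<dots> = int (card (monoms 3 (3 * m - 1))) - 3 * int (card (monoms 3 (m - 1)))"
  proof -
    have "3 * m - 1 - 2 * m = m - 1" by simp
    then show ?thesis using geom_poly_cube_coeff[of "2 * m" "3 * m - 1"] m1 by simp
  qed
  finally have "2 * int (hf (3 * m - 1)) =
      int (2 * card (monoms 3 (3 * m - 1))) - 3 * int (2 * card (monoms 3 (m - 1)))" by simp
  also have "\<dots> = 2 * int (3 * m ^ 2)"
  proof -
    obtain r where "m = Suc r" using m1 by (cases m) auto
    then show ?thesis unfolding two_card_monoms_3 by (simp add: power2_eq_square algebra_simps)
  qed
  finally have h: "hf (3 * m - 1) = 3 * m ^ 2" by linarith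
  show "m \<ge> 1" "d = 2 * m + 1" "hf (3 * m - 1) = 3 * m ^ 2" by fact+
  show "hf k = 3 * m ^ 2" if "k \<ge> 3 * m - 2" for k
    using hf_stable[OF q(2), of k] hf_stable[OF q(2), of "3 * m - 1"] h that qm by simp
qed

abbreviation D :: "nat \<Rightarrow> mpoly" where "D j \<equiv> pderiv_wrt j f"

text \<open>
  The value of a vector under the map \<open>S\<^sup>3 \<rightarrow> J\<^sub>f\<close> given by the partial derivatives.
\<close>

definition dot :: "(nat \<Rightarrow> mpoly) \<Rightarrow> mpoly" where
  "dot v = (\<Sum>j\<le>2. v j * D j)"

lemma dot_add: "dot (v + w) = dot v + dot w"
  by (simp add: dot_def distrib_right sum.distrib)

lemma dot_scale: "dot (\<lambda>j. a * v j) = a * dot v"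
  by (simp add: dot_def sum_distrib_left mult.assoc)

lemma dot_add': "dot (\<lambda>j. v j + w j) = dot v + dot w"
  by (simp add: dot_def distrib_right sum.distrib)

lemma dot_diff': "dot (\<lambda>j. v j - w j) = dot v - dot w"
  by (simp add: dot_def left_diff_distrib sum_subtractf)

lemma D_homog: "D j \<in> homog 2 (2 * m)"
proof -
  have "d - 1 = 2 * m" using plateau_facts(2) by simp
  then show ?thesis using pderiv_wrt_homog[OF f, of j] by (simp only:)
qed

lemma D_forms: "D j \<in> forms (2 * m)"
  using D_homog by (simp add: homog_eq)

lemma jacobian_ideal_iff: "p \<in> jacobian_ideal 2 f \<longleftrightarrow> (\<exists>v. (\<forall>j\<le>2. v j \<in> poly_ring 2) \<and> p = dot v)"
  by (auto simp: jacobian_ideal_def dot_def)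

lemma hcomp_dot: "hcomp (k + 2 * m) (dot v) = dot (\<lambda>j. hcomp k (v j))"
  unfolding dot_def hcomp_sum
proof (rule sum.cong)
  fix j show "hcomp (k + 2 * m) (v j * D j) = hcomp k (v j) * D j"
    using hcomp_mult[OF D_forms, of "k + 2 * m" j "v j"] by (simp add: mult.commute)
qed simp

definition syz :: "nat \<Rightarrow> (nat \<Rightarrow> mpoly) set" where
  "syz k = {v \<in> form_vecs 3 k. dot v = 0}"

lemma syz_subspace: "vec.subspace (syz k)"
proof -
  have "vec.subspace {v. dot v = 0}"
  proof (rule vec.subspaceI)
    show "0 \<in> {v. dot v = 0}" by (simp add: dot_def)
    show "v + w \<in> {v. dot v = 0}" if "v \<in> {v. dot v = 0}" "w \<in> {v. dot v = 0}" for v w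
      using that by (simp add: dot_add)
    show "(\<lambda>j. Const c * v j) \<in> {v. dot v = 0}" if "v \<in> {v. dot v = 0}" for c v
      using that dot_scale[of "Const c" v] by simp
  qed
  then have "vec.subspace (form_vecs 3 k \<inter> {v. dot v = 0})"
    by (intro vec.subspace_inter form_vecs_subspace)
  moreover have "syz k = form_vecs 3 k \<inter> {v. dot v = 0}" by (auto simp: syz_def)
  ultimately show ?thesis by simp
qed

text \<open>
  Rank and nullity for the map from vectors of forms of degree \<open>k\<close> onto the part of degree \<open>k + 2m\<close> of the
  Jacobian ideal, whose codimension is the value of the Hilbert function.
\<close>

lemma syz_dim:
  obtains s where "has_qdim vec_scale (syz k) {0} s"
    "s + card (monoms 3 (k + 2 * m)) = 3 * card (monoms 3 k) + hf (k + 2 * m)"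
proof -
  let ?sc = poly_scale and ?vc = vec_scale
  let ?J = "homog 2 (k + 2 * m) \<inter> ideal.span (jac_gens 2 f)"
  have Jsub: "lin.subspace ?J" by (intro lin.subspace_inter homog_lin_subspace) simp
  have "has_qdim ?sc (homog 2 (k + 2 * m)) ?J (hf (k + 2 * m))"
    using hilbert_fun_hf by (intro has_qdim_homog) (auto simp: hilbert_fun_def jac_gens_def)
  then obtain u where u: "has_qdim ?sc ?J {0} u" "card (monoms 3 (k + 2 * m)) = u + hf (k + 2 * m)"
    using lin.has_qdim_split[OF homog_lin_subspace Jsub lin.subspace_single_0 _ Int_lower1 has_qdim_homog_2]
      lin.has_qdim_unique[OF Jsub] lin.subspace_0[OF Jsub] by (metis empty_subsetI insert_subset)
  obtain s t where st: "has_qdim ?vc (syz k) {0} s" "has_qdim ?vc (form_vecs 3 k) (syz k) t"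
    "3 * card (monoms 3 k) = s + t"
    by (rule vec.has_qdim_split[OF form_vecs_subspace syz_subspace vec_subspace_0 _ _ has_qdim_form_vecs])
      (use vec.subspace_0[OF syz_subspace] in \<open>auto simp: syz_def\<close>)
  have "has_qdim ?sc ?J {0} t"
  proof (rule has_qdim_transfer[OF vec.complex_space_axioms lin.complex_space_axioms
        lin.subspace_single_0 dot_add dot_scale form_vecs_subspace _ _ _ st(2)])
    show "dot v \<in> ?J" if v: "v \<in> form_vecs 3 k" for v
    proof -
      have "v j * D j \<in> homog 2 (k + 2 * m)" if "j \<le> 2" for j
        using v that by (intro homog_mult D_homog) (auto simp: form_vecs_def)
      then have "dot v \<in> homog 2 (k + 2 * m)"
        unfolding dot_def by (intro lin.subspace_sum[OF homog_lin_subspace]) auto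
      moreover have "dot v \<in> jacobian_ideal 2 f"
        using v by (auto simp: jacobian_ideal_iff form_vecs_def homog_eq intro!: exI[of _ v])
      ultimately show ?thesis using jacobian_ideal_eq[OF f] by simp
    qed
    show "\<exists>v\<in>form_vecs 3 k. w - dot v \<in> {0}" if w: "w \<in> ?J" for w
    proof -
      have "w \<in> jacobian_ideal 2 f" using w jacobian_ideal_eq[OF f] by (simp add: homog_eq)
      then obtain v where v: "\<forall>j\<le>2. v j \<in> poly_ring 2" "w = dot v" by (auto simp: jacobian_ideal_iff)
      define v' where "v' j = (if j \<le> 2 then hcomp k (v j) else 0)" for j
      have "w \<in> forms (k + 2 * m)" using w by (simp add: homog_eq)
      then have "w = hcomp (k + 2 * m) (dot v)"
        unfolding v(2)[symmetric] by (simp add: hcomp_form)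
      also have "\<dots> = dot v'" by (simp add: hcomp_dot) (simp add: dot_def v'_def)
      finally have "w = dot v'" .
      moreover have "v' \<in> form_vecs 3 k"
        using v(1) by (auto simp: form_vecs_def v'_def homog_eq poly_ring_hcomp hcomp_in_forms)
      ultimately show ?thesis by (intro bexI[of _ v']) auto
    qed
  qed (auto simp: syz_def)
  then have "t = u" using lin.has_qdim_unique[OF lin.subspace_single_0 u(1)] by simp
  then show ?thesis using that[OF st(1)] st(3) u(2) by simp
qed

lemma syz_dim_above: "has_qdim vec_scale (syz (m + i)) {0} (2 * card (monoms 3 i))"
proof -
  obtain s where s: "has_qdim vec_scale (syz (m + i)) {0} s"
    "s + card (monoms 3 (m + i + 2 * m)) = 3 * card (monoms 3 (m + i)) + hf (m + i + 2 * m)"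
    by (rule syz_dim)
  have "hf (m + i + 2 * m) = 3 * m ^ 2" by (rule plateau_facts) simp
  then have "2 * s + 2 * card (monoms 3 (m + i + 2 * m)) = 3 * (2 * card (monoms 3 (m + i))) + 6 * m ^ 2"
    using s(2) by simp
  then have "2 * s = 2 * (2 * card (monoms 3 i))"
    unfolding two_card_monoms_3 by (simp add: power2_eq_square algebra_simps)
  then show ?thesis using s(1) by simp
qed

text \<open>
  In degree \<open>m - 1\<close> the dimension is 0; multiplication by a power of \<open>x\<^sub>0\<close> carries smaller degrees there.
\<close>

lemma syz_below_trivial:
  assumes "k < m" "v \<in> syz k"
  shows "v = 0"
proof -
  obtain s where s: "has_qdim vec_scale (syz (m - 1)) {0} s"
    "s + card (monoms 3 (m - 1 + 2 * m)) = 3 * card (monoms 3 (m - 1)) + hf (m - 1 + 2 * m)"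
    by (rule syz_dim)
  obtain r where r: "m = Suc r" using plateau_facts(1) by (cases m) auto
  have "hf (m - 1 + 2 * m) = 3 * m ^ 2" by (rule plateau_facts) simp
  then have "2 * s + 2 * card (monoms 3 (m - 1 + 2 * m)) = 3 * (2 * card (monoms 3 (m - 1))) + 6 * m ^ 2"
    using s(2) by simp
  then have "s = 0"
    unfolding two_card_monoms_3 by (simp add: power2_eq_square algebra_simps r)
  then have zero: "syz (m - 1) \<subseteq> {0}" using s(1) vec.has_qdim_0_iff by simp
  define w where "w = (\<lambda>j. Var 0 ^ (m - 1 - k) * v j)"
  have "Var 0 ^ (m - 1 - k) \<in> homog 2 (m - 1 - k)"
    using forms_power[OF forms_Var, of 0 "m - 1 - k"] poly_ring_power[OF poly_ring_Var, of 0 2]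
    by (simp add: homog_eq)
  then have "w \<in> form_vecs 3 (m - 1)"
    using assms homog_mult[of _ 2 "m - 1 - k" _ k] by (auto simp: form_vecs_def w_def syz_def)
  moreover have "dot w = 0" using assms(2) by (simp add: w_def dot_scale syz_def)
  ultimately have "w = 0" using zero by (auto simp: syz_def)
  then show "v = 0" by (auto simp: w_def fun_eq_iff)
qed

lemma syz_basis:
  obtains \<rho> \<sigma> where "\<rho> \<in> syz m" "\<sigma> \<in> syz m"
    "\<And>\<alpha> \<beta>. (\<lambda>j. Const \<alpha> * \<rho> j + Const \<beta> * \<sigma> j) = (\<lambda>_. 0) \<Longrightarrow> \<alpha> = 0 \<and> \<beta> = 0"
proof -
  have "has_qdim vec_scale (syz m) {0} 2"
  proof -
    have "2 * card (monoms 3 0) = 2" using two_card_monoms_3[of 0] by simp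
    then show ?thesis using syz_dim_above[of 0] by (simp only: add_0_right)
  qed
  then obtain B where B: "quot_basis vec_scale (syz m) {0} B" "card B = 2"
    by (auto simp: has_qdim_def)
  obtain \<rho> \<sigma> where rs: "B = {\<rho>, \<sigma>}" "\<rho> \<noteq> \<sigma>" using B(2) by (auto simp: card_2_iff)
  show ?thesis
  proof (rule that)
    show "\<rho> \<in> syz m" "\<sigma> \<in> syz m" using B(1) rs by (auto simp: quot_basis_def)
    fix \<alpha> \<beta> assume eq: "(\<lambda>j. Const \<alpha> * \<rho> j + Const \<beta> * \<sigma> j) = (\<lambda>_. 0)"
    define c where "c v = (if v = \<rho> then \<alpha> else \<beta>)" for v
    have "(\<Sum>b\<in>B. (\<lambda>j. Const (c b) * b j)) = (\<lambda>j. Const \<alpha> * \<rho> j + Const \<beta> * \<sigma> j)"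
      using rs by (simp add: c_def plus_fun_def)
    then have "(\<Sum>b\<in>B. (\<lambda>j. Const (c b) * b j)) \<in> {0}" unfolding eq by (simp add: zero_fun_def)
    then have c0: "c b = 0" if "b \<in> B" for b by (rule quot_basis_indep[OF B(1) _ that])
    have "c \<rho> = 0" "c \<sigma> = 0" using rs by (auto intro: c0)
    then show "\<alpha> = 0 \<and> \<beta> = 0" using rs(2) by (simp add: c_def)
  qed
qed

text \<open>
  Dividing a syzygy by \<open>b\<close> leaves a syzygy, which has no component of degree less than \<open>m\<close>; so the
  division does not lower the degree.
\<close>

lemma syz_of_quotient:
  assumes b: "b \<in> poly_ring 2" "b \<noteq> 0" and v: "v \<in> syz m" "v \<noteq> 0"
    and k: "\<And>j. j \<le> 2 \<Longrightarrow> k j \<in> poly_ring 2 \<and> v j = b * k j"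
  shows "b \<in> forms 0"
proof -
  define w where "w = (\<lambda>j. if j \<le> 2 then k j else 0)"
  have vw: "v j = b * w j" for j
    using k v by (auto simp: w_def syz_def form_vecs_def)
  have "v = (\<lambda>j. b * w j)" by (rule ext) (rule vw)
  then have "b * dot w = dot v" by (simp only: dot_scale)
  then have "dot w = 0" using b v(1) by (simp add: syz_def)
  have low: "hcomp t (w j) = 0" if "t < m" for t j
  proof -
    have "dot (\<lambda>j. hcomp t (w j)) = 0" using hcomp_dot[of t w] \<open>dot w = 0\<close> by simp
    moreover have "(\<lambda>j. hcomp t (w j)) \<in> form_vecs 3 t"
      using k by (auto simp: form_vecs_def w_def homog_eq hcomp_in_forms poly_ring_hcomp)
    ultimately have "(\<lambda>j. hcomp t (w j)) = 0" by (intro syz_below_trivial[OF that]) (simp add: syz_def)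
    then show ?thesis by (simp add: fun_eq_iff)
  qed
  obtain j where j: "v j \<noteq> 0" using v(2) by (auto simp: fun_eq_iff)
  then have "j \<le> 2" using v(1) by (cases "3 \<le> j") (auto simp: syz_def form_vecs_def)
  then have "v j \<in> homog 2 m" using v(1) by (simp add: syz_def form_vecs_def)
  then have "b * w j \<in> forms m" unfolding vw[symmetric] by (simp add: homog_eq)
  then show ?thesis using left_factor_const[of b "w j" m] b low j vw by auto
qed

text \<open>
  After division by their greatest common divisor, the coefficients of a relation divide \<open>\<sigma>\<close> and \<open>\<rho>\<close>
  respectively.  By \<open>syz_of_quotient\<close> they are constants, which contradicts linear independence.
\<close>

lemma syz_independent:
  assumes rs: "\<rho> \<in> syz m" "\<sigma> \<in> syz m"
    and indep: "\<And>\<alpha> \<beta>. (\<lambda>j. Const \<alpha> * \<rho> j + Const \<beta> * \<sigma> j) = (\<lambda>_. 0) \<Longrightarrow> \<alpha> = 0 \<and> \<beta> = 0"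
    and ab: "a \<in> poly_ring 2" "b \<in> poly_ring 2" "\<And>j. j \<le> 2 \<Longrightarrow> a * \<rho> j + b * \<sigma> j = 0"
  shows "a = 0 \<and> b = 0"
proof (rule ccontr)
  assume "\<not> (a = 0 \<and> b = 0)"
  then have nz: "a \<noteq> 0 \<or> b \<noteq> 0" by simp
  obtain g a' b' where g: "a = g * a'" "b = g * b'" "g \<in> poly_ring 2" "a' \<in> poly_ring 2" "b' \<in> poly_ring 2"
    and cop: "\<And>x y. x \<in> poly_ring 2 \<Longrightarrow> y \<in> poly_ring 2 \<Longrightarrow> a' * x = b' * y \<Longrightarrow> \<exists>k\<in>poly_ring 2. x = b' * k"
      "\<And>x y. x \<in> poly_ring 2 \<Longrightarrow> y \<in> poly_ring 2 \<Longrightarrow> a' * x = b' * y \<Longrightarrow> \<exists>k\<in>poly_ring 2. y = a' * k"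
    by (rule coprime_cofactors[OF ab(1,2) nz]) blast
  have g0: "g \<noteq> 0" using nz g by auto
  have R: "\<rho> j \<in> poly_ring 2" "\<sigma> j \<in> poly_ring 2" for j
    using rs by (cases "j < 3"; auto simp: syz_def form_vecs_def homog_eq)+
  have out: "\<rho> j = 0" "\<sigma> j = 0" if "\<not> j \<le> 2" for j
    using rs that by (auto simp: syz_def form_vecs_def)
  have rel: "a' * \<rho> j + b' * \<sigma> j = 0" for j
  proof (cases "j \<le> 2")
    case True
    have "g * (a' * \<rho> j + b' * \<sigma> j) = 0" using ab(3)[OF True] by (simp add: g(1,2) algebra_simps)
    then show ?thesis using g0 by simp
  qed (simp add: out)
  then have rel': "a' * \<rho> j = b' * (- \<sigma> j)" for j by (simp add: add_eq_0_iff2)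
  have nzv: "\<rho> \<noteq> 0" "\<sigma> \<noteq> 0"
    using indep[of 1 0] indep[of 0 1] by (auto simp: zero_fun_def)
  have "a' \<noteq> 0 \<or> b' \<noteq> 0" using nz g by auto
  then have nz': "a' \<noteq> 0" "b' \<noteq> 0" using rel nzv by (auto simp: fun_eq_iff)
  have "\<exists>k\<in>poly_ring 2. \<rho> j = b' * k" for j
    using cop(1)[OF R(1) poly_ring_minus[OF R(2)] rel'] .
  then obtain k where k: "\<And>j. k j \<in> poly_ring 2 \<and> \<rho> j = b' * k j" by metis
  have "\<exists>k\<in>poly_ring 2. \<sigma> j = a' * k" for j
  proof -
    obtain k where "k \<in> poly_ring 2" "- \<sigma> j = a' * k"
      using cop(2)[OF R(1) poly_ring_minus[OF R(2)] rel'] by blast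
    then have "\<sigma> j = a' * (- k)" by (metis minus_minus mult_minus_right)
    then show ?thesis using poly_ring_minus[OF \<open>k \<in> poly_ring 2\<close>] by blast
  qed
  then obtain l where l: "\<And>j. l j \<in> poly_ring 2 \<and> \<sigma> j = a' * l j" by metis
  have "b' \<in> forms 0" using syz_of_quotient[OF g(5) nz'(2) rs(1) nzv(1)] k by blast
  moreover have "a' \<in> forms 0" using syz_of_quotient[OF g(4) nz'(1) rs(2) nzv(2)] l by blast
  ultimately obtain \<alpha> \<beta> where "a' = Const \<alpha>" "b' = Const \<beta>" using form_0_eq_Const by blast
  then show False using indep[of \<alpha> \<beta>] rel nz' by auto
qed

text \<open>
  The combinations of \<open>\<rho>\<close> and \<open>\<sigma>\<close> with coefficients of degree \<open>i\<close> form a space of the same dimension as the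
  syzygies of degree \<open>m + i\<close> that contain it.
\<close>

lemma syz_generated:
  assumes rs: "\<rho> \<in> syz m" "\<sigma> \<in> syz m"
    and indep: "\<And>a b. a \<in> poly_ring 2 \<Longrightarrow> b \<in> poly_ring 2 \<Longrightarrow>
       (\<And>j. j \<le> 2 \<Longrightarrow> a * \<rho> j + b * \<sigma> j = 0) \<Longrightarrow> a = 0 \<and> b = 0"
    and v: "v \<in> syz k"
  shows "\<exists>a\<in>poly_ring 2. \<exists>b\<in>poly_ring 2. v = (\<lambda>j. a * \<rho> j + b * \<sigma> j)"
proof (cases "k < m")
  case True
  then have "v = 0" using syz_below_trivial v by blast
  then show ?thesis by (intro bexI[of _ 0]) (auto simp: fun_eq_iff)
next
  case False
  define i where "i = k - m"
  have k: "k = m + i" using False by (simp add: i_def)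
  define \<phi> where "\<phi> w = (\<lambda>j. w 0 * \<rho> j + w 1 * \<sigma> j)" for w :: "nat \<Rightarrow> mpoly"
  let ?vc = vec_scale
  have in_syz: "\<phi> w \<in> syz k" if w: "w \<in> form_vecs 2 i" for w
  proof -
    have w01: "w 0 \<in> homog 2 i" "w 1 \<in> homog 2 i" using w by (auto simp: form_vecs_def)
    have "dot (\<phi> w) = 0" using rs by (simp add: \<phi>_def dot_add' dot_scale syz_def)
    moreover have "\<phi> w j \<in> homog 2 k" if "j < 3" for j
      using that rs homog_mult[OF w01(1), of "\<rho> j" m] homog_mult[OF w01(2), of "\<sigma> j" m]
      by (auto simp: \<phi>_def k add.commute[of m] syz_def form_vecs_def intro!: homog_add)
    moreover have "\<phi> w j = 0" if "j \<ge> 3" for j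
      using that rs by (simp add: \<phi>_def syz_def form_vecs_def)
    ultimately show ?thesis by (simp add: syz_def form_vecs_def)
  qed
  have \<phi>_hom: "\<phi> (u + w) = \<phi> u + \<phi> w" "\<phi> (?vc c u) = ?vc c (\<phi> u)" for u w c
    by (auto simp: \<phi>_def fun_eq_iff algebra_simps)
  have U: "vec.subspace (\<phi> ` form_vecs 2 i)"
  proof (rule vec.subspaceI)
    have "0 = \<phi> 0" by (simp add: \<phi>_def fun_eq_iff)
    then show "0 \<in> \<phi> ` form_vecs 2 i" using vec.subspace_0[OF form_vecs_subspace] by blast
    show "x + y \<in> \<phi> ` form_vecs 2 i" if "x \<in> \<phi> ` form_vecs 2 i" "y \<in> \<phi> ` form_vecs 2 i" for x y
      using that vec.subspace_add[OF form_vecs_subspace] by (auto simp flip: \<phi>_hom(1))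
    show "?vc c x \<in> \<phi> ` form_vecs 2 i" if x: "x \<in> \<phi> ` form_vecs 2 i" for c x
    proof -
      obtain u where u: "x = \<phi> u" "u \<in> form_vecs 2 i" using x by (rule imageE)
      have "?vc c x = \<phi> (?vc c u)" unfolding u(1) by (rule \<phi>_hom(2)[symmetric])
      then show ?thesis using vec.subspace_scale[OF form_vecs_subspace u(2)] by blast
    qed
  qed
  have "has_qdim ?vc (\<phi> ` form_vecs 2 i) {0} (2 * card (monoms 3 i))"
  proof (rule has_qdim_transfer[OF vec.complex_space_axioms vec.complex_space_axioms vec_subspace_0
        \<phi>_hom form_vecs_subspace _ _ _ has_qdim_form_vecs])
    show "\<phi> w \<in> {0} \<longleftrightarrow> w \<in> {0}" if w: "w \<in> form_vecs 2 i" for w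
    proof
      assume "\<phi> w \<in> {0}"
      then have "w 0 * \<rho> j + w 1 * \<sigma> j = 0" for j by (simp add: \<phi>_def fun_eq_iff)
      then have "w 0 = 0 \<and> w 1 = 0"
        using w by (intro indep) (auto simp: form_vecs_def homog_eq)
      then have "w j = 0" for j
        using w by (cases "j < 2") (auto simp: form_vecs_def less_2_cases_iff)
      then show "w \<in> {0}" by (simp add: fun_eq_iff)
    qed (simp add: \<phi>_def fun_eq_iff)
  qed auto
  moreover have "\<phi> ` form_vecs 2 i \<subseteq> syz k" using in_syz by blast
  moreover have "has_qdim ?vc (syz k) {0} (2 * card (monoms 3 i))" using syz_dim_above by (simp add: k)
  ultimately have "\<phi> ` form_vecs 2 i = syz k"
    using vec.subspace_eq_if_dim_eq[OF syz_subspace U vec_subspace_0] vec.subspace_0[OF U] by simp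
  then obtain w where "w \<in> form_vecs 2 i" "v = \<phi> w" using v by blast
  then show ?thesis by (intro bexI[of _ "w 0"] bexI[of _ "w 1"]) (auto simp: \<phi>_def form_vecs_def homog_eq)
qed

text \<open>The homogeneous components of a syzygy are syzygies.\<close>

lemma all_syz_generated:
  assumes gen: "\<And>k v. v \<in> syz k \<Longrightarrow> \<exists>a\<in>poly_ring 2. \<exists>b\<in>poly_ring 2. v = (\<lambda>j. a * \<rho> j + b * \<sigma> j)"
    and v: "\<And>j. j \<le> 2 \<Longrightarrow> v j \<in> poly_ring 2" "dot v = 0"
  obtains a b where "a \<in> poly_ring 2" "b \<in> poly_ring 2" "\<forall>j\<le>2. v j = a * \<rho> j + b * \<sigma> j"
proof -
  define w where "w t = (\<lambda>j. if j \<le> 2 then hcomp t (v j) else 0)" for t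
  have "w t \<in> syz t" for t
  proof -
    have "dot (w t) = dot (\<lambda>j. hcomp t (v j))" by (simp add: dot_def w_def)
    also have "\<dots> = 0" using hcomp_dot[of t v] v(2) by simp
    finally show ?thesis
      using v(1) by (auto simp: syz_def form_vecs_def w_def homog_eq hcomp_in_forms poly_ring_hcomp)
  qed
  then have "\<forall>t. \<exists>a b. a \<in> poly_ring 2 \<and> b \<in> poly_ring 2 \<and> w t = (\<lambda>j. a * \<rho> j + b * \<sigma> j)"
    using gen by blast
  from choice[OF this] obtain a where
    "\<forall>t. \<exists>b. a t \<in> poly_ring 2 \<and> b \<in> poly_ring 2 \<and> w t = (\<lambda>j. a t * \<rho> j + b * \<sigma> j)" by blast
  from choice[OF this] obtain b where
    ab: "\<And>t. a t \<in> poly_ring 2" "\<And>t. b t \<in> poly_ring 2" "\<And>t. w t = (\<lambda>j. a t * \<rho> j + b t * \<sigma> j)" by blast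
  define T where "T = (\<Union>j\<le>2::nat. mdeg ` keys (v j))"
  show ?thesis
  proof (rule that[of "\<Sum>t\<in>T. a t" "\<Sum>t\<in>T. b t"])
    show "(\<Sum>t\<in>T. a t) \<in> poly_ring 2" "(\<Sum>t\<in>T. b t) \<in> poly_ring 2"
      using ab by (auto intro: poly_ring_sum)
    show "\<forall>j\<le>2. v j = (\<Sum>t\<in>T. a t) * \<rho> j + (\<Sum>t\<in>T. b t) * \<sigma> j"
    proof (intro allI impI)
      fix j :: nat assume j: "j \<le> 2"
      have "v j = (\<Sum>t\<in>T. hcomp t (v j))"
        using j by (intro sum_hcomp_superset[symmetric]) (auto simp: T_def)
      also have "\<dots> = (\<Sum>t\<in>T. a t * \<rho> j + b t * \<sigma> j)"
        using j fun_cong[OF ab(3), of _ j] by (intro sum.cong) (auto simp: w_def)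
      finally show "v j = (\<Sum>t\<in>T. a t) * \<rho> j + (\<Sum>t\<in>T. b t) * \<sigma> j"
        by (simp add: sum.distrib sum_distrib_right)
    qed
  qed
qed

end

section \<open>Saturation of the Jacobian ideal\<close>

text \<open>
  The variable \<open>x\<^sub>2\<close> is a nonzerodivisor modulo \<open>x\<^sub>0, x\<^sub>1\<close>; truncation keeps the cofactors in the ring.
\<close>

lemma variable_relation_coefficient:
  assumes p: "p \<in> poly_ring n" and n: "n \<ge> 2"
    and rel: "Var 0 * a + Var 1 * b + Var 2 * p = 0"
  obtains u w where "u \<in> poly_ring n" "w \<in> poly_ring n" "p = Var 0 * u + Var 1 * w"
proof -
  have gens: "Var 0 \<in> ideal.span (Var ` {0, 1})" "Var 1 \<in> ideal.span (Var ` {0, 1})"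
    by (auto intro: ideal.span_base)
  have "Var 2 * p = - (Var 0 * a + Var 1 * b)"
    using rel by (simp only: add_eq_0_iff)
  also have "\<dots> \<in> ideal.span (Var ` {0, 1})"
    by (intro ideal.span_neg ideal.span_add ideal_mult_right gens)
  finally have "p \<in> ideal.span (Var ` {0, 1})"
    using nzd_mod_Var[of 2 "{0, 1}"] unfolding nzd_mod_def by simp
  then have "p \<in> ideal.span {Var 0, Var 1}" by simp
  then obtain u where "p - u * Var 0 \<in> ideal.span {Var 1}" unfolding ideal.span_insert by blast
  then obtain w where "p - u * Var 0 = w * Var 1" by (auto simp: ideal.span_singleton)
  then have "p = Var 0 * u + Var 1 * w" by (simp add: algebra_simps)
  from arg_cong[OF this, of "trunc n"]
  have "p = Var 0 * trunc n u + Var 1 * trunc n w"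
    using n by (simp add: trunc_id[OF p] trunc_add trunc_mult trunc_id[OF poly_ring_Var])
  then show ?thesis using that[OF trunc_in_poly_ring trunc_in_poly_ring] by blast
qed

lemma divisible_by_first_variable:
  assumes b: "b \<in> poly_ring n" and eq: "Var 0 * a = Var 1 * b"
  obtains c where "c \<in> poly_ring n" "b = Var 0 * c"
proof -
  have "Var 1 * b \<in> ideal.span (Var ` {0})"
    unfolding eq[symmetric] by (intro ideal_mult_right ideal.span_base) simp
  then have "b \<in> ideal.span (Var ` {0})"
    using nzd_mod_Var[of 1 "{0}"] unfolding nzd_mod_def by simp
  then have "b \<in> ideal.span {Var 0}" by simp
  then obtain c where "b = Var 0 * c" by (auto simp: ideal.span_singleton mult.commute)
  from arg_cong[OF this, of "trunc n"] have "b = Var 0 * trunc n c"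
    by (simp add: trunc_id[OF b] trunc_mult trunc_id[OF poly_ring_Var])
  then show ?thesis using that[OF trunc_in_poly_ring] by blast
qed

context plane_threshold_gap
begin

text \<open>
  Write \<open>x\<^sub>i h\<close> as the image of a vector \<open>A i\<close>.  The vectors \<open>E i l = x\<^sub>i A l - x\<^sub>l A i\<close> are syzygies,
  \<open>E i l = p \<rho> + q \<sigma>\<close>.  Identically \<open>x\<^sub>0 E 1 2 - x\<^sub>1 E 0 2 + x\<^sub>2 E 0 1 = 0\<close>, so by independence of \<open>\<rho>, \<sigma>\<close> the
  same relation holds for the coefficients \<open>p\<close> and \<open>q\<close>.  It puts the coefficients of \<open>E 0 1\<close> into the ideal
  \<open>(x\<^sub>0, x\<^sub>1)\<close>, which allows changing \<open>A 0\<close> and \<open>A 1\<close> by syzygies to \<open>B0\<close> and \<open>B1\<close> with \<open>x\<^sub>0 B1 = x\<^sub>1 B0\<close>.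
  Then \<open>B0\<close> is divisible by \<open>x\<^sub>0\<close>, and the quotient is a vector with image \<open>h\<close>.
\<close>

lemma jacobian_socle:
  assumes h: "h \<in> poly_ring 2" "\<And>i. i \<le> 2 \<Longrightarrow> Var i * h \<in> jacobian_ideal 2 f"
  shows "h \<in> jacobian_ideal 2 f"
proof -
  obtain \<rho> \<sigma> where rs: "\<rho> \<in> syz m" "\<sigma> \<in> syz m"
    and lin: "\<And>\<alpha> \<beta>. (\<lambda>j. Const \<alpha> * \<rho> j + Const \<beta> * \<sigma> j) = (\<lambda>_. 0) \<Longrightarrow> \<alpha> = 0 \<and> \<beta> = 0"
    by (rule syz_basis) blast
  have indep: "a = 0 \<and> b = 0"
    if "a \<in> poly_ring 2" "b \<in> poly_ring 2" "\<And>j. j \<le> 2 \<Longrightarrow> a * \<rho> j + b * \<sigma> j = 0" for a b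
    by (rule syz_independent[OF rs lin that])
  have gen: "\<exists>a\<in>poly_ring 2. \<exists>b\<in>poly_ring 2. v = (\<lambda>j. a * \<rho> j + b * \<sigma> j)" if "v \<in> syz k" for k v
    by (rule syz_generated[OF rs indep that])
  have R: "\<rho> j \<in> poly_ring 2" "\<sigma> j \<in> poly_ring 2" for j
    using rs by (cases "j < 3"; auto simp: syz_def form_vecs_def homog_eq)+
  have dot_rs: "dot (\<lambda>j. a * \<rho> j + b * \<sigma> j) = 0" for a b
    using rs by (simp add: dot_add' dot_scale syz_def)
  have "\<forall>i. \<exists>v. i \<le> 2 \<longrightarrow> (\<forall>j\<le>2. v j \<in> poly_ring 2) \<and> Var i * h = dot v"
    using h(2) by (auto simp: jacobian_ideal_iff)
  from choice[OF this] obtain A where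
    A: "\<And>i j. i \<le> 2 \<Longrightarrow> j \<le> 2 \<Longrightarrow> A i j \<in> poly_ring 2" "\<And>i. i \<le> 2 \<Longrightarrow> Var i * h = dot (A i)"
    by blast
  define E where "E i l j = Var i * A l j - Var l * A i j" for i l j :: nat
  have E: "\<exists>p q. p \<in> poly_ring 2 \<and> q \<in> poly_ring 2 \<and> (\<forall>j\<le>2. E i l j = p * \<rho> j + q * \<sigma> j)"
    if il: "i \<le> 2" "l \<le> 2" for i l
  proof -
    have ev: "E i l j \<in> poly_ring 2" if "j \<le> 2" for j
      using il that by (auto simp: E_def intro!: poly_ring_diff poly_ring_mult poly_ring_Var A)
    have ed: "dot (E i l) = 0"
    proof -
      have "E i l = (\<lambda>j. Var i * A l j - Var l * A i j)" by (rule ext) (rule E_def)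
      then have "dot (E i l) = Var i * (Var l * h) - Var l * (Var i * h)"
        by (simp only: dot_diff' dot_scale A(2)[OF il(1)] A(2)[OF il(2)])
      then show ?thesis by (simp add: mult.left_commute)
    qed
    obtain p q where "p \<in> poly_ring 2" "q \<in> poly_ring 2" "\<forall>j\<le>2. E i l j = p * \<rho> j + q * \<sigma> j"
      by (rule all_syz_generated[OF gen ev ed])
    then show ?thesis by blast
  qed
  obtain p01 q01 where E01: "p01 \<in> poly_ring 2" "q01 \<in> poly_ring 2"
    "\<forall>j\<le>2. E 0 1 j = p01 * \<rho> j + q01 * \<sigma> j" using E[of 0 1] by auto
  obtain p02 q02 where E02: "p02 \<in> poly_ring 2" "q02 \<in> poly_ring 2"
    "\<forall>j\<le>2. E 0 2 j = p02 * \<rho> j + q02 * \<sigma> j" using E[of 0 2] by auto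
  obtain p12 q12 where E12: "p12 \<in> poly_ring 2" "q12 \<in> poly_ring 2"
    "\<forall>j\<le>2. E 1 2 j = p12 * \<rho> j + q12 * \<sigma> j" using E[of 1 2] by auto
  let ?P = "Var 0 * p12 + Var 1 * (- p02) + Var 2 * p01"
  let ?Q = "Var 0 * q12 + Var 1 * (- q02) + Var 2 * q01"
  have "?P = 0 \<and> ?Q = 0"
  proof (rule indep)
    show "?P \<in> poly_ring 2" "?Q \<in> poly_ring 2"
      using E01 E02 E12 by (auto intro!: poly_ring_add poly_ring_diff poly_ring_mult poly_ring_Var)
    fix j :: nat assume j: "j \<le> 2"
    have "?P * \<rho> j + ?Q * \<sigma> j =
        Var 0 * (p12 * \<rho> j + q12 * \<sigma> j) - Var 1 * (p02 * \<rho> j + q02 * \<sigma> j) +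
        Var 2 * (p01 * \<rho> j + q01 * \<sigma> j)"
      by (simp add: algebra_simps)
    also have "\<dots> = Var 0 * E 1 2 j - Var 1 * E 0 2 j + Var 2 * E 0 1 j"
      using E01(3) E02(3) E12(3) j by simp
    also have "\<dots> = 0" unfolding E_def by (simp add: algebra_simps)
    finally show "?P * \<rho> j + ?Q * \<sigma> j = 0" .
  qed
  then have P0: "?P = 0" and Q0: "?Q = 0" by simp_all
  obtain u1 u0 where u: "u1 \<in> poly_ring 2" "u0 \<in> poly_ring 2" "p01 = Var 0 * u1 + Var 1 * u0"
    by (rule variable_relation_coefficient[OF E01(1) order_refl P0])
  obtain w1 w0 where w: "w1 \<in> poly_ring 2" "w0 \<in> poly_ring 2" "q01 = Var 0 * w1 + Var 1 * w0"
    by (rule variable_relation_coefficient[OF E01(2) order_refl Q0])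
  define B0 where "B0 = (\<lambda>j. A 0 j + (u0 * \<rho> j + w0 * \<sigma> j))"
  define B1 where "B1 j = A 1 j - (u1 * \<rho> j + w1 * \<sigma> j)" for j
  have "\<exists>c. c \<in> poly_ring 2 \<and> B0 j = Var 0 * c" if j: "j \<le> 2" for j
  proof -
    have "E 0 1 j = (Var 0 * u1 + Var 1 * u0) * \<rho> j + (Var 0 * w1 + Var 1 * w0) * \<sigma> j"
      using E01(3) j u(3) w(3) by simp
    then have "Var 0 * B1 j = Var 1 * B0 j"
      unfolding E_def B0_def B1_def by (simp add: algebra_simps)
    moreover have "B0 j \<in> poly_ring 2"
      using A(1)[of 0 j] j u w R by (auto simp: B0_def intro!: poly_ring_add poly_ring_mult)
    ultimately show ?thesis using divisible_by_first_variable by metis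
  qed
  then have "\<forall>j. \<exists>c. j \<le> 2 \<longrightarrow> c \<in> poly_ring 2 \<and> B0 j = Var 0 * c" by blast
  from choice[OF this] obtain c where c: "\<And>j. j \<le> 2 \<Longrightarrow> c j \<in> poly_ring 2" "\<And>j. j \<le> 2 \<Longrightarrow> B0 j = Var 0 * c j"
    by blast
  have "Var 0 * h = dot (A 0) + dot (\<lambda>j. u0 * \<rho> j + w0 * \<sigma> j)" using A(2)[of 0] dot_rs by simp
  also have "\<dots> = dot B0" unfolding dot_add'[symmetric] B0_def ..
  also have "\<dots> = dot (\<lambda>j. Var 0 * c j)" unfolding dot_def using c(2) by (intro sum.cong) auto
  also have "\<dots> = Var 0 * dot c" by (rule dot_scale)
  finally have "h = dot c" by simp
  then show ?thesis using c(1) by (auto simp: jacobian_ideal_iff)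
qed

lemma jacobian_saturated: "jacobian_ideal 2 f = saturation 2 (jacobian_ideal 2 f)"
proof (intro equalityI subsetI)
  fix h assume h: "h \<in> jacobian_ideal 2 f"
  then have "g * h \<in> jacobian_ideal 2 f" if "g \<in> homog 2 0" for g
    using that by (auto simp: jacobian_ideal_eq[OF f] homog_eq poly_ring_mult ideal_mult_left)
  then show "h \<in> saturation 2 (jacobian_ideal 2 f)"
    using h by (auto simp: saturation_def jacobian_ideal_eq[OF f])
next
  fix h assume "h \<in> saturation 2 (jacobian_ideal 2 f)"
  then obtain k where h: "h \<in> poly_ring 2" and k: "\<forall>g\<in>homog 2 k. g * h \<in> jacobian_ideal 2 f"
    by (auto simp: saturation_def)
  from k show "h \<in> jacobian_ideal 2 f"
  proof (induction k)
    case 0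
    have "1 \<in> homog 2 0" by (simp add: homog_eq forms_one)
    then show ?case using 0 by fastforce
  next
    case (Suc k)
    have "g * h \<in> jacobian_ideal 2 f" if g: "g \<in> homog 2 k" for g
    proof (rule jacobian_socle)
      show "g * h \<in> poly_ring 2" using g h by (simp add: homog_eq poly_ring_mult)
      fix i :: nat assume "i \<le> 2"
      then have "Var i \<in> homog 2 1" unfolding homog_eq using forms_Var poly_ring_Var by blast
      from homog_mult[OF this g] have "Var i * g \<in> homog 2 (Suc k)" by simp
      then show "Var i * (g * h) \<in> jacobian_ideal 2 f" using Suc.prems by (simp flip: mult.assoc)
    qed
    then show ?case using Suc.IH by blast
  qed
qed

end

theorem theorem2p1:
  fixes n d :: nat and f fs :: mpoly and T :: real
  assumes "n \<ge> 1"
    and "f \<in> homog n d"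
    and "sing_points n f \<noteq> {}"
    and "\<forall>v\<in>sing_points n f. isolated_sing n f v"
    and "fs \<in> homog n d"
    and "sing_points n fs = {}"
    and "T = (real n + 1) * (real d - 2)"
    and "stability_threshold n f < coincidence_threshold n f fs"
  shows "(odd d \<and>
          ereal_of_enat (coincidence_threshold n f fs) = ereal ((T + 1) / 2) \<and>
          ereal_of_enat (stability_threshold n f) = ereal ((T - 1) / 2)) \<and>
         (n = 2 \<longrightarrow> free_plane_curve f)"
proof (intro conjI impI)
  interpret threshold_gap n d f fs
    using assms by unfold_locales
  obtain q where q: "2 * q + 1 = Suc n * (d - 2)"
    "stability_threshold n f = enat q" "coincidence_threshold n f fs = enat (Suc q)"
    using thresholds by metis
  have "odd (Suc n * (d - 2))" unfolding q(1)[symmetric] by simp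
  then have "odd (d - 2)" unfolding even_mult_iff by blast
  then show "odd d" using d_ge_2 by simp
  have "real (2 * q + 1) = T"
    unfolding q(1) assms(7) by (simp only: of_nat_mult of_nat_diff[OF d_ge_2]) simp
  then have T: "T = 2 * real q + 1" by simp
  show "ereal_of_enat (coincidence_threshold n f fs) = ereal ((T + 1) / 2)"
    by (simp add: q(3) T)
  show "ereal_of_enat (stability_threshold n f) = ereal ((T - 1) / 2)"
    by (simp add: q(2) T)
next
  assume "n = 2"
  then interpret plane_threshold_gap d f fs
    using assms by (intro plane_threshold_gap.intro threshold_gap.intro) auto
  show "free_plane_curve f" unfolding free_plane_curve_def by (rule jacobian_saturated)
qed

end
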